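(* Let $(M_1,g_1)$ and $(M_2,g_2)$ be two compact Riemannian manifolds and let $M:=M_1\times M_2$ be their Riemannian product. Let $h\in\Gamma(\mathrm{Sym}^2_0(TM))$ be a trace-free conformal Killing tensor. Then there exist Killing tensors $K_i\in\Gamma(\mathrm{Sym}^2(TM_i))$, $i=1,2$, and Killing vector fields $\xi_1,\ldots,\xi_k$ on $M_1$ and $\zeta_1,\ldots,\zeta_k$ on $M_2$ such that $$h=(K_1+K_2)_0+\sum_{i=1}^k\xi_i\cdot\zeta_i .$$ Conversely, every such tensor on $M$ is a trace-free conformal Killing tensor.
   Context: All objects are smooth, and $M=M_1\times M_2$ carries the product metric $g=g_1+g_2$. For a Riemannian manifold $(N,g)$ with Levi-Civita connection $\nabla$, $TN$ and $T^*N$ are identified via $g$, and $\mathrm{Sym}^pTN\subset TN^{\otimes p}$ is spanned by the symmetrized products $v_1\cdot\ldots\cdot v_p:=\sum_{\sigma\in S_p}v_{\sigma(1)}\otimes\ldots\otimes v_{\sigma(p)}$; these define a commutative graded product on $\bigoplus_p\mathrm{Sym}^pTN$ (so $v\cdot u=v\otimes u+u\otimes v$). For a tangent vector $v$, $v\lrcorner:\mathrm{Sym}^{p+1}TN\to\mathrm{Sym}^pTN$ is the derivation of this product with $v\lrcorner\,u=g(v,u)$. With $\{e_i\}$ a local orthonormal frame: $\Lambda K=\sum_i e_i\lrcorner\, e_i\lrcorner\, K$, $\mathrm{L}K=\sum_i e_i\cdot e_i\cdot K$ $(=2g\cdot K)$, $\mathrm{Sym}^p_0TN=\ker\Lambda$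 (trace-free tensors), and $\mathrm{d}K=\sum_i e_i\cdot\nabla_{e_i}K\in\Gamma(\mathrm{Sym}^{p+1}TN)$. A tensor $K\in\Gamma(\mathrm{Sym}^pTN)$ is a Killing tensor if $\mathrm{d}K=0$ (for $p=1$: a Killing vector field), and a conformal Killing tensor if $\mathrm{d}K=\mathrm{L}(k)$ for some $k\in\Gamma(\mathrm{Sym}^{p-1}TN)$. The subscript $0$ denotes the projection onto the trace-free part: for $K\in\Gamma(\mathrm{Sym}^2TN)$ with $n=\dim N$, $K_0=K-\frac{\mathrm{tr}(K)}{n}g$. Tensors and vector fields on the factors $M_i$ are identified with their pull-backs to $M$ via the projections $\pi_i:M\to M_i$ and the splitting $TM=\pi_1^*TM_1\oplus\pi_2^*TM_2$.
   Formalization: The two manifolds are taken to have dimension at least 1, and for the existence of the decomposition (not for the converse) both are assumed connected; without these assumptions the decomposition can fail. *)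

theory Defs
  imports "HOL-Analysis.Analysis" "HOL-Library.Multiset"
begin

section \<open>Smooth manifolds\<close>

primrec C_k_on :: "nat \<Rightarrow> 'e::euclidean_space set \<Rightarrow> ('e \<Rightarrow> 'f::euclidean_space) \<Rightarrow> bool" where
  "C_k_on 0 S f \<longleftrightarrow> continuous_on S f"
| "C_k_on (Suc k) S f \<longleftrightarrow> (\<forall>x\<in>S. f differentiable (at x)) \<and>
     (\<forall>v. C_k_on k S (\<lambda>x. frechet_derivative f (at x) v))"

text \<open>Only used for open sets.\<close>

definition smooth_on :: "'e::euclidean_space set \<Rightarrow> ('e \<Rightarrow> 'f::euclidean_space) \<Rightarrow> bool" where
  "smooth_on S f \<longleftrightarrow> (\<forall>k. C_k_on k S f)"

text \<open>
  A manifold is the whole of a Hausdorff type, with a smooth atlas indexed by the points: \<open>A x\<close> is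
  a chart (domain and coordinate map) around \<open>x\<close>. Every smooth structure arises in this
  way, by choosing for each point a chart around it. The choice identifies each tangent space
  \<open>T\<^sub>x\<close> with the model space \<open>'e\<close>, through the chart \<open>A x\<close>; so vector fields and tensor
  fields below are plain functions of the point. Second countability is not asked for, as all
  manifolds considered will be compact. Since \<open>DIM('e) \<ge> 1\<close>, there are no manifolds of dimension 0.
\<close>

type_synonym ('a, 'e) atlas = "'a \<Rightarrow> 'a set \<times> ('a \<Rightarrow> 'e)"

definition chart_dom :: "('a, 'e) atlas \<Rightarrow> 'a \<Rightarrow> 'a set" where
  "chart_dom A x = fst (A x)"

definition chart_map :: "('a, 'e) atlas \<Rightarrow> 'a \<Rightarrow> 'a \<Rightarrow> 'e" where
  "chart_map A x = snd (A x)"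

definition chart_inv :: "('a, 'e) atlas \<Rightarrow> 'a \<Rightarrow> 'e \<Rightarrow> 'a" where
  "chart_inv A x = inv_into (chart_dom A x) (chart_map A x)"

definition smooth_atlas :: "('a::t2_space, 'e::euclidean_space) atlas \<Rightarrow> bool" where
  "smooth_atlas A \<longleftrightarrow>
     (\<forall>x. x \<in> chart_dom A x \<and> open (chart_dom A x) \<and> open (chart_map A x ` chart_dom A x) \<and>
        homeomorphism (chart_dom A x) (chart_map A x ` chart_dom A x) (chart_map A x) (chart_inv A x)) \<and>
     (\<forall>x y. smooth_on (chart_map A x ` (chart_dom A x \<inter> chart_dom A y))
        (chart_map A y \<circ> chart_inv A x))"


section \<open>Symmetric tensors\<close>

text \<open>
  As \<open>TN\<close> and \<open>T\<^sup>*N\<close> are identified through the metric, an element of \<open>Sym\<^sup>p T\<^sub>xN\<close> is taken to be a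
  symmetric \<open>p\<close>-linear form on \<open>T\<^sub>xN\<close>. It is a function of the list of its arguments, and vanishes on
  lists of length other than \<open>p\<close>, so that equality of tensors is equality of functions.
\<close>

type_synonym 'e tensor = "'e list \<Rightarrow> real"

definition sym_tensors :: "nat \<Rightarrow> 'e::euclidean_space tensor set" where
  "sym_tensors p = {S.
     (\<forall>Xs. length Xs \<noteq> p \<longrightarrow> S Xs = 0) \<and>
     (\<forall>Xs i. length Xs = p \<longrightarrow> i < p \<longrightarrow> linear (\<lambda>v. S (Xs[i := v]))) \<and>
     (\<forall>Xs Ys. mset Xs = mset Ys \<longrightarrow> S Xs = S Ys)}"

text \<open>The vector \<open>v\<close> as an element of \<open>Sym\<^sup>1\<close>, for the scalar product \<open>G\<close>.\<close>

definition flat :: "'e tensor \<Rightarrow> 'e \<Rightarrow> 'e tensor" where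
  "flat G v = (\<lambda>Xs. case Xs of [X] \<Rightarrow> G [v, X] | _ \<Rightarrow> 0)"

text \<open>
  The product \<open>A \<cdot> B\<close> of \<open>\<Oplus>\<^sub>p Sym\<^sup>p\<close>: the sum over all ways of distributing the arguments over the
  two factors, without any normalising factor. This is the product for which
  \<open>v\<^sub>1 \<cdot> \<dots> \<cdot> v\<^sub>p = \<Sum>\<^sub>\<sigma> v\<^bsub>\<sigma>(1)\<^esub> \<otimes> \<dots> \<otimes> v\<^bsub>\<sigma>(p)\<^esub>\<close>.
\<close>

definition sym_prod :: "'e tensor \<Rightarrow> 'e tensor \<Rightarrow> 'e tensor" (infixr "\<odot>" 70) where
  "A \<odot> B = (\<lambda>Xs. \<Sum>I \<in> Pow {..<length Xs}. A (nths Xs I) * B (nths Xs (- I)))"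

text \<open>\<open>v \<lrcorner> S\<close>; see the lemmas \<open>contract_flat\<close> and \<open>contract_sym_prod\<close>.\<close>

definition contract :: "'e \<Rightarrow> 'e tensor \<Rightarrow> 'e tensor" where
  "contract v S = (\<lambda>Xs. S (v # Xs))"

text \<open>
  The operators \<open>\<Lambda>\<close>, \<open>L\<close> and \<open>d\<close> are expressed in some orthonormal basis; they do not depend on it.
\<close>

definition orthonormal_basis :: "'e::euclidean_space tensor \<Rightarrow> 'e set \<Rightarrow> bool" where
  "orthonormal_basis G E \<longleftrightarrow> finite E \<and> card E = DIM('e) \<and>
     (\<forall>u\<in>E. \<forall>v\<in>E. G [u, v] = (if u = v then 1 else 0))"

definition onb :: "'e::euclidean_space tensor \<Rightarrow> 'e set" where
  "onb G = (SOME E. orthonormal_basis G E)"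

definition Lambda_op :: "'e::euclidean_space tensor \<Rightarrow> 'e tensor \<Rightarrow> 'e tensor" where
  "Lambda_op G S = (\<lambda>Xs. \<Sum>e\<in>onb G. contract e (contract e S) Xs)"

definition L_op :: "'e::euclidean_space tensor \<Rightarrow> 'e tensor \<Rightarrow> 'e tensor" where
  "L_op G S = (\<lambda>Xs. \<Sum>e\<in>onb G. (flat G e \<odot> flat G e \<odot> S) Xs)"

text \<open>\<open>S\<^sub>0\<close> for \<open>S \<in> Sym\<^sup>2\<close>; the trace \<open>\<Lambda> S \<in> Sym\<^sup>0\<close> is evaluated at the empty list.\<close>

definition trace_free_part :: "'e::euclidean_space tensor \<Rightarrow> 'e tensor \<Rightarrow> 'e tensor" where
  "trace_free_part G S = (\<lambda>Xs. S Xs - Lambda_op G S [] / real DIM('e) * G Xs)"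


section \<open>Tensor fields and Riemannian metrics\<close>

type_synonym ('a, 'e) tensor_field = "'a \<Rightarrow> 'e tensor"

text \<open>
  The components of \<open>K\<close> in the chart around \<open>x\<close>, at the coordinates \<open>z\<close>. At the point \<open>q\<close> with these
  coordinates, the tangent space is identified with \<open>'e\<close> through the chart around \<open>q\<close>, hence the
  derivative of the change of coordinates.
\<close>

definition local_rep ::
  "('a, 'e::euclidean_space) atlas \<Rightarrow> ('a, 'e) tensor_field \<Rightarrow> 'a \<Rightarrow> 'e \<Rightarrow> 'e tensor" where
  "local_rep A K x z = (\<lambda>Xs. let q = chart_inv A x z in
     K q (map (frechet_derivative (chart_map A q \<circ> chart_inv A x) (at z)) Xs))"

text \<open>\<open>K \<in> \<Gamma>(Sym\<^sup>p TN)\<close>\<close>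

definition sym_tensor_field ::
  "('a, 'e::euclidean_space) atlas \<Rightarrow> nat \<Rightarrow> ('a, 'e) tensor_field \<Rightarrow> bool" where
  "sym_tensor_field A p K \<longleftrightarrow> (\<forall>x. K x \<in> sym_tensors p) \<and>
     (\<forall>x Xs. length Xs = p \<longrightarrow>
        smooth_on (chart_map A x ` chart_dom A x) (\<lambda>z. local_rep A K x z Xs))"

definition riemannian_metric ::
  "('a, 'e::euclidean_space) atlas \<Rightarrow> ('a, 'e) tensor_field \<Rightarrow> bool" where
  "riemannian_metric A g \<longleftrightarrow> sym_tensor_field A 2 g \<and> (\<forall>x v. v \<noteq> 0 \<longrightarrow> g x [v, v] > 0)"

definition riemannian_manifold ::
  "('a::t2_space, 'e::euclidean_space) atlas \<Rightarrow> ('a, 'e) tensor_field \<Rightarrow> bool" where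
  "riemannian_manifold A g \<longleftrightarrow> smooth_atlas A \<and> riemannian_metric A g"


section \<open>The Levi-Civita connection\<close>

text \<open>
  The partial derivative at \<open>x\<close>, in direction \<open>v\<close>, of the components of \<open>K\<close> in the chart around \<open>x\<close>.
\<close>

definition coord_deriv ::
  "('a, 'e::euclidean_space) atlas \<Rightarrow> ('a, 'e) tensor_field \<Rightarrow> 'a \<Rightarrow> 'e \<Rightarrow> 'e tensor" where
  "coord_deriv A K x v =
     (\<lambda>Xs. frechet_derivative (\<lambda>z. local_rep A K x z Xs) (at (chart_map A x x)) v)"

text \<open>
  The Christoffel symbols \<open>\<Gamma>\<^sub>x(v, w)\<close> of the chart around \<open>x\<close>, given by the Koszul formula. That the
  connection is the torsion-free metric one is \<open>christoffel_commute\<close> and \<open>nabla_metric\<close> below.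
\<close>

definition christoffel ::
  "('a, 'e::euclidean_space) atlas \<Rightarrow> ('a, 'e) tensor_field \<Rightarrow> 'a \<Rightarrow> 'e \<Rightarrow> 'e \<Rightarrow> 'e" where
  "christoffel A g x v w = (THE u. \<forall>y. 2 * g x [u, y] =
     coord_deriv A g x v [w, y] + coord_deriv A g x w [v, y] - coord_deriv A g x y [v, w])"

text \<open>\<open>\<nabla>\<^sub>v K\<close> at \<open>x\<close>\<close>

definition nabla ::
  "('a, 'e::euclidean_space) atlas \<Rightarrow> ('a, 'e) tensor_field \<Rightarrow> 'a \<Rightarrow> 'e \<Rightarrow> ('a, 'e) tensor_field
     \<Rightarrow> 'e tensor" where
  "nabla A g x v K = (\<lambda>Xs. coord_deriv A K x v Xs -
     (\<Sum>j<length Xs. K x (Xs[j := christoffel A g x v (Xs ! j)])))"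

text \<open>\<open>d K = \<Sum>\<^sub>i e\<^sub>i \<cdot> \<nabla>\<^bsub>e\<^sub>i\<^esub> K\<close>\<close>

definition d_op ::
  "('a, 'e::euclidean_space) atlas \<Rightarrow> ('a, 'e) tensor_field \<Rightarrow> ('a, 'e) tensor_field
     \<Rightarrow> ('a, 'e) tensor_field" where
  "d_op A g K = (\<lambda>x Xs. \<Sum>e\<in>onb (g x). (flat (g x) e \<odot> nabla A g x e K) Xs)"


section \<open>Killing tensors and conformal Killing tensors\<close>

definition killing_tensor ::
  "('a, 'e::euclidean_space) atlas \<Rightarrow> ('a, 'e) tensor_field \<Rightarrow> nat \<Rightarrow> ('a, 'e) tensor_field \<Rightarrow> bool"
where
  "killing_tensor A g p K \<longleftrightarrow> sym_tensor_field A p K \<and> (\<forall>x Xs. d_op A g K x Xs = 0)"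

text \<open>
  A vector field is a map \<open>\<xi> :: 'a \<Rightarrow> 'e\<close>. It is smooth iff \<open>\<lambda>x. flat (g x) (\<xi> x)\<close> is.
\<close>

definition killing_vector_field ::
  "('a, 'e::euclidean_space) atlas \<Rightarrow> ('a, 'e) tensor_field \<Rightarrow> ('a \<Rightarrow> 'e) \<Rightarrow> bool" where
  "killing_vector_field A g \<xi> \<longleftrightarrow> killing_tensor A g 1 (\<lambda>x. flat (g x) (\<xi> x))"

text \<open>
  For \<open>p = 0\<close> the truncated \<open>p - 1\<close> does no harm: \<open>d K\<close> and \<open>L k\<close> then have degrees 1 and 2, so
  that the condition becomes \<open>d K = 0\<close>, as \<open>Sym\<^sup>-\<^sup>1 = 0\<close> requires.
\<close>

definition conformal_killing_tensor ::
  "('a, 'e::euclidean_space) atlas \<Rightarrow> ('a, 'e) tensor_field \<Rightarrow> nat \<Rightarrow> ('a, 'e) tensor_field \<Rightarrow> bool"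
where
  "conformal_killing_tensor A g p K \<longleftrightarrow> sym_tensor_field A p K \<and>
     (\<exists>k. sym_tensor_field A (p - 1) k \<and> (\<forall>x. d_op A g K x = L_op (g x) (k x)))"

definition trace_free :: "('a, 'e::euclidean_space) tensor_field \<Rightarrow> ('a, 'e) tensor_field \<Rightarrow> bool" where
  "trace_free g K \<longleftrightarrow> (\<forall>x Xs. Lambda_op (g x) (K x) Xs = 0)"


section \<open>Riemannian products\<close>

text \<open>
  With the product charts, \<open>T\<^bsub>(x,y)\<^esub>(M\<^sub>1 \<times> M\<^sub>2) = T\<^sub>xM\<^sub>1 \<oplus> T\<^sub>yM\<^sub>2\<close> becomes the identity of
  \<open>'e \<times> 'f\<close>, and the differentials of the two projections become \<open>fst\<close> and \<open>snd\<close>.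
\<close>

definition product_atlas :: "('a, 'e) atlas \<Rightarrow> ('b, 'f) atlas \<Rightarrow> ('a \<times> 'b, 'e \<times> 'f) atlas" where
  "product_atlas A B = (\<lambda>(x, y). (chart_dom A x \<times> chart_dom B y,
     \<lambda>(p, q). (chart_map A x p, chart_map B y q)))"

definition pullback1 :: "('a, 'e) tensor_field \<Rightarrow> ('a \<times> 'b, 'e \<times> 'f) tensor_field" where
  "pullback1 K = (\<lambda>(x, y) Xs. K x (map fst Xs))"

definition pullback2 :: "('b, 'f) tensor_field \<Rightarrow> ('a \<times> 'b, 'e \<times> 'f) tensor_field" where
  "pullback2 K = (\<lambda>(x, y) Xs. K y (map snd Xs))"

definition pullback_vf1 :: "('a \<Rightarrow> 'e) \<Rightarrow> 'a \<times> 'b \<Rightarrow> 'e \<times> 'f::zero" where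
  "pullback_vf1 \<xi> = (\<lambda>(x, y). (\<xi> x, 0))"

definition pullback_vf2 :: "('b \<Rightarrow> 'f) \<Rightarrow> 'a \<times> 'b \<Rightarrow> 'e::zero \<times> 'f" where
  "pullback_vf2 \<zeta> = (\<lambda>(x, y). (0, \<zeta> y))"

definition product_metric ::
  "('a, 'e) tensor_field \<Rightarrow> ('b, 'f) tensor_field \<Rightarrow> ('a \<times> 'b, 'e \<times> 'f) tensor_field" where
  "product_metric g1 g2 = (\<lambda>z Xs. pullback1 g1 z Xs + pullback2 g2 z Xs)"

text \<open>The tensor field \<open>(K\<^sub>1 + K\<^sub>2)\<^sub>0 + \<Sum>\<^bsub>i<k\<^esub> \<xi>\<^sub>i \<cdot> \<zeta>\<^sub>i\<close> on \<open>M\<^sub>1 \<times> M\<^sub>2\<close>.\<close>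

definition killing_sum ::
  "('a, 'e::euclidean_space) tensor_field \<Rightarrow> ('b, 'f::euclidean_space) tensor_field \<Rightarrow>
   ('a, 'e) tensor_field \<Rightarrow> ('b, 'f) tensor_field \<Rightarrow> nat \<Rightarrow> (nat \<Rightarrow> 'a \<Rightarrow> 'e) \<Rightarrow> (nat \<Rightarrow> 'b \<Rightarrow> 'f) \<Rightarrow>
   ('a \<times> 'b, 'e \<times> 'f) tensor_field" where
  "killing_sum g1 g2 K1 K2 k \<xi> \<zeta> = (\<lambda>z Xs. let G = product_metric g1 g2 z in
     trace_free_part G (\<lambda>Ys. pullback1 K1 z Ys + pullback2 K2 z Ys) Xs +
     (\<Sum>i<k. (flat G (pullback_vf1 (\<xi> i) z) \<odot> flat G (pullback_vf2 (\<zeta> i) z)) Xs))"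


section \<open>Consistency of the conventions\<close>

lemma sum_Pow_lessThan_Suc:
  fixes f :: "nat set \<Rightarrow> real"
  shows "(\<Sum>I\<in>Pow {..<Suc n}. f I) =
    (\<Sum>I\<in>Pow {..<n}. f (insert 0 (Suc ` I))) + (\<Sum>I\<in>Pow {..<n}. f (Suc ` I))"
proof -
  have eq: "Pow {..<Suc n} = (\<lambda>I. insert 0 (Suc ` I)) ` Pow {..<n} \<union> (\<lambda>I. Suc ` I) ` Pow {..<n}"
    unfolding lessThan_Suc_eq_insert_0 Pow_insert image_Pow_surj[OF refl, symmetric] image_image
    by (simp add: Un_commute)
  have dis: "(\<lambda>I. insert 0 (Suc ` I)) ` Pow {..<n} \<inter> (\<lambda>I. Suc ` I) ` Pow {..<n} = {}"
    by auto
  have inj1: "inj_on (\<lambda>I. insert 0 (Suc ` I)) (Pow {..<n})"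
  proof (rule inj_onI)
    fix I J :: "nat set" assume "insert 0 (Suc ` I) = insert 0 (Suc ` J)"
    then have "Suc ` I = Suc ` J" by (metis insert_ident nat.distinct(1) imageE)
    then show "I = J" by (simp add: inj_image_eq_iff)
  qed
  have inj2: "inj_on (\<lambda>I. Suc ` I) (Pow {..<n})"
    by (auto intro!: inj_onI simp: inj_image_eq_iff)
  show ?thesis
    unfolding eq by (subst sum.union_disjoint[OF _ _ dis]) (auto simp: sum.reindex[OF inj1] sum.reindex[OF inj2])
qed

lemma nths_Cons_simps:
  "nths (x # xs) (insert 0 (Suc ` I)) = x # nths xs I"
  "nths (x # xs) (Suc ` I) = nths xs I"
  "nths (x # xs) (- insert 0 (Suc ` I)) = nths xs (- I)"
  "nths (x # xs) (- (Suc ` I)) = x # nths xs (- I)"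
  by (auto simp: nths_Cons Compl_eq intro!: arg_cong[where f = "nths xs"])

lemma contract_flat:
  "contract v (flat G u) [] = G [u, v]"
  by (simp add: contract_def flat_def)

lemma contract_sym_prod:
  "contract v (A \<odot> B) Xs = (contract v A \<odot> B) Xs + (A \<odot> contract v B) Xs"
  by (simp add: contract_def sym_prod_def sum_Pow_lessThan_Suc nths_Cons_simps del: image_insert)

lemma flat_sym_prod_flat:
  "(flat G v \<odot> flat G u) [X, Y] = G [v, X] * G [u, Y] + G [v, Y] * G [u, X]"
  by (simp add: sym_prod_def flat_def Pow_insert lessThan_Suc numeral_2_eq_2 nths_Cons insert_commute)

text \<open>Orthonormal bases exist, and \<open>onb\<close> is one.\<close>

lemma sym_tensors_2D:
  assumes "G \<in> sym_tensors 2"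
  shows "G [u, v] = G [v, u]" and "linear (\<lambda>u. G [u, v])" and "linear (\<lambda>v. G [u, v])"
proof -
  have *: "linear (\<lambda>v. G (Xs[i := v]))" if "length Xs = 2" "i < 2" for Xs i
    using assms that unfolding sym_tensors_def by blast
  have "mset [u, v] = mset [v, u]" by simp
  then show "G [u, v] = G [v, u]" using assms unfolding sym_tensors_def by blast
  show "linear (\<lambda>u. G [u, v])" using *[of "[v, v]" 0] by simp
  show "linear (\<lambda>v. G [u, v])" using *[of "[u, u]" 1] by simp
qed

lemma orthonormal_basis_onb:
  fixes G :: "'e::euclidean_space tensor"
  assumes G: "G \<in> sym_tensors 2" and pos: "\<And>v. v \<noteq> 0 \<Longrightarrow> G [v, v] > 0"
  shows "orthonormal_basis G (onb G)"
proof -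
  note sym = sym_tensors_2D(1)[OF G]
  note lin1 = sym_tensors_2D(2)[OF G]
  note lin2 = sym_tensors_2D(3)[OF G]
  have "\<exists>E::'e set. finite E \<and> card E = n \<and> (\<forall>u\<in>E. \<forall>v\<in>E. G [u, v] = (if u = v then 1 else 0))"
    if "n \<le> DIM('e)" for n
    using that
  proof (induction n)
    case 0
    show ?case by (rule exI[of _ "{}"]) simp
  next
    case (Suc n)
    then obtain E :: "'e set" where E: "finite E" "card E = n"
      and on: "\<And>u v. u \<in> E \<Longrightarrow> v \<in> E \<Longrightarrow> G [u, v] = (if u = v then 1 else 0)"
      by auto
    have "dim E < DIM('e)" using dim_le_card[OF subset_refl E(1)] span_base dim_le_card'[OF E(1)] E(2) Suc.prems by linarith
    then have "span E \<noteq> UNIV" by (metis dim_UNIV dim_span less_irrefl)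
    then obtain w where w: "w \<notin> span E" by blast
    define w' where "w' = w - (\<Sum>e\<in>E. G [w, e] *\<^sub>R e)"
    have "(\<Sum>e\<in>E. G [w, e] *\<^sub>R e) \<in> span E"
      by (intro span_sum span_scale span_base)
    then have w'0: "w' \<noteq> 0" using w by (auto simp: w'_def)
    have orth: "G [w', e] = 0" if "e \<in> E" for e
    proof -
      have "G [w', e] = G [w, e] - (\<Sum>e'\<in>E. G [w, e'] * G [e', e])"
        unfolding w'_def by (simp add: linear_diff[OF lin1] linear_sum[OF lin1] linear_scale[OF lin1])
      also have "(\<Sum>e'\<in>E. G [w, e'] * G [e', e]) = (\<Sum>e'\<in>E. if e' = e then G [w, e] else 0)"
        by (rule sum.cong) (auto simp: on that)
      finally show ?thesis using E(1) that by simp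
    qed
    define c where "c = 1 / sqrt (G [w', w'])"
    define u where "u = c *\<^sub>R w'"
    have "c \<noteq> 0" using pos[OF w'0] by (simp add: c_def)
    have uu: "G [u, u] = 1" using pos[OF w'0]
      by (simp add: u_def linear_scale[OF lin1] linear_scale[OF lin2] c_def)
    have ue: "G [u, e] = 0" if "e \<in> E" for e
      using orth[OF that] by (simp add: u_def linear_scale[OF lin1])
    have "u \<notin> E" using ue uu by force
    moreover have "G [e, u] = 0" if "e \<in> E" for e
      using ue[OF that] sym[of e u] by simp
    ultimately show ?case using E on uu ue
      by (intro exI[of _ "insert u E"]) auto
  qed
  then have "\<exists>E. orthonormal_basis G E" unfolding orthonormal_basis_def by blast
  then show ?thesis unfolding onb_def by (rule someI_ex)
qed

text \<open>At \<open>x\<close> itself, the components in the chart around \<open>x\<close> are the values.\<close>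

lemma transition_self:
  assumes "smooth_atlas A"
  shows "frechet_derivative (chart_map A x \<circ> chart_inv A x) (at (chart_map A x x)) = id"
proof -
  let ?S = "chart_map A x ` chart_dom A x"
  have h: "x \<in> chart_dom A x" "open ?S" "homeomorphism (chart_dom A x) ?S (chart_map A x) (chart_inv A x)"
    using assms unfolding smooth_atlas_def by auto
  have "((chart_map A x \<circ> chart_inv A x) has_derivative (\<lambda>v. v)) (at (chart_map A x x))"
    by (rule has_derivative_transform_within_open[OF has_derivative_ident h(2)])
      (use h(1) homeomorphism_apply2[OF h(3)] in auto)
  from frechet_derivative_at[OF this] show ?thesis by (simp add: id_def)
qed

lemma local_rep_self:
  assumes "smooth_atlas A"
  shows "local_rep A K x (chart_map A x x) = K x"
proof -
  have "chart_inv A x (chart_map A x x) = x"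
    using assms homeomorphism_apply1 unfolding smooth_atlas_def by metis
  then show ?thesis by (simp add: local_rep_def transition_self[OF assms])
qed

text \<open>The connection is torsion-free and metric.\<close>

lemma transition_linear:
  assumes A: "smooth_atlas A" and z: "z \<in> chart_map A x ` chart_dom A x"
  shows "linear (frechet_derivative (chart_map A (chart_inv A x z) \<circ> chart_inv A x) (at z))"
proof -
  let ?q = "chart_inv A x z"
  have h: "homeomorphism (chart_dom A x) (chart_map A x ` chart_dom A x) (chart_map A x) (chart_inv A x)"
    using A unfolding smooth_atlas_def by auto
  have q: "?q \<in> chart_dom A x" "?q \<in> chart_dom A ?q" "chart_map A x ?q = z"
    using A z homeomorphism_apply2[OF h z] homeomorphism_image2[OF h] unfolding smooth_atlas_def by auto
  have "smooth_on (chart_map A x ` (chart_dom A x \<inter> chart_dom A ?q)) (chart_map A ?q \<circ> chart_inv A x)"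
    using A unfolding smooth_atlas_def by blast
  then have "C_k_on (Suc 0) (chart_map A x ` (chart_dom A x \<inter> chart_dom A ?q)) (chart_map A ?q \<circ> chart_inv A x)"
    unfolding smooth_on_def by blast
  moreover have "z \<in> chart_map A x ` (chart_dom A x \<inter> chart_dom A ?q)" using q by force
  ultimately show ?thesis by (auto intro: linear_frechet_derivative)
qed

lemma coord_deriv_metric:
  assumes M: "riemannian_manifold A g"
  shows "coord_deriv A g x v [w, y] = coord_deriv A g x v [y, w]"
    and "linear (\<lambda>v. coord_deriv A g x v [w, y])"
    and "linear (\<lambda>y. coord_deriv A g x v [w, y])"
proof -
  let ?S = "chart_map A x ` chart_dom A x"
  let ?x = "chart_map A x x"
  let ?R = "\<lambda>w y z. local_rep A g x z [w, y]"
  have A: "smooth_atlas A" and g: "\<And>x. g x \<in> sym_tensors 2"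
    and sm: "\<And>Xs. length Xs = 2 \<Longrightarrow> smooth_on ?S (\<lambda>z. local_rep A g x z Xs)"
    using M unfolding riemannian_manifold_def riemannian_metric_def sym_tensor_field_def by auto
  have S: "open ?S" "?x \<in> ?S" using A unfolding smooth_atlas_def by auto
  have diff: "?R w y differentiable (at ?x)" for w y
  proof -
    have "smooth_on ?S (?R w y)" by (rule sm) simp
    then have "C_k_on (Suc 0) ?S (?R w y)" unfolding smooth_on_def by blast
    then show ?thesis using S(2) by (simp only: C_k_on.simps)
  qed
  note D = frechet_derivative_works[THEN iffD1, OF diff]
  show "coord_deriv A g x v [w, y] = coord_deriv A g x v [y, w]"
    unfolding coord_deriv_def local_rep_def Let_def list.map
    by (subst sym_tensors_2D(1)[OF g]) (rule refl)
  show "linear (\<lambda>v. coord_deriv A g x v [w, y])"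
    unfolding coord_deriv_def using linear_frechet_derivative[OF diff] by simp
  have lin: "linear (\<lambda>y. ?R w y z)" if "z \<in> ?S" for z
    unfolding local_rep_def Let_def
    using linear_compose[OF transition_linear[OF A that] sym_tensors_2D(3)[OF g]] by (simp add: o_def)
  show "linear (\<lambda>y. coord_deriv A g x v [w, y])"
  proof (rule linearI)
    fix y y'
    have "(?R w (y + y') has_derivative (\<lambda>v. frechet_derivative (?R w y) (at ?x) v + frechet_derivative (?R w y') (at ?x) v)) (at ?x)"
      by (rule has_derivative_transform_within_open[OF has_derivative_add[OF D D] S]) (simp add: linear_add[OF lin])
    from frechet_derivative_at[OF this, symmetric] show "coord_deriv A g x v [w, y + y'] = coord_deriv A g x v [w, y] + coord_deriv A g x v [w, y']"
      by (simp add: coord_deriv_def)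
  next
    fix c y
    have "(?R w (c *\<^sub>R y) has_derivative (\<lambda>v. c *\<^sub>R frechet_derivative (?R w y) (at ?x) v)) (at ?x)"
      by (rule has_derivative_transform_within_open[OF has_derivative_scaleR_right[OF D] S]) (simp add: linear_scale[OF lin])
    from frechet_derivative_at[OF this, symmetric] show "coord_deriv A g x v [w, c *\<^sub>R y] = c *\<^sub>R coord_deriv A g x v [w, y]"
      by (simp add: coord_deriv_def)
  qed
qed

lemma riesz_sym_tensor:
  fixes G :: "'e::euclidean_space tensor" and f :: "'e \<Rightarrow> real"
  assumes G: "G \<in> sym_tensors 2" and pos: "\<And>v. v \<noteq> 0 \<Longrightarrow> G [v, v] > 0" and f: "linear f"
  shows "\<exists>!u. \<forall>y. G [u, y] = f y"
proof -
  note lin1 = sym_tensors_2D(2)[OF G]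
  note lin2 = sym_tensors_2D(3)[OF G]
  have ext: "\<forall>y. h y = h' y" if "linear h" "linear h'" "\<And>b. b \<in> Basis \<Longrightarrow> h b = h' b"
    for h h' :: "'e \<Rightarrow> real"
    using linear_eq_stdbasis[OF that] by simp
  define T where "T u = (\<Sum>b\<in>Basis. G [u, b] *\<^sub>R b)" for u
  have linT: "linear T" unfolding T_def
    by (rule linearI) (simp_all add: linear_add[OF lin1] linear_scale[OF lin1] scaleR_add_left sum.distrib scaleR_sum_right)
  have Tb: "T u \<bullet> b = G [u, b]" if "b \<in> Basis" for u b
    unfolding T_def using that by (simp add: inner_sum_left_Basis)
  have zero: "u = 0" if "\<And>b. b \<in> Basis \<Longrightarrow> G [u, b] = 0" for u
  proof -
    have "\<forall>y. G [u, y] = 0" by (rule ext[OF lin2 linear_zero]) (use that in simp)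
    then show ?thesis using pos[of u] by force
  qed
  have inj: "inj T" unfolding linear_injective_0[OF linT]
    using zero Tb by (metis inner_zero_left)
  then have "surj T" using linT linear_injective_imp_surjective by blast
  then obtain u where u: "T u = (\<Sum>b\<in>Basis. f b *\<^sub>R b)" by (metis surjD)
  have "\<forall>y. G [u, y] = f y"
    by (rule ext[OF lin2 f]) (use Tb u in \<open>simp add: inner_sum_left_Basis flip: Tb\<close>)
  moreover have "u' = u''" if "\<forall>y. G [u', y] = f y" "\<forall>y. G [u'', y] = f y" for u' u''
    using zero[of "u' - u''"] that by (simp add: linear_diff[OF lin1])
  ultimately show ?thesis by blast
qed

lemma christoffel:
  assumes M: "riemannian_manifold A g"
  shows "2 * g x [christoffel A g x v w, y] =
     coord_deriv A g x v [w, y] + coord_deriv A g x w [v, y] - coord_deriv A g x y [v, w]"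
proof -
  let ?f = "\<lambda>y. (coord_deriv A g x v [w, y] + coord_deriv A g x w [v, y] - coord_deriv A g x y [v, w]) / 2"
  note l = coord_deriv_metric(2,3)[OF M]
  have "linear ?f"
    by (rule linearI) (simp_all add: linear_add[OF l(1)] linear_add[OF l(2)] linear_scale[OF l(1)] linear_scale[OF l(2)] field_simps)
  moreover have "g x \<in> sym_tensors 2" "\<And>v. v \<noteq> 0 \<Longrightarrow> g x [v, v] > 0"
    using M unfolding riemannian_manifold_def riemannian_metric_def sym_tensor_field_def by auto
  ultimately have "\<exists>!u. \<forall>y. g x [u, y] = ?f y" by (intro riesz_sym_tensor)
  then have "\<exists>!u. \<forall>y. 2 * g x [u, y] =
     coord_deriv A g x v [w, y] + coord_deriv A g x w [v, y] - coord_deriv A g x y [v, w]"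
    by (simp add: field_simps)
  from theI'[OF this] show ?thesis unfolding christoffel_def by blast
qed

lemma christoffel_commute:
  assumes "riemannian_manifold A g"
  shows "christoffel A g x v w = christoffel A g x w v"
  unfolding christoffel_def coord_deriv_metric(1)[OF assms, of x _ v w]
  by (simp only: add.commute[of "coord_deriv A g x v [w, _]"])

lemma nabla_metric:
  assumes M: "riemannian_manifold A g"
  shows "nabla A g x v g [w, y] = 0"
proof -
  have g: "g x \<in> sym_tensors 2"
    using M unfolding riemannian_manifold_def riemannian_metric_def sym_tensor_field_def by auto
  have "2 * g x [w, christoffel A g x v y] =
     coord_deriv A g x v [y, w] + coord_deriv A g x y [v, w] - coord_deriv A g x w [v, y]"
    unfolding sym_tensors_2D(1)[OF g, of w] by (rule christoffel[OF M])
  moreover have "coord_deriv A g x v [y, w] = coord_deriv A g x v [w, y]"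
    by (rule coord_deriv_metric(1)[OF M])
  ultimately show ?thesis
    using christoffel[OF M, of x v w y] by (simp add: nabla_def numeral_2_eq_2 lessThan_Suc)
qed

end

theory Submission
  imports Defs
begin

text \<open>
  A symmetric tensor is treated as a function on the tangent bundle, polynomial in the fibres. The
  covariant derivative on the diagonal, \<open>(\<nabla>\<^sub>v K)(v, \<dots>, v)\<close>, then is the derivative of this function along the
  geodesic flow, and Killing tensors are the functions that are constant along the flow. On a product
  there are two commuting derivatives \<open>F1\<close> and \<open>F2\<close>, along the geodesic flows of the two factors, acting on
  functions of a pair \<open>(v, w)\<close> of tangent vectors. Let \<open>a(v, v)\<close>, \<open>2 m(v, w)\<close>, \<open>b(w, w)\<close> be the parts of \<open>h\<close>, \<open>k1(v)\<close>
  and \<open>k2(w)\<close> the parts of \<open>k\<close>, and \<open>r2\<close>, \<open>s2\<close> the squared norms of \<open>v\<close> and \<open>w\<close>. The conformal Killing equation reads,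
  sorted by degrees in \<open>v\<close> and \<open>w\<close>,
  \<open>F1 a = 2 r2 k1\<close>, \<open>F2 a + 2 F1 m = 2 r2 k2\<close>, \<open>F1 b + 2 F2 m = 2 s2 k1\<close>, \<open>F2 b = 2 s2 k2\<close>.

  Eliminating \<open>k\<close>, the function \<open>c = s2 a - r2 b\<close> satisfies \<open>F1 c = 2 r2 F2 m\<close> and \<open>F2 c = - 2 s2 F1 m\<close>. For unit vectors
  these are the Cauchy-Riemann equations for \<open>c + 2 i m\<close>: on a product of two geodesics it is an entire
  function of one complex variable, bounded as both manifolds are compact. So the Liouville theorem
  makes \<open>m\<close> and \<open>c\<close> constant along both flows. The proof below replaces the Liouville theorem by a
  maximum principle on the unit tangent bundles (\<open>cauchy_riemann_zero\<close>), which needs the vector fields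
  that generate the flows, but not the flows.

  The mixed part \<open>m\<close> is now a Killing form in \<open>v\<close> and in \<open>w\<close>. A Killing form on a connected manifold is determined
  by its 1-jet at a point (\<open>killing_form_zero\<close>), so that these forms have a finite-dimensional span and \<open>m\<close> is a
  finite sum of products (\<open>killing_forms_finite_rank\<close>).

  The diagonal parts satisfy \<open>F2 a = 2 r2 k2\<close> and \<open>F1 b = 2 s2 k1\<close>, so that the trace-free part of \<open>a\<close> is constant along
  the second factor, and that of \<open>b\<close> along the first. As \<open>tr a + tr b = 0\<close>, it follows that \<open>k1\<close> lives on the first
  factor and \<open>k2\<close> on the second (\<open>k1_independent\<close>). Hence \<open>- 2 k = d \<tau>\<close> for a function \<open>\<tau>\<close>, and
  \<open>K1 = a + \<tau> r2\<close>, \<open>K2 = b + \<tau> s2\<close> are Killing tensors on the factors (\<open>potential\<close>). Since \<open>h = K1 + K2 - \<tau> g + 2 m\<close> has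
  trace zero, \<open>\<tau>\<close> is the trace of \<open>K1 + K2\<close> divided by the dimension (\<open>trace_free_is_killing_sum\<close>).

  The converse is the computation \<open>(F1 + F2) h = - (F1 \<tau> + F2 \<tau>) (r2 + s2)\<close> (\<open>killing_sum_conformal\<close>).

  Two facts are used throughout. The generator of the geodesic flow does not depend on the chart
  (\<open>chart_christoffel_transition\<close>, \<open>geo_tlift\<close>). The Christoffel symbols and the trace of a tensor are
  smooth because they solve linear systems with smooth coefficients (\<open>solution_smooth\<close>).
\<close>


section \<open>Calculus of smooth maps between Euclidean spaces\<close>

lemma linear_Basis_expand:
  assumes "linear f"
  shows "f v = (\<Sum>b\<in>Basis. (v \<bullet> b) *\<^sub>R f b)"
proof -
  have "f (\<Sum>b\<in>Basis. (v \<bullet> b) *\<^sub>R b) = (\<Sum>b\<in>Basis. (v \<bullet> b) *\<^sub>R f b)"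
    by (simp add: linear_sum[OF assms] linear_scale[OF assms])
  then show ?thesis by (simp add: euclidean_representation)
qed

lemma C_k_on_cong:
  assumes "open S" "\<And>x. x \<in> S \<Longrightarrow> f x = g x" "C_k_on k S f"
  shows "C_k_on k S g"
  using assms(2,3)
proof (induction k arbitrary: f g)
  case 0
  then show ?case by (auto cong: continuous_on_cong)
next
  case (Suc k)
  have D: "(g has_derivative frechet_derivative f (at x)) (at x)" if "x \<in> S" for x
  proof (rule has_derivative_transform_within_open[OF _ assms(1) that])
    show "(f has_derivative frechet_derivative f (at x)) (at x)"
      using Suc.prems(2) that by (intro frechet_derivative_works[THEN iffD1]) simp
  qed (use Suc.prems(1) in blast)
  then have eq: "frechet_derivative g (at x) = frechet_derivative f (at x)" if "x \<in> S" for x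
    using frechet_derivative_at that by metis
  have "C_k_on k S (\<lambda>x. frechet_derivative g (at x) v)" for v
    by (rule Suc.IH[of "\<lambda>x. frechet_derivative f (at x) v"]) (simp add: eq, use Suc.prems(2) in simp)
  moreover have "g differentiable (at x)" if "x \<in> S" for x
    using D[OF that] differentiable_def by blast
  ultimately show ?case unfolding C_k_on.simps by blast
qed

lemma C_k_on_SucI:
  assumes "open S" "\<And>x. x \<in> S \<Longrightarrow> (f has_derivative f' x) (at x)"
    and "\<And>v. C_k_on k S (\<lambda>x. f' x v)"
  shows "C_k_on (Suc k) S f"
proof -
  have "f' x = frechet_derivative f (at x)" if "x \<in> S" for x
    using frechet_derivative_at assms(2) that by metis
  then have "C_k_on k S (\<lambda>x. frechet_derivative f (at x) v)" for v
    by (intro C_k_on_cong[OF assms(1) _ assms(3)]) auto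
  moreover have "f differentiable (at x)" if "x \<in> S" for x
    using assms(2)[OF that] differentiable_def by blast
  ultimately show ?thesis unfolding C_k_on.simps by blast
qed

lemma C_k_on_SucD:
  assumes "C_k_on (Suc k) S f"
  shows "x \<in> S \<Longrightarrow> (f has_derivative frechet_derivative f (at x)) (at x)"
    and "C_k_on k S (\<lambda>x. frechet_derivative f (at x) v)"
proof -
  show "(f has_derivative frechet_derivative f (at x)) (at x)" if "x \<in> S"
    using assms that by (intro frechet_derivative_works[THEN iffD1]) simp
  show "C_k_on k S (\<lambda>x. frechet_derivative f (at x) v)" using assms by simp
qed

lemma C_k_on_mono: "C_k_on (Suc k) S f \<Longrightarrow> C_k_on k S f"
proof (induction k arbitrary: f)
  case 0
  then show ?case
    by (auto intro!: differentiable_imp_continuous_on simp: differentiable_on_def differentiable_at_withinI)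
next
  case (Suc k)
  have "C_k_on k S (\<lambda>x. frechet_derivative f (at x) v)" for v
    by (rule Suc.IH) (rule C_k_on_SucD(2)[OF Suc.prems])
  moreover have "f differentiable at x" if "x \<in> S" for x
    using C_k_on_SucD(1)[OF Suc.prems that] differentiable_def by blast
  ultimately show ?case unfolding C_k_on.simps by blast
qed

lemma C_k_on_const: "open S \<Longrightarrow> C_k_on k S (\<lambda>x. c)"
proof (induction k arbitrary: c)
  case (Suc k)
  then show ?case by (intro C_k_on_SucI[where f' = "\<lambda>x v. 0"]) auto
qed simp

lemma C_k_on_linear_comp:
  assumes "open S" "linear h" "C_k_on k S f"
  shows "C_k_on k S (\<lambda>x. h (f x))"
  using assms(3)
proof (induction k arbitrary: f)
  case 0
  then show ?case by (auto intro: linear_continuous_on_compose assms(2))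
next
  case (Suc k)
  have h: "bounded_linear h" using assms(2) linear_conv_bounded_linear by blast
  show ?case
    by (rule C_k_on_SucI[OF assms(1)])
      (use bounded_linear.has_derivative[OF h C_k_on_SucD(1)[OF Suc.prems]]
        Suc.IH[OF C_k_on_SucD(2)[OF Suc.prems]] in auto)
qed

lemma C_k_on_add:
  assumes "open S" "C_k_on k S f" "C_k_on k S g"
  shows "C_k_on k S (\<lambda>x. f x + g x)"
  using assms(2,3)
proof (induction k arbitrary: f g)
  case 0
  then show ?case by (auto intro: continuous_intros)
next
  case (Suc k)
  show ?case
    by (rule C_k_on_SucI[OF assms(1)])
      (use has_derivative_add[OF C_k_on_SucD(1)[OF Suc.prems(1)] C_k_on_SucD(1)[OF Suc.prems(2)]]
        Suc.IH[OF C_k_on_SucD(2)[OF Suc.prems(1)] C_k_on_SucD(2)[OF Suc.prems(2)]] in auto)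
qed

lemma C_k_on_bilinear:
  fixes B :: "'b::euclidean_space \<Rightarrow> 'c::euclidean_space \<Rightarrow> 'd::euclidean_space"
  assumes "open S" "bounded_bilinear B" "C_k_on k S f" "C_k_on k S g"
  shows "C_k_on k S (\<lambda>x. B (f x) (g x))"
  using assms(3,4)
proof (induction k arbitrary: f g)
  case 0
  then show ?case by (auto intro: bounded_bilinear.continuous_on[OF assms(2)])
next
  case (Suc k)
  show ?case
  proof (rule C_k_on_SucI[OF assms(1)])
    fix x assume "x \<in> S"
    then show "((\<lambda>x. B (f x) (g x)) has_derivative
        (\<lambda>v. B (f x) (frechet_derivative g (at x) v) + B (frechet_derivative f (at x) v) (g x))) (at x)"
      by (intro bounded_bilinear.FDERIV[OF assms(2)] C_k_on_SucD(1)[OF Suc.prems(1)] C_k_on_SucD(1)[OF Suc.prems(2)])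
  next
    fix v
    show "C_k_on k S (\<lambda>x. B (f x) (frechet_derivative g (at x) v) + B (frechet_derivative f (at x) v) (g x))"
      by (intro C_k_on_add[OF assms(1)] Suc.IH C_k_on_mono[OF Suc.prems(1)] C_k_on_mono[OF Suc.prems(2)]
          C_k_on_SucD(2)[OF Suc.prems(1)] C_k_on_SucD(2)[OF Suc.prems(2)])
  qed
qed

lemma C_k_on_sum:
  assumes "open S" "\<And>i. i \<in> I \<Longrightarrow> C_k_on k S (f i)"
  shows "C_k_on k S (\<lambda>x. \<Sum>i\<in>I. f i x)"
  using assms(2)
  by (induction I rule: infinite_finite_induct)
    (auto intro: C_k_on_add C_k_on_const simp: assms(1))

lemma C_k_on_compose:
  fixes f :: "'a::euclidean_space \<Rightarrow> 'b::euclidean_space" and g :: "'b \<Rightarrow> 'c::euclidean_space"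
  assumes "open S" "C_k_on k S f" "C_k_on k T g" "f ` S \<subseteq> T"
  shows "C_k_on k S (\<lambda>x. g (f x))"
  using assms(2,3)
proof (induction k arbitrary: g)
  case 0
  then show ?case using continuous_on_compose2 assms(4) by auto
next
  case (Suc k)
  show ?case
  proof (rule C_k_on_SucI[OF assms(1)])
    fix x assume x: "x \<in> S"
    have fx: "f x \<in> T" using x assms(4) by auto
    note Dg = C_k_on_SucD(1)[OF Suc.prems(2) fx] and Df = C_k_on_SucD(1)[OF Suc.prems(1) x]
    have eq: "frechet_derivative g (at (f x)) v = (\<Sum>b\<in>Basis. (v \<bullet> b) *\<^sub>R frechet_derivative g (at (f x)) b)" for v
      by (rule linear_Basis_expand[OF has_derivative_linear[OF Dg]])
    show "((\<lambda>x. g (f x)) has_derivative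
        (\<lambda>v. \<Sum>b\<in>Basis. (frechet_derivative f (at x) v \<bullet> b) *\<^sub>R frechet_derivative g (at (f x)) b)) (at x)"
      unfolding eq[symmetric] by (rule has_derivative_compose[OF Df Dg])
  next
    fix v
    have 1: "C_k_on k S (\<lambda>x. frechet_derivative f (at x) v \<bullet> b)" for b
      by (rule C_k_on_linear_comp[OF assms(1) _ C_k_on_SucD(2)[OF Suc.prems(1)]]) (simp add: linear_iff inner_add_left)
    have 2: "C_k_on k S (\<lambda>x. frechet_derivative g (at (f x)) b)" for b
      by (rule Suc.IH[OF C_k_on_mono[OF Suc.prems(1)] C_k_on_SucD(2)[OF Suc.prems(2)]])
    show "C_k_on k S (\<lambda>x. \<Sum>b\<in>Basis. (frechet_derivative f (at x) v \<bullet> b) *\<^sub>R frechet_derivative g (at (f x)) b)"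
      by (rule C_k_on_sum[OF assms(1)]) (rule C_k_on_bilinear[OF assms(1) bounded_bilinear_scaleR 1 2])
  qed
qed

lemma smooth_on_has_derivative:
  "smooth_on S f \<Longrightarrow> x \<in> S \<Longrightarrow> (f has_derivative frechet_derivative f (at x)) (at x)"
  unfolding smooth_on_def using C_k_on_SucD(1) by blast

lemma smooth_on_deriv:
  "smooth_on S f \<Longrightarrow> smooth_on S (\<lambda>x. frechet_derivative f (at x) v)"
  unfolding smooth_on_def using C_k_on_SucD(2) by blast

lemma smooth_on_continuous_on: "smooth_on S f \<Longrightarrow> continuous_on S f"
  unfolding smooth_on_def by (metis C_k_on.simps(1))

lemma smooth_on_cong: "open S \<Longrightarrow> (\<And>x. x \<in> S \<Longrightarrow> f x = g x) \<Longrightarrow> smooth_on S f \<Longrightarrow> smooth_on S g"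
  unfolding smooth_on_def by (intro allI) (rule C_k_on_cong[where f = f], auto)

lemma smooth_on_const: "open S \<Longrightarrow> smooth_on S (\<lambda>x. c)"
  by (simp add: smooth_on_def C_k_on_const)

lemma smooth_on_id: "open S \<Longrightarrow> smooth_on S (\<lambda>x. x)"
  unfolding smooth_on_def
proof
  fix k assume S: "open S"
  show "C_k_on k S (\<lambda>x. x)"
  proof (cases k)
    case (Suc j)
    show ?thesis unfolding Suc
      by (rule C_k_on_SucI[OF S, where f' = "\<lambda>x v. v"]) (rule has_derivative_ident C_k_on_const[OF S])+
  next
    case 0
    then show ?thesis by simp
  qed
qed

lemma smooth_on_linear_comp: "open S \<Longrightarrow> linear h \<Longrightarrow> smooth_on S f \<Longrightarrow> smooth_on S (\<lambda>x. h (f x))"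
  by (simp add: smooth_on_def C_k_on_linear_comp)

lemma smooth_on_linear: "open S \<Longrightarrow> linear h \<Longrightarrow> smooth_on S h"
  by (rule smooth_on_linear_comp[OF _ _ smooth_on_id])

lemma smooth_on_add: "open S \<Longrightarrow> smooth_on S f \<Longrightarrow> smooth_on S g \<Longrightarrow> smooth_on S (\<lambda>x. f x + g x)"
  by (simp add: smooth_on_def C_k_on_add)

lemma smooth_on_bilinear:
  "open S \<Longrightarrow> bounded_bilinear B \<Longrightarrow> smooth_on S f \<Longrightarrow> smooth_on S g \<Longrightarrow> smooth_on S (\<lambda>x. B (f x) (g x))"
  by (simp add: smooth_on_def C_k_on_bilinear)

lemmas smooth_on_mult = smooth_on_bilinear[OF _ bounded_bilinear_mult[where 'a = real]]
lemmas smooth_on_scaleR = smooth_on_bilinear[OF _ bounded_bilinear_scaleR]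
lemmas smooth_on_inner = smooth_on_bilinear[OF _ bounded_bilinear_inner]

lemma smooth_on_sum:
  "open S \<Longrightarrow> (\<And>i. i \<in> I \<Longrightarrow> smooth_on S (f i)) \<Longrightarrow> smooth_on S (\<lambda>x. \<Sum>i\<in>I. f i x)"
  by (simp add: smooth_on_def C_k_on_sum)

lemma smooth_on_compose:
  "open S \<Longrightarrow> smooth_on S f \<Longrightarrow> smooth_on T g \<Longrightarrow> f ` S \<subseteq> T \<Longrightarrow> smooth_on S (\<lambda>x. g (f x))"
  unfolding smooth_on_def by (intro allI) (rule C_k_on_compose[where T = T and g = g], auto)

lemma smooth_on_subset: "open S \<Longrightarrow> S \<subseteq> T \<Longrightarrow> smooth_on T f \<Longrightarrow> smooth_on S f"
  by (rule smooth_on_compose[OF _ smooth_on_id]) auto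

lemma smooth_on_cmult: "open S \<Longrightarrow> smooth_on S f \<Longrightarrow> smooth_on S (\<lambda>x. c * f x :: real)"
  by (rule smooth_on_mult[OF _ smooth_on_const])

lemma smooth_on_minus: "open S \<Longrightarrow> smooth_on S f \<Longrightarrow> smooth_on S (\<lambda>x. - f x)"
  by (rule smooth_on_linear_comp) (auto intro: linearI)

lemma smooth_on_diff: "open S \<Longrightarrow> smooth_on S f \<Longrightarrow> smooth_on S g \<Longrightarrow> smooth_on S (\<lambda>x. f x - g x)"
  using smooth_on_add[OF _ _ smooth_on_minus, of S f g] by simp

lemma smooth_on_Pair: 
  assumes "open S" "smooth_on S f" "smooth_on S g" shows "smooth_on S (\<lambda>x. (f x, g x))"
proof -
  have "smooth_on S (\<lambda>x. (f x, 0) + (0, g x))"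
    by (intro smooth_on_add assms smooth_on_linear_comp[where h = "\<lambda>u. (u, 0)"]
      smooth_on_linear_comp[where h = "\<lambda>u. (0, u)"]) (auto intro: linearI)
  then show ?thesis by simp
qed

lemma smooth_on_fst: "open S \<Longrightarrow> smooth_on S f \<Longrightarrow> smooth_on S (\<lambda>x. fst (f x))"
  by (rule smooth_on_linear_comp) (auto intro: linearI)

lemma smooth_on_snd: "open S \<Longrightarrow> smooth_on S f \<Longrightarrow> smooth_on S (\<lambda>x. snd (f x))"
  by (rule smooth_on_linear_comp) (auto intro: linearI)

text \<open>So the derivative of a smooth function along a smooth vector field can be differentiated again.\<close>

lemma smooth_on_deriv_dir:
  assumes "open S" "smooth_on S f" "smooth_on S X"
  shows "smooth_on S (\<lambda>x. frechet_derivative f (at x) (X x))"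
proof -
  have "smooth_on S (\<lambda>x. \<Sum>b\<in>Basis. (X x \<bullet> b) *\<^sub>R frechet_derivative f (at x) b)"
    by (intro smooth_on_sum smooth_on_scaleR smooth_on_inner smooth_on_const smooth_on_deriv assms)
  then show ?thesis
    by (rule smooth_on_cong[OF assms(1), rotated])
      (rule linear_Basis_expand[OF has_derivative_linear[OF smooth_on_has_derivative[OF assms(2)]], symmetric])
qed

lemma frechet_derivative_cong:
  assumes "open S" "x \<in> S" "\<And>y. y \<in> S \<Longrightarrow> f y = g y"
  shows "frechet_derivative f (at x) = frechet_derivative g (at x)"
proof -
  have "(f has_derivative D) (at x) \<longleftrightarrow> (g has_derivative D) (at x)" for D
    using has_derivative_transform_within_open[OF _ assms(1,2)] assms(3) by metis
  then show ?thesis unfolding frechet_derivative_def by simp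
qed

text \<open>Schwarz: by the mean value theorem applied twice, the second difference of \<open>f\<close> at \<open>x\<close>
  along \<open>s v\<close> and \<open>s w\<close> is \<open>s\<^sup>2\<close> times a mixed second derivative at a nearby point; it is symmetric in
  \<open>v\<close> and \<open>w\<close>.\<close>

lemma second_difference_mvt:
  fixes f :: "'a::euclidean_space \<Rightarrow> real"
  assumes S: "\<And>s t. 0 \<le> s \<Longrightarrow> s \<le> h \<Longrightarrow> 0 \<le> t \<Longrightarrow> t \<le> h \<Longrightarrow> x + s *\<^sub>R v + t *\<^sub>R w \<in> S"
    and f: "smooth_on S f" and h: "h > 0"
  shows "\<exists>s t. 0 \<le> s \<and> s \<le> h \<and> 0 \<le> t \<and> t \<le> h \<and>
     f (x + h *\<^sub>R v + h *\<^sub>R w) - f (x + h *\<^sub>R v) - f (x + h *\<^sub>R w) + f x =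
       h * h * frechet_derivative (\<lambda>y. frechet_derivative f (at y) v) (at (x + s *\<^sub>R v + t *\<^sub>R w)) w"
proof -
  let ?D = "\<lambda>y. frechet_derivative f (at y)"
  let ?p = "\<lambda>s. f (x + s *\<^sub>R v + h *\<^sub>R w) - f (x + s *\<^sub>R v + 0 *\<^sub>R w)"
  have scale: "?D y (c *\<^sub>R u) = ?D y u * c" if "y \<in> S" for y c u
    using linear_scale[OF has_derivative_linear[OF smooth_on_has_derivative[OF f that]]] by simp
  have d1: "((\<lambda>s. f (x + s *\<^sub>R v + t *\<^sub>R w)) has_real_derivative ?D (x + s *\<^sub>R v + t *\<^sub>R w) v) (at s)"
    if "0 \<le> s" "s \<le> h" "0 \<le> t" "t \<le> h" for s t
  proof -
    have in_S: "x + s *\<^sub>R v + t *\<^sub>R w \<in> S" using S that by blast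
    have "((\<lambda>s. f (x + s *\<^sub>R v + t *\<^sub>R w)) has_derivative (\<lambda>c. ?D (x + s *\<^sub>R v + t *\<^sub>R w) (c *\<^sub>R v))) (at s)"
      by (rule has_derivative_compose[where f = "\<lambda>s. x + s *\<^sub>R v + t *\<^sub>R w" and x = s,
            OF _ smooth_on_has_derivative[OF f in_S]]) (auto intro!: derivative_eq_intros)
    then show ?thesis by (simp add: has_field_derivative_def scale[OF in_S])
  qed
  have p: "(?p has_real_derivative (?D (x + s *\<^sub>R v + h *\<^sub>R w) v - ?D (x + s *\<^sub>R v + 0 *\<^sub>R w) v)) (at s)"
    if "0 \<le> s" "s \<le> h" for s
    by (intro DERIV_diff d1) (use that h in auto)
  obtain s where s: "0 < s" "s < h"
    and eq1: "?p h - ?p 0 = (h - 0) * (?D (x + s *\<^sub>R v + h *\<^sub>R w) v - ?D (x + s *\<^sub>R v + 0 *\<^sub>R w) v)"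
    using MVT2[OF h p] by auto
  have d2: "((\<lambda>t. ?D (x + s *\<^sub>R v + t *\<^sub>R w) v) has_real_derivative
      frechet_derivative (\<lambda>y. ?D y v) (at (x + s *\<^sub>R v + t *\<^sub>R w)) w) (at t)"
    if "0 \<le> t" "t \<le> h" for t
  proof -
    have in_S: "x + s *\<^sub>R v + t *\<^sub>R w \<in> S" using S that s by auto
    note D = smooth_on_has_derivative[OF smooth_on_deriv[OF f] in_S, of v]
    have "((\<lambda>t. ?D (x + s *\<^sub>R v + t *\<^sub>R w) v) has_derivative
      (\<lambda>c. frechet_derivative (\<lambda>y. ?D y v) (at (x + s *\<^sub>R v + t *\<^sub>R w)) (c *\<^sub>R w))) (at t)"
      by (rule has_derivative_compose[where f = "\<lambda>t. x + s *\<^sub>R v + t *\<^sub>R w" and x = t, OF _ D]) (auto intro!: derivative_eq_intros)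
    then show ?thesis
      using linear_scale[OF has_derivative_linear[OF D], of _ w]
      by (simp add: has_field_derivative_def mult.commute[of _ "frechet_derivative _ _ _"])
  qed
  obtain t where "0 < t" "t < h" "?D (x + s *\<^sub>R v + h *\<^sub>R w) v - ?D (x + s *\<^sub>R v + 0 *\<^sub>R w) v =
      (h - 0) * frechet_derivative (\<lambda>y. ?D y v) (at (x + s *\<^sub>R v + t *\<^sub>R w)) w"
    using MVT2[OF h d2] by auto
  with s eq1 show ?thesis by (intro exI[of _ s] exI[of _ t]) auto
qed

lemma second_derivative_symmetric_real:
  fixes f :: "'a::euclidean_space \<Rightarrow> real"
  assumes "open S" "smooth_on S f" "x \<in> S"
  shows "frechet_derivative (\<lambda>y. frechet_derivative f (at y) v) (at x) w =
    frechet_derivative (\<lambda>y. frechet_derivative f (at y) w) (at x) v"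
proof (rule ccontr)
  let ?H = "\<lambda>v w y. frechet_derivative (\<lambda>y. frechet_derivative f (at y) v) (at y) w"
  assume "\<not> ?thesis"
  then have d: "dist (?H v w x) (?H w v x) / 2 > 0" (is "?e > 0") by simp
  have ex: "\<exists>r>0. \<forall>y. dist y x < r \<longrightarrow> y \<in> S \<and> dist (?H v w y) (?H v w x) < ?e" for v w
  proof -
    have "continuous_on S (?H v w)" using assms(2) by (intro smooth_on_continuous_on smooth_on_deriv)
    then have "isCont (?H v w) x" using assms(1,3) continuous_on_eq_continuous_at by blast
    then obtain r where "r > 0" "\<forall>y. dist y x < r \<longrightarrow> dist (?H v w y) (?H v w x) < ?e"
      using d unfolding continuous_at_eps_delta by metis
    moreover obtain r' where "r' > 0" "\<forall>y. dist y x < r' \<longrightarrow> y \<in> S"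
      using assms(1,3) open_dist by blast
    ultimately show ?thesis by (intro exI[of _ "min r r'"]) auto
  qed
  obtain r1 where r1: "r1 > 0" "\<And>y. dist y x < r1 \<Longrightarrow> y \<in> S \<and> dist (?H v w y) (?H v w x) < ?e" using ex by metis
  obtain r2 where r2: "r2 > 0" "\<And>y. dist y x < r2 \<Longrightarrow> y \<in> S \<and> dist (?H w v y) (?H w v x) < ?e" using ex by metis
  define h where "h = min r1 r2 / (norm v + norm w + 1)"
  have pos: "norm v + norm w + 1 > 0" by (smt (verit) norm_ge_zero)
  have h: "h > 0" using r1 r2 pos by (simp add: h_def)
  have near: "dist (x + s *\<^sub>R v + t *\<^sub>R w) x < min r1 r2" if "0 \<le> s" "s \<le> h" "0 \<le> t" "t \<le> h" for s t
  proof -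
    have "dist (x + s *\<^sub>R v + t *\<^sub>R w) x = norm (s *\<^sub>R v + t *\<^sub>R w)" by (simp add: dist_norm algebra_simps)
    also have "\<dots> \<le> s * norm v + t * norm w" using norm_triangle_ineq[of "s *\<^sub>R v" "t *\<^sub>R w"] that by simp
    also have "\<dots> \<le> h * norm v + h * norm w" using that by (intro add_mono mult_right_mono) auto
    also have "\<dots> < h * (norm v + norm w + 1)" using h by (simp add: algebra_simps)
    also have "\<dots> = min r1 r2" using pos by (simp add: h_def)
    finally show ?thesis .
  qed
  obtain s t where st: "0 \<le> s" "s \<le> h" "0 \<le> t" "t \<le> h"
    and 1: "f (x + h *\<^sub>R v + h *\<^sub>R w) - f (x + h *\<^sub>R v) - f (x + h *\<^sub>R w) + f x = h * h * ?H v w (x + s *\<^sub>R v + t *\<^sub>R w)"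
    using second_difference_mvt[of h x v w S f] near r1 h assms(2) by fastforce
  obtain s' t' where st': "0 \<le> s'" "s' \<le> h" "0 \<le> t'" "t' \<le> h"
    and 2: "f (x + h *\<^sub>R w + h *\<^sub>R v) - f (x + h *\<^sub>R w) - f (x + h *\<^sub>R v) + f x = h * h * ?H w v (x + s' *\<^sub>R w + t' *\<^sub>R v)"
    using second_difference_mvt[of h x w v S f] near r1 h assms(2) by (fastforce simp: add.assoc add.commute[of "_ *\<^sub>R w"])
  have "x + h *\<^sub>R w + h *\<^sub>R v = x + h *\<^sub>R v + h *\<^sub>R w" by simp
  then have "h * h * ?H v w (x + s *\<^sub>R v + t *\<^sub>R w) = h * h * ?H w v (x + s' *\<^sub>R w + t' *\<^sub>R v)"
    using 1 2 by (smt (verit))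
  then have "?H v w (x + s *\<^sub>R v + t *\<^sub>R w) = ?H w v (x + s' *\<^sub>R w + t' *\<^sub>R v)" using h by simp
  moreover have "dist (?H v w (x + s *\<^sub>R v + t *\<^sub>R w)) (?H v w x) < ?e" using near[OF st] r1 by auto
  moreover have "x + s' *\<^sub>R w + t' *\<^sub>R v = x + t' *\<^sub>R v + s' *\<^sub>R w" by simp
  with near[OF st'(3,4,1,2)] have "dist (x + s' *\<^sub>R w + t' *\<^sub>R v) x < r2" by (metis min_less_iff_conj)
  then have "dist (?H w v (x + s' *\<^sub>R w + t' *\<^sub>R v)) (?H w v x) < ?e"
    using r2(2) by blast
  ultimately show False by (smt (verit) dist_real_def field_sum_of_halves)
qed

lemma second_derivative_symmetric:
  fixes f :: "'a::euclidean_space \<Rightarrow> 'b::euclidean_space"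
  assumes "open S" "smooth_on S f" "x \<in> S"
  shows "frechet_derivative (\<lambda>y. frechet_derivative f (at y) v) (at x) w =
    frechet_derivative (\<lambda>y. frechet_derivative f (at y) w) (at x) v"
proof (rule euclidean_eqI)
  fix b :: 'b
  have lin: "linear (\<lambda>u::'b. u \<bullet> b)" by (simp add: linear_iff inner_add_left)
  have comp: "frechet_derivative (\<lambda>y. g y \<bullet> b) (at y) u = frechet_derivative g (at y) u \<bullet> b"
    if "smooth_on S g" "y \<in> S" for g y u
    using frechet_derivative_at[OF has_derivative_inner_left[OF smooth_on_has_derivative[OF that]]] by metis
  have sm: "smooth_on S (\<lambda>y. f y \<bullet> b)"
    by (rule smooth_on_linear_comp[OF assms(1) lin assms(2)])
  have "frechet_derivative (\<lambda>y. frechet_derivative f (at y) v) (at x) w \<bullet> b =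
      frechet_derivative (\<lambda>y. frechet_derivative (\<lambda>y. f y \<bullet> b) (at y) v) (at x) w" for v w
    unfolding comp[OF smooth_on_deriv[OF assms(2)] assms(3), symmetric]
    by (rule fun_cong[OF frechet_derivative_cong[OF assms(1,3)]]) (simp add: comp[OF assms(2)])
  then show "frechet_derivative (\<lambda>y. frechet_derivative f (at y) v) (at x) w \<bullet> b =
    frechet_derivative (\<lambda>y. frechet_derivative f (at y) w) (at x) v \<bullet> b"
    using second_derivative_symmetric_real[OF assms(1) sm assms(3)] by simp
qed

section \<open>Families of linear and bilinear forms\<close>

lemma linear_deriv_in_argument:
  fixes \<theta> :: "'t::real_normed_vector \<Rightarrow> 'e::real_vector \<Rightarrow> 'c::real_normed_vector"
  assumes T: "open T" "t \<in> T" and lin: "\<And>s. s \<in> T \<Longrightarrow> linear (\<theta> s)"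
    and d: "\<And>u. ((\<lambda>s. \<theta> s u) has_derivative \<theta>' u) (at t)"
  shows "linear (\<lambda>u. \<theta>' u h)"
proof (rule linearI)
  fix u v
  have "((\<lambda>s. \<theta> s (u + v)) has_derivative (\<lambda>h. \<theta>' u h + \<theta>' v h)) (at t)"
    by (rule has_derivative_transform_within_open[OF has_derivative_add[OF d[of u] d[of v]] T])
      (simp add: linear_add[OF lin])
  from has_derivative_unique[OF this d] show "\<theta>' (u + v) h = \<theta>' u h + \<theta>' v h" by metis
next
  fix c u
  have "((\<lambda>s. \<theta> s (c *\<^sub>R u)) has_derivative (\<lambda>h. c *\<^sub>R \<theta>' u h)) (at t)"
    by (rule has_derivative_transform_within_open[OF has_derivative_scaleR_right[OF d[of u]] T])
      (simp add: linear_scale[OF lin])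
  from has_derivative_unique[OF this d] show "\<theta>' (c *\<^sub>R u) h = c *\<^sub>R \<theta>' u h" by metis
qed

text \<open>The product rule for a form that depends on a parameter, evaluated at a vector that depends on the
  same parameter. In a chart, tensor fields and derivatives are such forms.\<close>

lemma has_derivative_linear_eval:
  fixes \<theta> :: "'t::real_normed_vector \<Rightarrow> 'e::euclidean_space \<Rightarrow> 'c::real_normed_vector"
  assumes T: "open T" "t \<in> T" and lin: "\<And>s. s \<in> T \<Longrightarrow> linear (\<theta> s)"
    and d: "\<And>u. ((\<lambda>s. \<theta> s u) has_derivative \<theta>' u) (at t)"
    and U: "(U has_derivative U') (at t)"
  shows "((\<lambda>s. \<theta> s (U s)) has_derivative (\<lambda>h. \<theta>' (U t) h + \<theta> t (U' h))) (at t)"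
proof -
  have "((\<lambda>s. \<Sum>b\<in>Basis. (U s \<bullet> b) *\<^sub>R \<theta> s b) has_derivative
      (\<lambda>h. \<Sum>b\<in>Basis. (U t \<bullet> b) *\<^sub>R \<theta>' b h + (U' h \<bullet> b) *\<^sub>R \<theta> t b)) (at t)"
    by (intro has_derivative_sum has_derivative_scaleR has_derivative_inner_left U d)
  moreover have "(\<Sum>b\<in>Basis. (U t \<bullet> b) *\<^sub>R \<theta>' b h + (U' h \<bullet> b) *\<^sub>R \<theta> t b) = \<theta>' (U t) h + \<theta> t (U' h)" for h
    by (subst linear_Basis_expand[OF lin[OF T(2)], of "U' h"],
        subst linear_Basis_expand[OF linear_deriv_in_argument[OF T lin d], of "U t" h])
      (simp_all add: sum.distrib)
  ultimately have "((\<lambda>s. \<Sum>b\<in>Basis. (U s \<bullet> b) *\<^sub>R \<theta> s b) has_derivative (\<lambda>h. \<theta>' (U t) h + \<theta> t (U' h))) (at t)"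
    by simp
  then show ?thesis
    by (rule has_derivative_transform_within_open[OF _ T]) (rule linear_Basis_expand[OF lin, symmetric])
qed

lemma has_derivative_bilinear_eval:
  fixes G :: "'t::real_normed_vector \<Rightarrow> 'e::euclidean_space \<Rightarrow> 'f::euclidean_space \<Rightarrow> 'c::real_normed_vector"
  assumes T: "open T" "t \<in> T" and bil: "\<And>s. s \<in> T \<Longrightarrow> bilinear (G s)"
    and d: "\<And>u v. ((\<lambda>s. G s u v) has_derivative G' u v) (at t)"
    and U: "(U has_derivative U') (at t)" and V: "(V has_derivative V') (at t)"
  shows "((\<lambda>s. G s (U s) (V s)) has_derivative
     (\<lambda>h. G' (U t) (V t) h + G t (U' h) (V t) + G t (U t) (V' h))) (at t)"
proof -
  have "((\<lambda>s. G s (U s) v) has_derivative (\<lambda>h. G' (U t) v h + G t (U' h) v)) (at t)" for v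
    by (rule has_derivative_linear_eval[OF T _ d U]) (use bil in \<open>auto simp: bilinear_def\<close>)
  from has_derivative_linear_eval[where \<theta> = "\<lambda>s. G s (U s)", OF T _ this V] show ?thesis
    using bil by (simp add: bilinear_def)
qed

lemma smooth_on_linear_eval:
  fixes \<theta> :: "'a::euclidean_space \<Rightarrow> 'e::euclidean_space \<Rightarrow> 'c::euclidean_space"
  assumes "open T" "smooth_on T p" "smooth_on T U" "p ` T \<subseteq> S"
    and "\<And>u. smooth_on S (\<lambda>z. \<theta> z u)" "\<And>z. z \<in> S \<Longrightarrow> linear (\<theta> z)"
  shows "smooth_on T (\<lambda>t. \<theta> (p t) (U t))"
proof (rule smooth_on_cong[OF assms(1)])
  show "smooth_on T (\<lambda>t. \<Sum>b\<in>Basis. (U t \<bullet> b) *\<^sub>R \<theta> (p t) b)"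
    by (intro smooth_on_sum smooth_on_scaleR smooth_on_inner smooth_on_const assms
        smooth_on_compose[OF assms(1,2) assms(5) assms(4)])
  show "(\<Sum>b\<in>Basis. (U t \<bullet> b) *\<^sub>R \<theta> (p t) b) = \<theta> (p t) (U t)" if "t \<in> T" for t
    by (rule linear_Basis_expand[symmetric]) (use assms(4,6) that in auto)
qed

lemma smooth_on_bilinear_eval:
  fixes G :: "'a::euclidean_space \<Rightarrow> 'e::euclidean_space \<Rightarrow> 'f::euclidean_space \<Rightarrow> 'c::euclidean_space"
  assumes T: "open T" and p: "smooth_on T p" and U: "smooth_on T U" and V: "smooth_on T V" and S: "p ` T \<subseteq> S"
    and sm: "\<And>u v. smooth_on S (\<lambda>z. G z u v)" and bil: "\<And>z. z \<in> S \<Longrightarrow> bilinear (G z)"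
  shows "smooth_on T (\<lambda>t. G (p t) (U t) (V t))"
proof -
  have "smooth_on T (\<lambda>t. G (p t) (U t) v)" for v
    by (rule smooth_on_linear_eval[OF T p U S]) (use sm bil in \<open>auto simp: bilinear_def\<close>)
  then show ?thesis
    by (rule smooth_on_linear_eval[where \<theta> = "\<lambda>t. G (p t) (U t)", OF T smooth_on_id[OF T] V, rotated])
      (use bil S in \<open>auto simp: bilinear_def\<close>)
qed

lemma linear_deriv_of_smooth_family:
  assumes "open S" "z \<in> S" "\<And>u. smooth_on S (\<lambda>z. \<theta> z u)" "\<And>z. z \<in> S \<Longrightarrow> linear (\<theta> z)"
  shows "linear (\<lambda>u. frechet_derivative (\<lambda>z. \<theta> z u) (at z) h)"
  by (rule linear_deriv_in_argument[OF assms(1,2) assms(4) smooth_on_has_derivative[OF assms(3,2)]])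

lemma bilinear_expand:
  assumes "bilinear B"
  shows "B u v = (\<Sum>b\<in>Basis. \<Sum>c\<in>Basis. ((u \<bullet> b) * (v \<bullet> c)) *\<^sub>R B b c)"
proof -
  have l: "linear (B x)" "linear (\<lambda>x. B x y)" for x y using assms by (auto simp: bilinear_def)
  have "B u v = (\<Sum>b\<in>Basis. (u \<bullet> b) *\<^sub>R B b v)" by (rule linear_Basis_expand[OF l(2)])
  also have "\<dots> = (\<Sum>b\<in>Basis. (u \<bullet> b) *\<^sub>R (\<Sum>c\<in>Basis. (v \<bullet> c) *\<^sub>R B b c))"
    by (intro sum.cong refl arg_cong2[where f = scaleR]) (rule linear_Basis_expand[OF l(1)])
  finally show ?thesis by (simp add: scaleR_sum_right)
qed

text \<open>The minimum over the compact set of parameters and unit vectors is positive; homogeneity does the rest.\<close>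

lemma posdef_lower_bound:
  fixes G :: "'a::metric_space \<Rightarrow> 'e::euclidean_space \<Rightarrow> 'e \<Rightarrow> real"
  assumes C: "compact C" and cont: "\<And>u v. continuous_on C (\<lambda>z. G z u v)"
    and bil: "\<And>z. z \<in> C \<Longrightarrow> bilinear (G z)" and pos: "\<And>z v. z \<in> C \<Longrightarrow> v \<noteq> 0 \<Longrightarrow> G z v v > 0"
  shows "\<exists>c>0. \<forall>z\<in>C. \<forall>v. c * (norm v)\<^sup>2 \<le> G z v v"
proof (cases "C = {}")
  case False
  let ?K = "C \<times> sphere (0::'e) 1"
  have exp: "G z v v = (\<Sum>b\<in>Basis. \<Sum>c\<in>Basis. ((v \<bullet> b) * (v \<bullet> c)) *\<^sub>R G z b c)" if "z \<in> C" for z v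
    using bilinear_expand[OF bil[OF that]] .
  have "continuous_on ?K (\<lambda>p. \<Sum>b\<in>Basis. \<Sum>c\<in>Basis. ((snd p \<bullet> b) * (snd p \<bullet> c)) *\<^sub>R G (fst p) b c)"
    by (intro continuous_intros continuous_on_compose2[OF cont]) auto
  then have cK: "continuous_on ?K (\<lambda>p. G (fst p) (snd p) (snd p))"
    by (rule continuous_on_cong[THEN iffD1, rotated 2]) (auto simp: exp)
  obtain b :: 'e where "b \<in> Basis" using nonempty_Basis by blast
  then have "?K \<noteq> {}" using False by auto
  then obtain p where
    p: "p \<in> ?K" "\<And>q. q \<in> ?K \<Longrightarrow> G (fst p) (snd p) (snd p) \<le> G (fst q) (snd q) (snd q)"
    using continuous_attains_inf[OF compact_Times[OF C compact_sphere] _ cK] by blast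
  let ?c = "G (fst p) (snd p) (snd p)"
  have "snd p \<noteq> 0" using p(1) by auto
  then have "?c > 0" using p(1) by (auto intro: pos)
  moreover have "?c * (norm v)\<^sup>2 \<le> G z v v" if z: "z \<in> C" for z v
  proof (cases "v = 0")
    case True
    then show ?thesis using bilinear_lzero[OF bil[OF z]] by simp
  next
    case False
    let ?w = "v /\<^sub>R norm v"
    have v: "v = norm v *\<^sub>R ?w" using False by simp
    have "G z v v = (norm v)\<^sup>2 * G z ?w ?w"
      by (subst v, subst bilinear_lmul[OF bil[OF z]], subst v, subst bilinear_rmul[OF bil[OF z]])
        (use False in \<open>simp add: power2_eq_square\<close>)
    moreover have "?c \<le> G z ?w ?w" using p(2)[of "(z, ?w)"] z False by simp
    ultimately show ?thesis by (simp add: mult.commute[of ?c] mult_left_mono)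
  qed
  ultimately show ?thesis by blast
qed (use zero_less_one in blast)

text \<open>The form tested on \<open>e\<close> itself bounds \<open>e\<close> by its components \<open>G z e b\<close>, uniformly near \<open>z0\<close>. Differences of solutions
  of a linear system are estimated in this way.\<close>

lemma posdef_norm_bound:
  fixes G :: "'a::euclidean_space \<Rightarrow> 'e::euclidean_space \<Rightarrow> 'e \<Rightarrow> real"
  assumes S: "open S" "z0 \<in> S" and sm: "\<And>u v. continuous_on S (\<lambda>z. G z u v)"
    and bil: "\<And>z. z \<in> S \<Longrightarrow> bilinear (G z)" and pos: "\<And>z v. z \<in> S \<Longrightarrow> v \<noteq> 0 \<Longrightarrow> G z v v > 0"
  shows "\<exists>c r. c > 0 \<and> r > 0 \<and> cball z0 r \<subseteq> S \<and> (\<forall>z\<in>cball z0 r. \<forall>e. norm e \<le> c * (\<Sum>b\<in>Basis. \<bar>G z e b\<bar>))"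
proof -
  obtain r where r: "r > 0" "cball z0 r \<subseteq> S" using S open_contains_cball by blast
  have "\<exists>c>0. \<forall>z\<in>cball z0 r. \<forall>v. c * (norm v)\<^sup>2 \<le> G z v v"
    by (rule posdef_lower_bound) (use r bil pos in \<open>auto intro: continuous_on_subset[OF sm]\<close>)
  then obtain c where c: "c > 0" and le: "\<And>z v. z \<in> cball z0 r \<Longrightarrow> c * (norm v)\<^sup>2 \<le> G z v v" by blast
  have "norm e \<le> (1/c) * (\<Sum>b\<in>Basis. \<bar>G z e b\<bar>)" if z: "z \<in> cball z0 r" for z e
  proof (cases "e = 0")
    case True
    then show ?thesis using c by (simp add: sum_nonneg)
  next
    case False
    have "linear (G z e)" using bil r z by (auto simp: bilinear_def)
    from linear_Basis_expand[OF this, of e] have "G z e e = (\<Sum>b\<in>Basis. (e \<bullet> b) * G z e b)" by simp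
    also have "\<dots> \<le> (\<Sum>b\<in>Basis. norm e * \<bar>G z e b\<bar>)"
    proof (rule sum_mono)
      fix b :: 'e assume "b \<in> Basis"
      then have "\<bar>e \<bullet> b\<bar> * \<bar>G z e b\<bar> \<le> norm e * \<bar>G z e b\<bar>" by (intro mult_right_mono Basis_le_norm) auto
      then show "(e \<bullet> b) * G z e b \<le> norm e * \<bar>G z e b\<bar>" by (metis abs_ge_self abs_mult order_trans)
    qed
    also have "\<dots> = norm e * (\<Sum>b\<in>Basis. \<bar>G z e b\<bar>)" by (simp add: sum_distrib_left)
    finally have "c * (norm e)\<^sup>2 \<le> norm e * (\<Sum>b\<in>Basis. \<bar>G z e b\<bar>)" using le[OF z, of e] by linarith
    then have "c * norm e \<le> (\<Sum>b\<in>Basis. \<bar>G z e b\<bar>)" using False by (simp add: power2_eq_square)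
    then show ?thesis using c by (simp add: field_simps)
  qed
  with c r show ?thesis by (intro exI[of _ "1/c"] exI[of _ r]) auto
qed

lemma posdef_solvable:
  fixes G :: "'e::euclidean_space \<Rightarrow> 'e \<Rightarrow> real"
  assumes bil: "bilinear G" and pos: "\<And>v. v \<noteq> 0 \<Longrightarrow> G v v > 0"
  shows "\<exists>R. linear R \<and> (\<forall>x. \<forall>b\<in>Basis. G (R x) b = x \<bullet> b)"
proof -
  define T where "T u = (\<Sum>b\<in>Basis. G u b *\<^sub>R b)" for u
  have l: "linear (\<lambda>u. G u v)" "linear (G u)" for u v using bil by (auto simp: bilinear_def)
  have linT: "linear T" unfolding T_def
    by (rule linearI) (simp_all add: linear_add[OF l(1)] linear_scale[OF l(1)] scaleR_add_left sum.distrib scaleR_sum_right)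
  have Tb: "T u \<bullet> b = G u b" if "b \<in> Basis" for u b
    unfolding T_def using that by (simp add: inner_sum_left_Basis)
  have "u = 0" if "T u = 0" for u
  proof -
    have "G u b = 0" if "b \<in> Basis" for b using Tb[OF that, of u] \<open>T u = 0\<close> by simp
    then have "G u u = 0" using linear_Basis_expand[OF l(2), of u u] by simp
    then show ?thesis using pos[of u] by force
  qed
  then have "inj T" unfolding linear_injective_0[OF linT] by blast
  then have "surj T" using linT linear_injective_imp_surjective by blast
  then obtain R where R: "linear R" "T \<circ> R = id" using linear_surjective_right_inverse[OF linT] by blast
  have "G (R x) b = x \<bullet> b" if "b \<in> Basis" for x b
    using Tb[OF that, of "R x"] R(2) by (metis comp_apply id_apply)
  then show ?thesis using R(1) by blast
qed

text \<open>The solution of a linear system depends smoothly on the coefficients: the derivative of the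
  solution solves a system with the same matrix, whose right-hand side is less differentiable by one.\<close>

lemma solution_continuous:
  fixes G :: "'a::euclidean_space \<Rightarrow> 'e::euclidean_space \<Rightarrow> 'e \<Rightarrow> real"
  assumes S: "open S" and sm: "\<And>u v. continuous_on S (\<lambda>z. G z u v)"
    and bil: "\<And>z. z \<in> S \<Longrightarrow> bilinear (G z)" and pos: "\<And>z v. z \<in> S \<Longrightarrow> v \<noteq> 0 \<Longrightarrow> G z v v > 0"
    and f: "\<And>b. b \<in> Basis \<Longrightarrow> continuous_on S (\<lambda>z. f z b)"
    and eq: "\<And>z b. z \<in> S \<Longrightarrow> b \<in> Basis \<Longrightarrow> G z (u z) b = f z b"
  shows "continuous_on S u"
proof -
  have "(u \<longlongrightarrow> u z0) (at z0)" if z0: "z0 \<in> S" for z0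
  proof -
    obtain c r where c: "c > 0" "r > 0" "cball z0 r \<subseteq> S"
      and le: "\<And>z e. z \<in> cball z0 r \<Longrightarrow> norm e \<le> c * (\<Sum>b\<in>Basis. \<bar>G z e b\<bar>)"
      using posdef_norm_bound[OF S z0 sm bil pos] by blast
    let ?\<psi> = "\<lambda>z. c * (\<Sum>b\<in>Basis. \<bar>f z b - G z (u z0) b\<bar>)"
    have "continuous_on S ?\<psi>" by (intro continuous_intros f sm)
    then have "isCont ?\<psi> z0" using S z0 continuous_on_eq_continuous_at by blast
    then have "(?\<psi> \<longlongrightarrow> ?\<psi> z0) (at z0)" by (rule isContD)
    then have lim: "(?\<psi> \<longlongrightarrow> 0) (at z0)" using eq[OF z0] by simp
    have "norm (u z - u z0) \<le> ?\<psi> z" if z: "z \<in> cball z0 r" for z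
    proof -
      have "z \<in> S" using c z by blast
      then have "G z (u z - u z0) b = f z b - G z (u z0) b" if "b \<in> Basis" for b
        using bilinear_lsub[OF bil] eq that by metis
      then show ?thesis using le[OF z, of "u z - u z0"] by simp
    qed
    then have "\<forall>\<^sub>F z in at z0. norm (u z - u z0) \<le> ?\<psi> z"
      unfolding eventually_at using c by (intro exI[of _ r]) (auto simp: dist_commute)
    then have "((\<lambda>z. u z - u z0) \<longlongrightarrow> 0) (at z0)" by (rule Lim_null_comparison[OF _ lim])
    then show ?thesis using LIM_zero_cancel by blast
  qed
  then show ?thesis by (meson continuous_at_imp_continuous_on continuous_at)
qed

text \<open>The candidate \<open>u'\<close> solves the differentiated system. The error \<open>u z - u z0 - u' (z - z0)\<close> then solves a system whose
  right-hand side vanishes at \<open>z0\<close> together with its derivative, and the uniform bound carries this over to the error.\<close>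

lemma solution_has_derivative:
  fixes G :: "'a::euclidean_space \<Rightarrow> 'e::euclidean_space \<Rightarrow> 'e \<Rightarrow> real"
  assumes S: "open S" "z0 \<in> S" and sm: "\<And>u v. smooth_on S (\<lambda>z. G z u v)"
    and bil: "\<And>z. z \<in> S \<Longrightarrow> bilinear (G z)" and pos: "\<And>z v. z \<in> S \<Longrightarrow> v \<noteq> 0 \<Longrightarrow> G z v v > 0"
    and f: "\<And>b. b \<in> Basis \<Longrightarrow> ((\<lambda>z. f z b) has_derivative f' b) (at z0)"
    and eq: "\<And>z b. z \<in> S \<Longrightarrow> b \<in> Basis \<Longrightarrow> G z (u z) b = f z b"
  shows "\<exists>u'. (u has_derivative u') (at z0) \<and> (\<forall>b\<in>Basis. \<forall>h.
     G z0 (u' h) b = f' b h - frechet_derivative (\<lambda>z. G z (u z0) b) (at z0) h)"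
proof -
  note DG = smooth_on_has_derivative[OF sm S(2)]
  let ?rhs = "\<lambda>h b. f' b h - frechet_derivative (\<lambda>z. G z (u z0) b) (at z0) h"
  obtain R where R: "linear R" "\<And>x b. b \<in> Basis \<Longrightarrow> G z0 (R x) b = x \<bullet> b"
    using posdef_solvable[OF bil[OF S(2)] pos[OF S(2)]] by blast
  define u' where "u' h = R (\<Sum>b\<in>Basis. ?rhs h b *\<^sub>R b)" for h
  have bl: "bounded_linear (\<lambda>h. \<Sum>b\<in>Basis. ?rhs h b *\<^sub>R b)"
    by (intro bounded_linear_sum bounded_linear_scaleR_left[THEN bounded_linear_compose] bounded_linear_sub
        has_derivative_bounded_linear[OF f] has_derivative_bounded_linear[OF DG])
  then have u': "bounded_linear u'" unfolding u'_def
    using bounded_linear_compose[of R] R(1) linear_conv_bounded_linear by blast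
  have sol: "G z0 (u' h) b = ?rhs h b" if "b \<in> Basis" for h b
    using R(2)[OF that] that by (simp add: u'_def inner_sum_left_Basis)
  let ?e = "\<lambda>z. u z - u z0 - u' (z - z0)"
  have \<psi>: "((\<lambda>z. f z b - G z (u z0) b - G z (u' (z - z0)) b) has_derivative (\<lambda>h. 0)) (at z0)"
    if b: "b \<in> Basis" for b
  proof -
    have lin: "linear (\<lambda>v. G z v b)" if "z \<in> S" for z using bil[OF that] by (simp add: bilinear_def)
    have "((\<lambda>z. u' (z - z0)) has_derivative u') (at z0)"
      by (rule bounded_linear.has_derivative[OF u', where g' = "\<lambda>h. h"]) (auto intro!: derivative_eq_intros)
    from has_derivative_linear_eval[OF S lin DG this]
    have D1: "((\<lambda>z. G z (u' (z - z0)) b) has_derivative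
      (\<lambda>h. frechet_derivative (\<lambda>z. G z (u' (z0 - z0)) b) (at z0) h + G z0 (u' h) b)) (at z0)" .
    have "linear (\<lambda>v. frechet_derivative (\<lambda>z. G z v b) (at z0) h)" for h
      by (rule linear_deriv_of_smooth_family[OF S sm lin])
    from linear_0[OF this] have 0: "frechet_derivative (\<lambda>z. G z (u' 0) b) (at z0) h = 0" for h
      by (simp add: linear_0[OF bounded_linear.linear[OF u']])
    show ?thesis
      by (rule has_derivative_eq_rhs[OF has_derivative_diff[OF has_derivative_diff[OF f[OF b] DG] D1]])
        (simp add: 0 sol[OF b])
  qed
  obtain c r where c: "c > 0" "r > 0" "cball z0 r \<subseteq> S"
    and le: "\<And>z e. z \<in> cball z0 r \<Longrightarrow> norm e \<le> c * (\<Sum>b\<in>Basis. \<bar>G z e b\<bar>)"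
    using posdef_norm_bound[OF S smooth_on_continuous_on[OF sm] bil pos] by blast
  let ?\<psi> = "\<lambda>z b. f z b - G z (u z0) b - G z (u' (z - z0)) b"
  have \<psi>0: "f z0 b - G z0 (u z0) b - G z0 (u' 0) b = 0" if "b \<in> Basis" for b
    using eq[OF S(2) that] bilinear_lzero[OF bil[OF S(2)]] by (simp add: linear_0[OF bounded_linear.linear[OF u']])
  have "((\<lambda>z. c * (\<Sum>b\<in>Basis. norm (?\<psi> z b - ?\<psi> z0 b - 0) / norm (z - z0))) \<longlongrightarrow> c * (\<Sum>b\<in>(Basis::'e set). 0)) (at z0)"
    by (intro tendsto_mult tendsto_sum tendsto_const) (use \<psi> in \<open>simp only: has_derivative_iff_norm\<close>)
  then have lim: "((\<lambda>z. c * (\<Sum>b\<in>Basis. \<bar>?\<psi> z b\<bar> / norm (z - z0))) \<longlongrightarrow> 0) (at z0)"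
    by (simp add: \<psi>0)
  have "norm (?e z) / norm (z - z0) \<le> c * (\<Sum>b\<in>Basis. \<bar>?\<psi> z b\<bar> / norm (z - z0))" if z: "z \<in> cball z0 r" for z
  proof -
    have zS: "z \<in> S" using c z by blast
    then have "G z (?e z) b = ?\<psi> z b" if "b \<in> Basis" for b
      using bilinear_lsub[OF bil[OF zS]] eq[OF zS that] by simp
    then have "norm (?e z) \<le> c * (\<Sum>b\<in>Basis. \<bar>?\<psi> z b\<bar>)" using le[OF z, of "?e z"] by simp
    then have "norm (?e z) / norm (z - z0) \<le> c * (\<Sum>b\<in>Basis. \<bar>?\<psi> z b\<bar>) / norm (z - z0)"
      by (rule divide_right_mono) simp
    then show ?thesis by (simp flip: sum_divide_distrib)
  qed
  then have "\<forall>\<^sub>F z in at z0. norm (norm (?e z) / norm (z - z0)) \<le> c * (\<Sum>b\<in>Basis. \<bar>?\<psi> z b\<bar> / norm (z - z0))"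
    unfolding eventually_at using c by (intro exI[of _ r]) (auto simp: dist_commute)
  then have "((\<lambda>z. norm (?e z) / norm (z - z0)) \<longlongrightarrow> 0) (at z0)"
    by (rule Lim_null_comparison[OF _ lim])
  then have "(u has_derivative u') (at z0)" using u' by (simp add: has_derivative_iff_norm)
  with sol show ?thesis by blast
qed

lemma solution_C_k:
  fixes G :: "'a::euclidean_space \<Rightarrow> 'e::euclidean_space \<Rightarrow> 'e \<Rightarrow> real"
  assumes S: "open S" and sm: "\<And>u v. smooth_on S (\<lambda>z. G z u v)"
    and bil: "\<And>z. z \<in> S \<Longrightarrow> bilinear (G z)" and pos: "\<And>z v. z \<in> S \<Longrightarrow> v \<noteq> 0 \<Longrightarrow> G z v v > 0"
    and "\<And>b. b \<in> Basis \<Longrightarrow> C_k_on k S (\<lambda>z. f z b)"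
    and "\<And>z b. z \<in> S \<Longrightarrow> b \<in> Basis \<Longrightarrow> G z (u z) b = f z b"
  shows "C_k_on k S u"
  using assms(5,6)
proof (induction k arbitrary: f u)
  case 0
  then show ?case
    unfolding C_k_on.simps by (intro solution_continuous[OF S smooth_on_continuous_on[OF sm] bil pos])
next
  case (Suc k)
  note Df = C_k_on_SucD[OF Suc.prems(1)]
  have "\<exists>u'. (u has_derivative u') (at z) \<and> (\<forall>b\<in>Basis. \<forall>h.
     G z (u' h) b = frechet_derivative (\<lambda>z. f z b) (at z) h - frechet_derivative (\<lambda>z'. G z' (u z) b) (at z) h)"
    if "z \<in> S" for z
    by (rule solution_has_derivative[OF S that sm bil pos Df(1)[OF _ that]]) (use Suc.prems(2) in auto)
  then obtain u' where u': "\<And>z. z \<in> S \<Longrightarrow> (u has_derivative u' z) (at z)"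
    and sol: "\<And>z b h. z \<in> S \<Longrightarrow> b \<in> Basis \<Longrightarrow>
     G z (u' z h) b = frechet_derivative (\<lambda>z. f z b) (at z) h - frechet_derivative (\<lambda>z'. G z' (u z) b) (at z) h"
    by metis
  have u: "C_k_on k S u"
    by (rule Suc.IH[OF C_k_on_mono[OF Suc.prems(1)] Suc.prems(2)])
  have "C_k_on k S (\<lambda>z. u' z h)" for h
  proof (rule Suc.IH[OF _ sol])
    fix b :: 'e assume b: "b \<in> Basis"
    have lin: "linear (\<lambda>v. frechet_derivative (\<lambda>z. G z v b) (at z) h)" if "z \<in> S" for z
      by (rule linear_deriv_of_smooth_family[OF S that sm]) (use bil in \<open>auto simp: bilinear_def\<close>)
    have "C_k_on k S (\<lambda>z. frechet_derivative (\<lambda>z. f z b) (at z) h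
       + (\<Sum>c\<in>Basis. (u z \<bullet> c) *\<^sub>R (-1 * frechet_derivative (\<lambda>z'. G z' c b) (at z) h)))"
    proof (intro C_k_on_add[OF S] C_k_on_sum[OF S] C_k_on_bilinear[OF S bounded_bilinear_scaleR])
      show "C_k_on k S (\<lambda>z. u z \<bullet> c)" for c
        by (rule C_k_on_linear_comp[OF S _ u]) (simp add: linear_iff inner_add_left)
      show "C_k_on k S (\<lambda>z. -1 * frechet_derivative (\<lambda>z'. G z' c b) (at z) h)" for c
        using smooth_on_cmult[OF S smooth_on_deriv[OF sm], of "-1" c b h] unfolding smooth_on_def by blast
    qed (rule Df(2)[OF b])
    then show "C_k_on k S (\<lambda>z. frechet_derivative (\<lambda>z. f z b) (at z) h - frechet_derivative (\<lambda>z'. G z' (u z) b) (at z) h)"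
    proof (rule C_k_on_cong[OF S, rotated])
      fix z assume z: "z \<in> S"
      show "frechet_derivative (\<lambda>z. f z b) (at z) h
         + (\<Sum>c\<in>Basis. (u z \<bullet> c) *\<^sub>R (-1 * frechet_derivative (\<lambda>z'. G z' c b) (at z) h)) =
         frechet_derivative (\<lambda>z. f z b) (at z) h - frechet_derivative (\<lambda>z'. G z' (u z) b) (at z) h"
        by (subst linear_Basis_expand[OF lin[OF z], of "u z"]) (simp add: sum_negf)
    qed
  qed
  from C_k_on_SucI[OF S u' this] show ?case .
qed

lemma solution_smooth:
  fixes G :: "'a::euclidean_space \<Rightarrow> 'e::euclidean_space \<Rightarrow> 'e \<Rightarrow> real"
  assumes "open S" "\<And>u v. smooth_on S (\<lambda>z. G z u v)"
    and "\<And>z. z \<in> S \<Longrightarrow> bilinear (G z)" "\<And>z v. z \<in> S \<Longrightarrow> v \<noteq> 0 \<Longrightarrow> G z v v > 0"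
    and "\<And>y. smooth_on S (\<lambda>z. f z y)"
    and "\<And>z y. z \<in> S \<Longrightarrow> G z (u z) y = f z y"
  shows "smooth_on S u"
  unfolding smooth_on_def
  by (intro allI solution_C_k[OF assms(1-4), where f = f]) (use assms(5,6) in \<open>auto simp: smooth_on_def\<close>)

section \<open>Vector fields on open sets: the second-derivative test and commutation\<close>

text \<open>The derivative of the field \<open>X\<close> is paired with the first derivative of \<open>f\<close> only: this term vanishes at a
  maximum of \<open>f\<close>, and for fields that do not change in the direction of each other.\<close>

lemma has_derivative_deriv_dir:
  fixes f :: "'a::euclidean_space \<Rightarrow> 'b::euclidean_space"
  assumes S: "open S" "x \<in> S" and f: "smooth_on S f" and X: "(X has_derivative X') (at x)"
  shows "((\<lambda>y. frechet_derivative f (at y) (X y)) has_derivative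
     (\<lambda>k. frechet_derivative (\<lambda>y. frechet_derivative f (at y) (X x)) (at x) k + frechet_derivative f (at x) (X' k))) (at x)"
  by (rule has_derivative_linear_eval[OF S has_derivative_linear[OF smooth_on_has_derivative[OF f]]
        smooth_on_has_derivative[OF smooth_on_deriv[OF f] S(2)] X])

text \<open>Otherwise \<open>f\<close> would increase along the line with direction \<open>v\<close>.\<close>

lemma second_derivative_nonpos_at_max:
  fixes f :: "'a::euclidean_space \<Rightarrow> real"
  assumes S: "open S" "x \<in> S" and f: "smooth_on S f" and max: "\<And>y. y \<in> S \<Longrightarrow> f y \<le> f x"
  shows "frechet_derivative (\<lambda>y. frechet_derivative f (at y) v) (at x) v \<le> 0"
proof (rule ccontr)
  let ?D = "\<lambda>y. frechet_derivative f (at y)"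
  assume "\<not> ?thesis"
  then have pos: "frechet_derivative (\<lambda>y. ?D y v) (at x) v > 0" by simp
  have D0: "?D x = (\<lambda>v. 0)"
    by (rule differential_zero_maxmin[OF S(2,1) smooth_on_has_derivative[OF f S(2)]]) (use max in blast)
  have scale: "?D y (c *\<^sub>R v) = ?D y v * c" if "y \<in> S" for y c
    using linear_scale[OF has_derivative_linear[OF smooth_on_has_derivative[OF f that]]] by simp
  have d1: "((\<lambda>s. f (x + s *\<^sub>R v)) has_real_derivative ?D (x + s *\<^sub>R v) v) (at s)" if "x + s *\<^sub>R v \<in> S" for s
  proof -
    have "((\<lambda>s. f (x + s *\<^sub>R v)) has_derivative (\<lambda>c. ?D (x + s *\<^sub>R v) (c *\<^sub>R v))) (at s)"
      by (rule has_derivative_compose[where f = "\<lambda>s. x + s *\<^sub>R v" and x = s,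
            OF _ smooth_on_has_derivative[OF f that]]) (auto intro!: derivative_eq_intros)
    then show ?thesis by (simp add: has_field_derivative_def scale[OF that])
  qed
  note DD = smooth_on_has_derivative[OF smooth_on_deriv[OF f, of v] S(2)]
  have "((\<lambda>s. ?D (x + s *\<^sub>R v) v) has_derivative (\<lambda>c. frechet_derivative (\<lambda>y. ?D y v) (at x) (c *\<^sub>R v))) (at 0)"
    by (rule has_derivative_compose[where f = "\<lambda>s. x + s *\<^sub>R v" and x = 0 and g = "\<lambda>y. ?D y v"])
      (use DD in \<open>auto intro!: derivative_eq_intros\<close>)
  then have "((\<lambda>s. ?D (x + s *\<^sub>R v) v) has_real_derivative frechet_derivative (\<lambda>y. ?D y v) (at x) v) (at 0)"
    using linear_scale[OF has_derivative_linear[OF DD], of _ v]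
    by (simp add: has_field_derivative_def mult.commute[of _ "frechet_derivative _ _ _"])
  from DERIV_pos_inc_right[OF this pos] obtain d where d: "d > 0" "\<And>h. 0 < h \<Longrightarrow> h < d \<Longrightarrow> 0 < ?D (x + h *\<^sub>R v) v"
    using D0 by auto
  obtain e where e: "e > 0" "ball x e \<subseteq> S" using S open_contains_ball by blast
  define r where "r = e / (norm v + 1)"
  have inS: "x + s *\<^sub>R v \<in> S" if "\<bar>s\<bar> < r" for s
  proof -
    have pos: "norm v + 1 > 0" using norm_ge_zero[of v] by linarith
    have "\<bar>s\<bar> * norm v \<le> \<bar>s\<bar> * (norm v + 1)" by (intro mult_left_mono) auto
    also have "\<dots> < e" using that pos by (simp add: r_def field_simps)
    finally show ?thesis using e by (auto simp: dist_norm)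
  qed
  have r: "r > 0" "\<And>s. \<bar>s\<bar> < r \<Longrightarrow> x + s *\<^sub>R v \<in> S"
    using inS e by (auto simp: r_def add_nonneg_pos)
  define h where "h = min d r / 2"
  have h: "0 < h" "h < d" "h < r" using d r by (auto simp: h_def)
  obtain s where s: "0 < s" "s < h" "f (x + h *\<^sub>R v) - f (x + 0 *\<^sub>R v) = (h - 0) * ?D (x + s *\<^sub>R v) v"
    using MVT2[of 0 h "\<lambda>s. f (x + s *\<^sub>R v)" "\<lambda>s. ?D (x + s *\<^sub>R v) v", OF h(1) d1] r h by auto
  moreover have "h * ?D (x + s *\<^sub>R v) v > 0" using d(2)[of s] h s by (intro mult_pos_pos) auto
  ultimately have "f (x + h *\<^sub>R v) > f x" by simp
  moreover have "f (x + h *\<^sub>R v) \<le> f x" using max r h by simp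
  ultimately show False by simp
qed

lemma field_derivative_twice_nonpos_at_max:
  fixes f :: "'a::euclidean_space \<Rightarrow> real"
  assumes S: "open S" "x \<in> S" and f: "smooth_on S f" and max: "\<And>y. y \<in> S \<Longrightarrow> f y \<le> f x" and X: "smooth_on S X"
  shows "frechet_derivative (\<lambda>y. frechet_derivative f (at y) (X y)) (at x) (X x) \<le> 0"
proof -
  have D0: "frechet_derivative f (at x) = (\<lambda>v. 0)"
    by (rule differential_zero_maxmin[OF S(2,1) smooth_on_has_derivative[OF f S(2)]]) (use max in blast)
  have "frechet_derivative (\<lambda>y. frechet_derivative f (at y) (X y)) (at x) (X x) =
      frechet_derivative (\<lambda>y. frechet_derivative f (at y) (X x)) (at x) (X x)"
    using frechet_derivative_at[OF has_derivative_deriv_dir[OF S f smooth_on_has_derivative[OF X S(2)]], symmetric]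
    by (simp add: D0)
  then show ?thesis using second_derivative_nonpos_at_max[OF S f max] by simp
qed

lemma frechet_derivative_fst_slice:
  assumes "smooth_on S f" "(p, q) \<in> S"
  shows "frechet_derivative (\<lambda>p. f (p, q)) (at p) u = frechet_derivative f (at (p, q)) (u, 0)"
proof -
  have "((\<lambda>p. (p, q)) has_derivative (\<lambda>u. (u, 0))) (at p)" by (auto intro!: derivative_eq_intros)
  from has_derivative_compose[OF this smooth_on_has_derivative[OF assms]]
  show ?thesis using frechet_derivative_at by metis
qed

lemma frechet_derivative_snd_slice:
  assumes "smooth_on S f" "(p, q) \<in> S"
  shows "frechet_derivative (\<lambda>q. f (p, q)) (at q) u = frechet_derivative f (at (p, q)) (0, u)"
proof -
  have "((\<lambda>q. (p, q)) has_derivative (\<lambda>u. (0, u))) (at q)" by (auto intro!: derivative_eq_intros)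
  from has_derivative_compose[OF this smooth_on_has_derivative[OF assms]]
  show ?thesis using frechet_derivative_at by metis
qed

text \<open>Neither field changes along the other one, so that only the second derivative of \<open>f\<close> remains, which
  is symmetric.\<close>

lemma factor_fields_commute:
  fixes f :: "'a::euclidean_space \<times> 'b::euclidean_space \<Rightarrow> 'c::euclidean_space"
  assumes S: "open (S \<times> T)" "p \<in> S" "q \<in> T" and f: "smooth_on (S \<times> T) f"
    and X: "smooth_on S X" and Y: "smooth_on T Y"
  shows "frechet_derivative (\<lambda>z. frechet_derivative f (at z) (0, Y (snd z))) (at (p, q)) (X p, 0) =
    frechet_derivative (\<lambda>z. frechet_derivative f (at z) (X (fst z), 0)) (at (p, q)) (0, Y q)"
proof -
  have pq: "(p, q) \<in> S \<times> T" using S by simp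
  have X': "(X has_derivative frechet_derivative X (at p)) (at (fst (p, q)))"
    using smooth_on_has_derivative[OF X S(2)] by simp
  have Y': "(Y has_derivative frechet_derivative Y (at q)) (at (snd (p, q)))"
    using smooth_on_has_derivative[OF Y S(3)] by simp
  have dX: "((\<lambda>z. (X (fst z), 0::'b)) has_derivative (\<lambda>k. (frechet_derivative X (at p) (fst k), 0))) (at (p, q))"
    by (intro has_derivative_Pair has_derivative_const has_derivative_compose[of fst fst "(p, q)" UNIV X, OF _ X'] has_derivative_fst has_derivative_ident)
  have dY: "((\<lambda>z. (0::'a, Y (snd z))) has_derivative (\<lambda>k. (0, frechet_derivative Y (at q) (snd k)))) (at (p, q))"
    by (intro has_derivative_Pair has_derivative_const has_derivative_compose[of snd snd "(p, q)" UNIV Y, OF _ Y'] has_derivative_snd has_derivative_ident)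
  have 0: "frechet_derivative X (at p) 0 = 0" "frechet_derivative Y (at q) 0 = 0"
    "frechet_derivative f (at (p, q)) (0, 0) = 0"
    using linear_0[OF has_derivative_linear[OF smooth_on_has_derivative[OF X S(2)]]]
      linear_0[OF has_derivative_linear[OF smooth_on_has_derivative[OF Y S(3)]]]
      linear_0[OF has_derivative_linear[OF smooth_on_has_derivative[OF f pq]]] by (simp_all add: zero_prod_def)
  show ?thesis
    unfolding frechet_derivative_at[OF has_derivative_deriv_dir[OF S(1) pq f dX], symmetric]
      frechet_derivative_at[OF has_derivative_deriv_dir[OF S(1) pq f dY], symmetric]
    by (simp add: 0 second_derivative_symmetric[OF S(1) f pq])
qed

section \<open>Unique continuation for Killing forms\<close>

text \<open>Gronwall: with \<open>E = \<Sum> y\<^sub>i\<^sup>2\<close> and a suitable constant \<open>K\<close>, the function \<open>E e\<^bsup>-Kt\<^esup>\<close> decreases.\<close>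

lemma linear_system_zero:
  fixes y :: "'i \<Rightarrow> real \<Rightarrow> real"
  assumes I: "finite I" and d: "\<And>i t. i \<in> I \<Longrightarrow> 0 \<le> t \<Longrightarrow> t \<le> 1 \<Longrightarrow> (y i has_real_derivative y' i t) (at t)"
    and le: "\<And>i t. i \<in> I \<Longrightarrow> 0 \<le> t \<Longrightarrow> t \<le> 1 \<Longrightarrow> \<bar>y' i t\<bar> \<le> C * (\<Sum>j\<in>I. \<bar>y j t\<bar>)"
    and 0: "\<And>i. i \<in> I \<Longrightarrow> y i 0 = 0" and i: "i \<in> I"
  shows "y i 1 = 0"
proof -
  let ?E = "\<lambda>t. \<Sum>i\<in>I. (y i t)\<^sup>2"
  define K where "K = 2 * \<bar>C\<bar> * real (card I)"
  let ?E' = "\<lambda>t. \<Sum>i\<in>I. 2 * y i t * y' i t"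
  have E: "(?E has_real_derivative ?E' t) (at t)" if "0 \<le> t" "t \<le> 1" for t
    by (intro DERIV_sum) (use d that in \<open>auto intro!: derivative_eq_intros\<close>)
  have E': "?E' t \<le> K * ?E t" if t: "0 \<le> t" "t \<le> 1" for t
  proof -
    let ?s = "\<Sum>j\<in>I. \<bar>y j t\<bar>"
    have "?E' t \<le> (\<Sum>i\<in>I. 2 * \<bar>C\<bar> * ?s * \<bar>y i t\<bar>)"
    proof (rule sum_mono)
      fix i assume i: "i \<in> I"
      have "\<bar>y' i t\<bar> \<le> \<bar>C\<bar> * ?s"
        using le[OF i t] mult_right_mono[OF abs_ge_self[of C], of ?s] by (simp add: sum_nonneg)
      then have "\<bar>y i t\<bar> * \<bar>y' i t\<bar> \<le> \<bar>y i t\<bar> * (\<bar>C\<bar> * ?s)" by (rule mult_left_mono) simp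
      then show "2 * y i t * y' i t \<le> 2 * \<bar>C\<bar> * ?s * \<bar>y i t\<bar>"
        using abs_ge_self[of "y i t * y' i t"] by (simp add: abs_mult algebra_simps)
    qed
    also have "\<dots> = 2 * \<bar>C\<bar> * ?s\<^sup>2" by (simp add: sum_distrib_left[symmetric] power2_eq_square)
    also have "\<dots> \<le> 2 * \<bar>C\<bar> * (real (card I) * ?E t)"
      using Cauchy_Schwarz_ineq_sum[of "\<lambda>j. 1" "\<lambda>j. \<bar>y j t\<bar>" I] by (intro mult_left_mono) auto
    finally show ?thesis by (simp add: K_def)
  qed
  let ?F = "\<lambda>t. ?E t * exp (- K * t)"
  have "?F 1 \<le> ?F 0"
  proof (rule DERIV_nonpos_imp_nonincreasing[of 0 1 ?F])
    fix t :: real assume t: "0 \<le> t" "t \<le> 1"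
    have "(?F has_real_derivative (?E' t - K * ?E t) * exp (- K * t)) (at t)"
      by (rule DERIV_cong[OF DERIV_mult[OF E[OF t] DERIV_fun_exp]])
        (auto intro!: derivative_eq_intros simp: algebra_simps)
    moreover have "(?E' t - K * ?E t) * exp (- K * t) \<le> 0"
      using E'[OF t] by (simp add: mult_nonpos_nonneg)
    ultimately show "\<exists>D. (?F has_real_derivative D) (at t) \<and> D \<le> 0" by blast
  qed simp
  also have "\<dots> = 0" using 0 by simp
  finally have "?E 1 \<le> 0" by (simp add: mult_le_0_iff)
  then have "?E 1 = 0" using sum_nonneg[of I "\<lambda>i. (y i 1)\<^sup>2"] by simp
  then have "\<forall>i\<in>I. (y i 1)\<^sup>2 = 0" by (subst (asm) sum_nonneg_eq_0_iff[OF I]) auto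
  then show ?thesis using i by simp
qed

text \<open>A one-form \<open>\<theta>\<close> with \<open>\<partial>\<^sub>u\<theta>(v) + \<partial>\<^sub>v\<theta>(u) = 2 \<theta>(\<Gamma>(u,v)) =: S(u,v)\<close> has
  \<open>2 \<partial>\<^sub>u\<partial>\<^sub>v\<theta>(w) = \<partial>\<^sub>u S(v,w) + \<partial>\<^sub>v S(u,w) - \<partial>\<^sub>w S(u,v)\<close>. Along a segment, \<open>\<theta>\<close> and \<open>\<partial>\<theta>\<close> therefore satisfy a
  linear system of ordinary differential equations.\<close>

lemma killing_form_unique_continuation:
  fixes \<theta> :: "'e::euclidean_space \<Rightarrow> 'e \<Rightarrow> real" and \<Gamma> :: "'e \<Rightarrow> 'e \<Rightarrow> 'e \<Rightarrow> 'e"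
  assumes B: "open B" "convex B" and sm: "\<And>v. smooth_on B (\<lambda>z. \<theta> z v)" and lin: "\<And>z. z \<in> B \<Longrightarrow> linear (\<theta> z)"
    and \<Gamma>: "\<And>u v. smooth_on B (\<lambda>z. \<Gamma> z u v)"
    and kill: "\<And>z u v. z \<in> B \<Longrightarrow> frechet_derivative (\<lambda>z. \<theta> z v) (at z) u + frechet_derivative (\<lambda>z. \<theta> z u) (at z) v = 2 * \<theta> z (\<Gamma> z u v)"
    and z0: "z0 \<in> B" "\<And>b. b \<in> Basis \<Longrightarrow> \<theta> z0 b = 0" "\<And>b c. b \<in> Basis \<Longrightarrow> c \<in> Basis \<Longrightarrow> frechet_derivative (\<lambda>z. \<theta> z c) (at z0) b = 0"
    and z1: "z1 \<in> B"
  shows "\<theta> z1 v = 0"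
proof -
  let ?d = "\<lambda>b c z. frechet_derivative (\<lambda>z. \<theta> z c) (at z) b"
  let ?S = "\<lambda>b c z. 2 * \<theta> z (\<Gamma> z b c)"
  let ?dS = "\<lambda>a b c z. frechet_derivative (?S b c) (at z) a"
  let ?dd = "\<lambda>a b c z. frechet_derivative (?d b c) (at z) a"
  \<comment> \<open>the components of the 1-jet: \<open>Inl c\<close> for \<open>\<theta>(c)\<close>, \<open>Inr (b, c)\<close> for \<open>\<partial>\<^sub>b\<theta>(c)\<close>\<close>
  define I where "I = (Basis :: 'e set) <+> ((Basis :: 'e set) \<times> (Basis :: 'e set))"
  define Y where "Y i z = (case i of Inl c \<Rightarrow> \<theta> z c | Inr (b, c) \<Rightarrow> ?d b c z)" for i z
  have Y: "Y (Inl c) = (\<lambda>z. \<theta> z c)" "Y (Inr (b, c)) = ?d b c" for b c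
    by (simp_all add: fun_eq_iff Y_def)
  have I: "finite I" by (simp add: I_def)
  have Ysm: "smooth_on B (Y i)" for i
    unfolding Y_def by (cases i) (auto split: prod.splits intro: sm smooth_on_deriv)
  have second: "2 * ?dd a b c z = ?dS a b c z + ?dS b a c z - ?dS c a b z" if z: "z \<in> B" for a b c z
  proof -
    have s1: "?dS a b c z = ?dd a b c z + ?dd a c b z" for a b c
    proof -
      have "?dS a b c z = frechet_derivative (\<lambda>z. ?d b c z + ?d c b z) (at z) a"
        by (rule fun_cong[OF frechet_derivative_cong[OF B(1) z]]) (simp add: kill)
      then show ?thesis
        unfolding frechet_derivative_at[OF has_derivative_add[OF smooth_on_has_derivative[OF smooth_on_deriv[OF sm, of c b] z]
          smooth_on_has_derivative[OF smooth_on_deriv[OF sm, of b c] z]], symmetric] .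
    qed
    have s2: "?dd a b c z = ?dd b a c z" for a b c
      by (rule second_derivative_symmetric[OF B(1) sm z])
    show ?thesis
      using s1[where a=a and b=b and c=c] s1[where a=b and b=a and c=c] s1[where a=c and b=a and c=b] s2[where a=a and b=b and c=c] s2[where a=a and b=c and c=b] s2[where a=b and b=c and c=a] by linarith
  qed
  \<comment> \<open>so the derivatives of the 1-jet are linear in the 1-jet, with coefficients from \<open>\<Gamma>\<close> and its derivative\<close>
  have dS: "?dS a b c z = 2 * (\<Sum>l\<in>Basis. (\<Gamma> z b c \<bullet> l) * ?d a l z + (frechet_derivative (\<lambda>z. \<Gamma> z b c) (at z) a \<bullet> l) * \<theta> z l)"
    if z: "z \<in> B" for a b c z
  proof -
    have "?dS a b c z = frechet_derivative (\<lambda>z. 2 * (\<Sum>l\<in>Basis. (\<Gamma> z b c \<bullet> l) * \<theta> z l)) (at z) a"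
      proof (rule fun_cong[OF frechet_derivative_cong[OF B(1) z]])
      fix y assume "y \<in> B"
      show "?S b c y = 2 * (\<Sum>l\<in>Basis. (\<Gamma> y b c \<bullet> l) * \<theta> y l)"
        by (subst linear_Basis_expand[OF lin[OF \<open>y \<in> B\<close>], of "\<Gamma> y b c"]) simp
    qed
    moreover have D: "((\<lambda>z. 2 * (\<Sum>l\<in>Basis. (\<Gamma> z b c \<bullet> l) * \<theta> z l)) has_derivative
      (\<lambda>a. 2 * (\<Sum>l\<in>Basis. (\<Gamma> z b c \<bullet> l) * ?d a l z + (frechet_derivative (\<lambda>z. \<Gamma> z b c) (at z) a \<bullet> l) * \<theta> z l))) (at z)"
      by (intro has_derivative_mult_right has_derivative_sum has_derivative_mult has_derivative_inner_left
          smooth_on_has_derivative[OF sm z] smooth_on_has_derivative[OF \<Gamma> z])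
    ultimately show ?thesis unfolding frechet_derivative_at[OF D, symmetric] by simp
  qed
  define p where "p t = z0 + t *\<^sub>R (z1 - z0)" for t :: real
  have pB: "p t \<in> B" if "0 \<le> t" "t \<le> 1" for t
    using convexD_alt[OF B(2) z0(1) z1, of t] that by (simp add: p_def algebra_simps)
  let ?N = "p ` {0..1}"
  have N: "compact ?N" "?N \<subseteq> B"
    using pB by (auto intro!: compact_continuous_image continuous_intros simp: p_def)
  obtain M where M: "\<And>z b c l. z \<in> ?N \<Longrightarrow> b \<in> Basis \<Longrightarrow> c \<in> Basis \<Longrightarrow> \<bar>\<Gamma> z b c \<bullet> l\<bar> \<le> M * norm l"
    and M': "\<And>z a b c l. z \<in> ?N \<Longrightarrow> a \<in> Basis \<Longrightarrow> b \<in> Basis \<Longrightarrow> c \<in> Basis \<Longrightarrow>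
      \<bar>frechet_derivative (\<lambda>z. \<Gamma> z b c) (at z) a \<bullet> l\<bar> \<le> M * norm l" and M0: "M \<ge> 0"
  proof -
    let ?m = "\<lambda>z. (\<Sum>b\<in>Basis. \<Sum>c\<in>Basis. norm (\<Gamma> z b c) + (\<Sum>a\<in>Basis. norm (frechet_derivative (\<lambda>z. \<Gamma> z b c) (at z) a)))"
    have "continuous_on ?N ?m"
      by (intro continuous_intros continuous_on_subset[OF smooth_on_continuous_on[OF \<Gamma>] N(2)]
          continuous_on_subset[OF smooth_on_continuous_on[OF smooth_on_deriv[OF \<Gamma>]] N(2)])
    then have "bounded (?m ` ?N)" using N(1) compact_continuous_image compact_imp_bounded by blast
    then obtain M where M: "\<And>z. z \<in> ?N \<Longrightarrow> norm (?m z) \<le> M" unfolding bounded_iff by blast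
    have M0: "M \<ge> 0" by (rule order_trans[OF norm_ge_zero M[of "p 0"]]) simp
    have mem: "f b \<le> (\<Sum>b\<in>Basis. f b)" if "b \<in> Basis" "\<And>b. f b \<ge> 0" for b :: 'e and f :: "'e \<Rightarrow> real"
      by (rule member_le_sum) (use that in auto)
    have 1: "norm (\<Gamma> z b c) + (\<Sum>a\<in>Basis. norm (frechet_derivative (\<lambda>z. \<Gamma> z b c) (at z) a)) \<le> M"
      if "z \<in> ?N" "b \<in> Basis" "c \<in> Basis" for z b c
    proof -
      let ?g = "\<lambda>b c. norm (\<Gamma> z b c) + (\<Sum>a\<in>Basis. norm (frechet_derivative (\<lambda>z. \<Gamma> z b c) (at z) a))"
      have nn: "0 \<le> ?g b c" for b c by (intro add_nonneg_nonneg sum_nonneg) auto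
      have "?g b c \<le> (\<Sum>c\<in>Basis. ?g b c)" by (rule mem[of c "?g b", OF that(3) nn])
      also have "\<dots> \<le> ?m z" by (rule mem[of b "\<lambda>b. \<Sum>c\<in>Basis. ?g b c", OF that(2)]) (rule sum_nonneg[OF nn])
      also have "\<dots> \<le> M" by (rule order_trans[OF abs_ge_self M[OF that(1), unfolded real_norm_def]])
      finally show ?thesis .
    qed
    show ?thesis
    proof
      show "\<bar>\<Gamma> z b c \<bullet> l\<bar> \<le> M * norm l" if "z \<in> ?N" "b \<in> Basis" "c \<in> Basis" for z b c l
      proof -
        have "norm (\<Gamma> z b c) \<le> M"
          using 1[OF that] sum_nonneg[of Basis "\<lambda>a. norm (frechet_derivative (\<lambda>z. \<Gamma> z b c) (at z) a)"] by simp
        then show ?thesis using Cauchy_Schwarz_ineq2[of "\<Gamma> z b c" l] by (meson mult_right_mono norm_ge_zero order_trans)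
      qed
      show "\<bar>frechet_derivative (\<lambda>z. \<Gamma> z b c) (at z) a \<bullet> l\<bar> \<le> M * norm l"
        if "z \<in> ?N" "a \<in> Basis" "b \<in> Basis" "c \<in> Basis" for z a b c l
      proof -
        let ?x = "frechet_derivative (\<lambda>z. \<Gamma> z b c) (at z) a"
        have "norm ?x \<le> M"
          using 1[OF that(1,3,4)] mem[OF that(2), of "\<lambda>a. norm (frechet_derivative (\<lambda>z. \<Gamma> z b c) (at z) a)", OF norm_ge_zero]
            norm_ge_zero[of "\<Gamma> z b c"] by linarith
        then show ?thesis using Cauchy_Schwarz_ineq2[of ?x l] by (meson mult_right_mono norm_ge_zero order_trans)
      qed
    qed (rule M0)
  qed
  let ?\<Sigma> = "\<lambda>z. \<Sum>j\<in>I. \<bar>Y j z\<bar>"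
  have Yle: "\<bar>\<theta> z l\<bar> \<le> ?\<Sigma> z" "\<bar>?d a l z\<bar> \<le> ?\<Sigma> z" if "a \<in> Basis" "l \<in> Basis" for a l z
    using member_le_sum[of "Inl l" I "\<lambda>j. \<bar>Y j z\<bar>"] member_le_sum[of "Inr (a, l)" I "\<lambda>j. \<bar>Y j z\<bar>"] that I
    by (auto simp: I_def Y_def)
  have \<Sigma>0: "?\<Sigma> z \<ge> 0" for z by (simp add: sum_nonneg)
  let ?n = "real DIM('e)"
  have dSle: "\<bar>?dS a b c z\<bar> \<le> 4 * ?n * M * ?\<Sigma> z" if "z \<in> ?N" "a \<in> Basis" "b \<in> Basis" "c \<in> Basis" for a b c z
  proof -
    have "\<bar>\<Sum>l\<in>Basis. (\<Gamma> z b c \<bullet> l) * ?d a l z + (frechet_derivative (\<lambda>z. \<Gamma> z b c) (at z) a \<bullet> l) * \<theta> z l\<bar> \<le> (\<Sum>l\<in>(Basis::'e set). 2 * M * ?\<Sigma> z)"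
    proof (rule order_trans[OF sum_abs sum_mono])
      fix l :: 'e assume l: "l \<in> Basis"
      have "\<bar>(\<Gamma> z b c \<bullet> l) * ?d a l z\<bar> \<le> M * ?\<Sigma> z" "\<bar>(frechet_derivative (\<lambda>z. \<Gamma> z b c) (at z) a \<bullet> l) * \<theta> z l\<bar> \<le> M * ?\<Sigma> z"
        unfolding abs_mult using M[OF that(1,3,4), of l] M'[OF that, of l] l Yle[OF that(2) l] M0
        by (auto intro!: mult_mono)
      then show "\<bar>(\<Gamma> z b c \<bullet> l) * ?d a l z + (frechet_derivative (\<lambda>z. \<Gamma> z b c) (at z) a \<bullet> l) * \<theta> z l\<bar> \<le> 2 * M * ?\<Sigma> z"
        by linarith
    qed
    then show ?thesis using dS[where z=z and a=a and b=b and c=c] that(1) N by (auto simp: abs_mult algebra_simps)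
  qed
  define C where "C = (1 + 6 * ?n * M) * (norm (z1 - z0) * ?n)"
  have dY: "\<bar>frechet_derivative (Y i) (at z) (z1 - z0)\<bar> \<le> C * ?\<Sigma> z" if i: "i \<in> I" and z: "z \<in> ?N" for i z
  proof -
    have zB: "z \<in> B" using z N by blast
    have "\<bar>frechet_derivative (Y i) (at z) a\<bar> \<le> (1 + 6 * ?n * M) * ?\<Sigma> z" if a: "a \<in> Basis" for a
    proof (cases i)
      case (Inl c)
      have "\<bar>?d a c z\<bar> \<le> 1 * ?\<Sigma> z" using Yle(2)[OF a, of c] i Inl by (auto simp: I_def)
      also have "\<dots> \<le> (1 + 6 * ?n * M) * ?\<Sigma> z" using M0 \<Sigma>0 by (intro mult_right_mono) auto
      finally show ?thesis by (simp only: Inl Y)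
    next
      case (Inr bc)
      then obtain b c where bc: "i = Inr (b, c)" "b \<in> Basis" "c \<in> Basis" using i by (auto simp: I_def)
      have "\<bar>2 * ?dd a b c z\<bar> \<le> 3 * (4 * ?n * M * ?\<Sigma> z)"
        unfolding second[OF zB] using dSle[OF z a bc(2,3)] dSle[OF z bc(2) a bc(3)] dSle[OF z bc(3) a bc(2)] by linarith
      then have "\<bar>?dd a b c z\<bar> \<le> 6 * ?n * M * ?\<Sigma> z" by simp
      also have "\<dots> \<le> (1 + 6 * ?n * M) * ?\<Sigma> z" using \<Sigma>0 by (intro mult_right_mono) auto
      finally show ?thesis by (simp only: bc Y)
    qed
    then have "\<bar>\<Sum>a\<in>Basis. ((z1 - z0) \<bullet> a) * frechet_derivative (Y i) (at z) a\<bar> \<le>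
        (\<Sum>a\<in>(Basis::'e set). norm (z1 - z0) * ((1 + 6 * ?n * M) * ?\<Sigma> z))"
      by (intro order_trans[OF sum_abs sum_mono]) (auto simp: abs_mult intro!: mult_mono Basis_le_norm)
    moreover have "frechet_derivative (Y i) (at z) (z1 - z0) = (\<Sum>a\<in>Basis. ((z1 - z0) \<bullet> a) * frechet_derivative (Y i) (at z) a)"
      using linear_Basis_expand[OF has_derivative_linear[OF smooth_on_has_derivative[OF Ysm[of i] zB]], of "z1 - z0"] by simp
    ultimately show ?thesis by (simp add: C_def algebra_simps)
  qed
  have Y1: "Y i (p 1) = 0" if "i \<in> I" for i
  proof (rule linear_system_zero[where y = "\<lambda>i t. Y i (p t)" and y' = "\<lambda>i t. frechet_derivative (Y i) (at (p t)) (z1 - z0)",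
      OF I _ _ _ that])
    fix i t assume "i \<in> I" and t: "0 \<le> t" "t \<le> (1::real)"
    note DY = smooth_on_has_derivative[OF Ysm[of i] pB[OF t]]
    have "((\<lambda>t. Y i (p t)) has_derivative (\<lambda>c. frechet_derivative (Y i) (at (p t)) (c *\<^sub>R (z1 - z0)))) (at t)"
      by (rule has_derivative_compose[where f = p and x = t, OF _ DY])
        (auto intro!: derivative_eq_intros simp: p_def[abs_def])
    then show "((\<lambda>t. Y i (p t)) has_real_derivative frechet_derivative (Y i) (at (p t)) (z1 - z0)) (at t)"
      using linear_scale[OF has_derivative_linear[OF DY], of _ "z1 - z0"]
      by (simp add: has_field_derivative_def mult.commute[of _ "frechet_derivative _ _ _"])
    show "\<bar>frechet_derivative (Y i) (at (p t)) (z1 - z0)\<bar> \<le> C * ?\<Sigma> (p t)"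
      by (rule dY[OF \<open>i \<in> I\<close>]) (use t in auto)
  next
    fix i assume "i \<in> I"
    then show "Y i (p 0) = 0" using z0 by (auto simp: I_def Y_def p_def)
  qed
  have "\<theta> z1 b = 0" if "b \<in> Basis" for b
    using Y1[of "Inl b"] that by (auto simp: I_def Y_def p_def)
  then show ?thesis using linear_Basis_expand[OF lin[OF z1], of v] by simp
qed

section \<open>Charts of the tangent bundle\<close>

definition chart_img :: "('a, 'e) atlas \<Rightarrow> 'a \<Rightarrow> 'e set" where
  "chart_img A x = chart_map A x ` chart_dom A x"

abbreviation chart_center :: "('a, 'e) atlas \<Rightarrow> 'a \<Rightarrow> 'e" where
  "chart_center A x \<equiv> chart_map A x x"

definition overlap :: "('a, 'e) atlas \<Rightarrow> 'a \<Rightarrow> 'a \<Rightarrow> 'e set" where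
  "overlap A x q = chart_map A x ` (chart_dom A x \<inter> chart_dom A q)"

abbreviation transition :: "('a, 'e) atlas \<Rightarrow> 'a \<Rightarrow> 'a \<Rightarrow> 'e \<Rightarrow> 'e" where
  "transition A x q \<equiv> chart_map A q \<circ> chart_inv A x"

abbreviation dtransition :: "('a, 'e::euclidean_space) atlas \<Rightarrow> 'a \<Rightarrow> 'a \<Rightarrow> 'e \<Rightarrow> 'e \<Rightarrow> 'e" where
  "dtransition A x q z \<equiv> frechet_derivative (transition A x q) (at z)"

text \<open>A tangent vector with components \<open>v\<close> in the chart around \<open>x\<close>, at the coordinates \<open>z\<close>, has
  components \<open>tangent_iso A x z v\<close> in the chart around its base point.\<close>

definition tangent_iso :: "('a, 'e::euclidean_space) atlas \<Rightarrow> 'a \<Rightarrow> 'e \<Rightarrow> 'e \<Rightarrow> 'e" where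
  "tangent_iso A x z = dtransition A x (chart_inv A x z) z"

definition tlift :: "('a, 'e::euclidean_space) atlas \<Rightarrow> 'a \<Rightarrow> 'e \<times> 'e \<Rightarrow> 'a \<times> 'e" where
  "tlift A x p = (chart_inv A x (fst p), tangent_iso A x (fst p) (snd p))"

text \<open>The total space of the tangent bundle is the type \<open>'a \<times> 'e\<close>, with the charts \<open>tlift\<close>; its
  product topology is not the topology of the bundle.\<close>

definition tsmooth :: "('a, 'e::euclidean_space) atlas \<Rightarrow> ('a \<times> 'e \<Rightarrow> real) \<Rightarrow> bool" where
  "tsmooth A \<psi> \<longleftrightarrow> (\<forall>x. smooth_on (chart_img A x \<times> UNIV) (\<lambda>p. \<psi> (tlift A x p)))"

lemma atlas_chart:
  fixes A :: "('a::t2_space, 'e::euclidean_space) atlas"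
  assumes A: "smooth_atlas A"
  shows "x \<in> chart_dom A x" "open (chart_img A x)" "chart_center A x \<in> chart_img A x" "open (chart_dom A x)"
    "continuous_on (chart_img A x) (chart_inv A x)" "continuous_on (chart_dom A x) (chart_map A x)"
    "z \<in> chart_img A x \<Longrightarrow> chart_inv A x z \<in> chart_dom A x"
    "z \<in> chart_img A x \<Longrightarrow> chart_map A x (chart_inv A x z) = z"
    "q \<in> chart_dom A x \<Longrightarrow> chart_map A x q \<in> chart_img A x"
    "q \<in> chart_dom A x \<Longrightarrow> chart_inv A x (chart_map A x q) = q"
proof -
  have h: "homeomorphism (chart_dom A x) (chart_img A x) (chart_map A x) (chart_inv A x)"
    using A unfolding smooth_atlas_def chart_img_def by blast
  show "x \<in> chart_dom A x" "open (chart_img A x)" "open (chart_dom A x)"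
    using A unfolding smooth_atlas_def chart_img_def by blast+
  then show "chart_center A x \<in> chart_img A x" by (simp add: chart_img_def)
  show "continuous_on (chart_img A x) (chart_inv A x)" "continuous_on (chart_dom A x) (chart_map A x)"
    using h by (auto simp: homeomorphism_def)
  show "z \<in> chart_img A x \<Longrightarrow> chart_inv A x z \<in> chart_dom A x" using homeomorphism_image2[OF h] by blast
  show "z \<in> chart_img A x \<Longrightarrow> chart_map A x (chart_inv A x z) = z" using homeomorphism_apply2[OF h] .
  show "q \<in> chart_dom A x \<Longrightarrow> chart_map A x q \<in> chart_img A x" by (simp add: chart_img_def)
  show "q \<in> chart_dom A x \<Longrightarrow> chart_inv A x (chart_map A x q) = q" using homeomorphism_apply1[OF h] .
qed

lemma atlas_overlap:
  fixes A :: "('a::t2_space, 'e::euclidean_space) atlas"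
  assumes A: "smooth_atlas A"
  shows "overlap A x q = {z \<in> chart_img A x. chart_inv A x z \<in> chart_dom A q}"
    and "open (overlap A x q)" and "smooth_on (overlap A x q) (transition A x q)"
    and "z \<in> overlap A x q \<Longrightarrow> transition A x q z \<in> overlap A q x"
    and "z \<in> overlap A x q \<Longrightarrow> chart_inv A q (transition A x q z) = chart_inv A x z"
    and "z \<in> chart_img A x \<Longrightarrow> z \<in> overlap A x (chart_inv A x z)"
proof -
  note c = atlas_chart[OF A]
  have overlap_alt: "overlap A x q = {z \<in> chart_img A x. chart_inv A x z \<in> chart_dom A q}" for q
    unfolding overlap_def chart_img_def using c(10) by force
  note eq = overlap_alt[of q]
  show "overlap A x q = {z \<in> chart_img A x. chart_inv A x z \<in> chart_dom A q}" by (rule eq)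
  have "{z \<in> chart_img A x. chart_inv A x z \<in> chart_dom A q} = chart_img A x \<inter> chart_inv A x -` chart_dom A q" by auto
  then show "open (overlap A x q)"
    unfolding eq using continuous_open_preimage[OF c(5,2,4)] by simp
  show "smooth_on (overlap A x q) (transition A x q)"
    using A unfolding smooth_atlas_def overlap_def by blast
  show inv: "z \<in> overlap A x q \<Longrightarrow> chart_inv A q (transition A x q z) = chart_inv A x z"
    using c(10) by (auto simp: eq)
  show "z \<in> overlap A x q \<Longrightarrow> transition A x q z \<in> overlap A q x"
    unfolding overlap_def using c(10) by fastforce
  show "z \<in> chart_img A x \<Longrightarrow> z \<in> overlap A x (chart_inv A x z)"
    using c(1) by (simp add: overlap_alt)
qed

lemma overlap_subset: "smooth_atlas A \<Longrightarrow> overlap A x q \<subseteq> chart_img A x"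
  unfolding overlap_def chart_img_def by auto

lemma has_derivative_transition:
  assumes "smooth_atlas A" "z \<in> overlap A x q"
  shows "(transition A x q has_derivative dtransition A x q z) (at z)"
  by (rule smooth_on_has_derivative[OF atlas_overlap(3)[OF assms(1)] assms(2)])

lemma dtransition_chain:
  assumes A: "smooth_atlas A" and z: "z \<in> overlap A x q" "z \<in> overlap A x r"
  shows "dtransition A x r z v = dtransition A q r (transition A x q z) (dtransition A x q z v)"
proof -
  note o = atlas_overlap[OF A]
  have w: "transition A x q z \<in> overlap A q r"
    using o(1,4,5) z overlap_subset[OF A] by (smt (verit) mem_Collect_eq subsetD)
  have "((\<lambda>y. transition A q r (transition A x q y)) has_derivative
      (\<lambda>v. dtransition A q r (transition A x q z) (dtransition A x q z v))) (at z)"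
    by (rule has_derivative_compose[where f = "transition A x q", OF has_derivative_transition[OF A z(1)] has_derivative_transition[OF A w]])
  then have "(transition A x r has_derivative
      (\<lambda>v. dtransition A q r (transition A x q z) (dtransition A x q z v))) (at z)"
    by (rule has_derivative_transform_within_open[OF _ o(2)[of x q] z(1)]) (use o(5) in simp)
  then show ?thesis using frechet_derivative_at by metis
qed

lemma dtransition_self:
  assumes A: "smooth_atlas A" and z: "z \<in> chart_img A x"
  shows "dtransition A x x z v = v"
proof -
  have "(transition A x x has_derivative (\<lambda>v. v)) (at z)"
    by (rule has_derivative_transform_within_open[OF has_derivative_ident atlas_chart(2)[OF A] z])
      (simp add: atlas_chart(8)[OF A])
  then show ?thesis using frechet_derivative_at by metis
qed

lemma dtransition_linear: "smooth_atlas A \<Longrightarrow> z \<in> overlap A x q \<Longrightarrow> linear (dtransition A x q z)"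
  using has_derivative_transition has_derivative_linear by blast

lemma dtransition_inverse:
  assumes A: "smooth_atlas A" and z: "z \<in> overlap A x q"
  shows "dtransition A q x (transition A x q z) (dtransition A x q z v) = v"
    and "dtransition A x q z (dtransition A q x (transition A x q z) v) = v"
proof -
  note o = atlas_overlap[OF A]
  have zi: "z \<in> chart_img A x" using z overlap_subset[OF A] by blast
  have "z \<in> overlap A x x" using zi o(1) atlas_chart(7)[OF A] by blast
  from dtransition_chain[OF A z this] dtransition_self[OF A zi]
  show "dtransition A q x (transition A x q z) (dtransition A x q z v) = v" by simp
  let ?w = "transition A x q z"
  have w: "?w \<in> overlap A q x" using o(4) z by blast
  then have wi: "?w \<in> chart_img A q" using overlap_subset[OF A] by blast
  have "?w \<in> overlap A q q" using wi o(1) atlas_chart(7)[OF A] by blast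
  from dtransition_chain[OF A w this] dtransition_self[OF A wi]
  have "dtransition A x q (transition A q x ?w) (dtransition A q x ?w v) = v" by simp
  moreover have "transition A q x ?w = z"
    using o(5)[OF z] atlas_chart(8)[OF A zi] by simp
  ultimately show "dtransition A x q z (dtransition A q x ?w v) = v" by simp
qed

lemma tangent_iso_linear: "smooth_atlas A \<Longrightarrow> z \<in> chart_img A x \<Longrightarrow> linear (tangent_iso A x z)"
  unfolding tangent_iso_def by (intro dtransition_linear atlas_overlap(6))

lemma tangent_iso_bij:
  assumes A: "smooth_atlas A" and z: "z \<in> chart_img A x"
  shows "bij (tangent_iso A x z)"
  unfolding tangent_iso_def
  by (rule o_bij[where g = "dtransition A (chart_inv A x z) x (transition A x (chart_inv A x z) z)"])
    (use dtransition_inverse[OF A atlas_overlap(6)[OF A z]] in \<open>auto simp: fun_eq_iff\<close>)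

lemma tangent_iso_center: "smooth_atlas A \<Longrightarrow> tangent_iso A x (chart_center A x) v = v"
  unfolding tangent_iso_def using atlas_chart(10,1) transition_self by (metis id_apply)

lemma tangent_iso_chain:
  assumes A: "smooth_atlas A" and z: "z \<in> overlap A x q"
  shows "tangent_iso A x z v = tangent_iso A q (transition A x q z) (dtransition A x q z v)"
  unfolding tangent_iso_def atlas_overlap(5)[OF A z]
  by (rule dtransition_chain[OF A z atlas_overlap(6)[OF A]]) (use z overlap_subset[OF A] in blast)

lemma tlift_center: "smooth_atlas A \<Longrightarrow> tlift A x (chart_center A x, v) = (x, v)"
  by (simp add: tlift_def tangent_iso_center atlas_chart(10,1))

lemma tlift_transition:
  assumes "smooth_atlas A" "fst p \<in> overlap A x q"
  shows "tlift A x p = tlift A q (transition A x q (fst p), dtransition A x q (fst p) (snd p))"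
  unfolding tlift_def fst_conv snd_conv tangent_iso_chain[OF assms] atlas_overlap(5)[OF assms] ..

lemma local_rep_tangent_iso: "local_rep A K x z Xs = K (chart_inv A x z) (map (tangent_iso A x z) Xs)"
  by (simp add: local_rep_def tangent_iso_def Let_def)

lemma local_rep_transition:
  assumes "smooth_atlas A" "z \<in> overlap A x q"
  shows "local_rep A K x z Xs = local_rep A K q (transition A x q z) (map (dtransition A x q z) Xs)"
  unfolding local_rep_tangent_iso atlas_overlap(5)[OF assms] tangent_iso_chain[OF assms, abs_def] by (simp add: comp_def)

section \<open>Symmetric tensors of degree one and two\<close>

lemma sym_tensors_linear:
  "S \<in> sym_tensors p \<Longrightarrow> length Xs = p \<Longrightarrow> i < p \<Longrightarrow> linear (\<lambda>v. S (Xs[i := v]))"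
  unfolding sym_tensors_def by blast

lemma sym_tensors_pullback:
  assumes S: "S \<in> sym_tensors p" and L: "linear L"
  shows "(\<lambda>Xs. S (map L Xs)) \<in> sym_tensors p"
  unfolding sym_tensors_def
proof (intro CollectI conjI allI impI)
  show "S (map L Xs) = 0" if "length Xs \<noteq> p" for Xs
    using S that by (simp add: sym_tensors_def)
  show "linear (\<lambda>v. S (map L (Xs[i := v])))" if "length Xs = p" "i < p" for Xs i
  proof -
    have "linear (\<lambda>v. S ((map L Xs)[i := v]))" by (rule sym_tensors_linear[OF S]) (use that in auto)
    from linear_compose[OF L this] show ?thesis by (simp add: map_update comp_def)
  qed
  show "S (map L Xs) = S (map L Ys)" if "mset Xs = mset Ys" for Xs Ys
  proof -
    have "mset (map L Xs) = mset (map L Ys)" using that by simp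
    then show ?thesis using S unfolding sym_tensors_def by blast
  qed
qed

lemma sym_tensors_1_linear: "S \<in> sym_tensors 1 \<Longrightarrow> linear (\<lambda>v. S [v])"
proof -
  assume "S \<in> sym_tensors 1"
  from sym_tensors_linear[OF this, of "[undefined]" 0] have "linear (\<lambda>v. S ([undefined][0 := v]))" by simp
  then show ?thesis by simp
qed

lemma sym_tensors_2_bilinear: "S \<in> sym_tensors 2 \<Longrightarrow> bilinear (\<lambda>u v. S [u, v])"
  unfolding bilinear_def using sym_tensors_2D(2,3) by blast

lemma sym_tensors_length: "S \<in> sym_tensors p \<Longrightarrow> length Xs \<noteq> p \<Longrightarrow> S Xs = 0"
  by (simp add: sym_tensors_def)

lemma sym_tensors_1I:
  assumes "\<And>Xs. length Xs \<noteq> 1 \<Longrightarrow> S Xs = 0" "linear (\<lambda>v. S [v])"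
  shows "S \<in> sym_tensors 1"
  unfolding sym_tensors_def
proof (intro CollectI conjI allI impI)
  show "linear (\<lambda>v. S (Xs[i := v]))" if "length Xs = 1" "i < 1" for Xs i
    using that assms(2) by (auto simp: length_Suc_conv)
  show "S Xs = S Ys" if "mset Xs = mset Ys" for Xs Ys
  proof (cases "length Xs = 1")
    case True
    then obtain v where "Xs = [v]" by (auto simp: length_Suc_conv)
    then show ?thesis using that by simp
  next
    case False
    then show ?thesis using assms(1) mset_eq_length[OF that] by simp
  qed
qed (use assms in auto)

lemma length_2_cases: "length Xs = 2 \<Longrightarrow> (\<And>u v. Xs = [u, v] \<Longrightarrow> P) \<Longrightarrow> P"
  by (auto simp: numeral_2_eq_2 length_Suc_conv)

lemma sym_tensors_2I:
  assumes "\<And>Xs. length Xs \<noteq> 2 \<Longrightarrow> S Xs = 0" "\<And>u v. S [u, v] = S [v, u]" "\<And>v. linear (\<lambda>u. S [u, v])"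
  shows "S \<in> sym_tensors 2"
  unfolding sym_tensors_def
proof (intro CollectI conjI allI impI)
  show "linear (\<lambda>v. S (Xs[i := v]))" if Xs: "length Xs = 2" "i < 2" for Xs i
  proof -
    obtain u w where uw: "Xs = [u, w]" using length_2_cases[OF Xs(1)] by blast
    have "i = 0 \<or> i = 1" using Xs(2) by linarith
    then show ?thesis using assms(3)[of w] assms(3)[of u] by (auto simp: uw assms(2)[of u])
  qed
  show "S Xs = S Ys" if m: "mset Xs = mset Ys" for Xs Ys
  proof (cases "length Xs = 2")
    case True
    obtain u v where uv: "Xs = [u, v]" using length_2_cases[OF True] by blast
    obtain u' v' where uv': "Ys = [u', v']" using length_2_cases mset_eq_length[OF m] True by metis
    have "(u = u' \<and> v = v') \<or> (u = v' \<and> v = u')"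
      using m unfolding uv uv' by (auto simp: add_eq_conv_ex)
    then show ?thesis using assms(2) uv uv' by metis
  next
    case False
    then show ?thesis using assms(1) mset_eq_length[OF m] by simp
  qed
qed (use assms in auto)

text \<open>By polarisation, \<open>2 S(u, v) = S(u + v, u + v) - S(u, u) - S(v, v)\<close>.\<close>

lemma sym_tensors_2_eqI:
  assumes S: "S \<in> sym_tensors 2" and T: "T \<in> sym_tensors 2" and eq: "\<And>v. S [v, v] = T [v, v]"
  shows "S = T"
proof
  fix Xs
  show "S Xs = T Xs"
  proof (cases "length Xs = 2")
    case True
    obtain u v where uv: "Xs = [u, v]" using length_2_cases[OF True] by blast
    have "2 * S [u, v] = S [u + v, u + v] - S [u, u] - S [v, v]" if "S \<in> sym_tensors 2" for S :: "'a tensor"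
      using sym_tensors_2D(1)[OF that, of u v] by (simp add: linear_add[OF sym_tensors_2D(2)[OF that]] linear_add[OF sym_tensors_2D(3)[OF that]])
    from this[OF S] this[OF T] eq show ?thesis unfolding uv by simp
  qed (use sym_tensors_length[OF S] sym_tensors_length[OF T] in simp)
qed

lemma sym_tensor_fieldD:
  "sym_tensor_field A p K \<Longrightarrow> K x \<in> sym_tensors p"
  "sym_tensor_field A p K \<Longrightarrow> length Xs = p \<Longrightarrow> smooth_on (chart_img A x) (\<lambda>z. local_rep A K x z Xs)"
  by (auto simp: sym_tensor_field_def chart_img_def)

lemma local_rep_sym_tensors:
  "smooth_atlas A \<Longrightarrow> sym_tensor_field A p K \<Longrightarrow> z \<in> chart_img A x \<Longrightarrow> local_rep A K x z \<in> sym_tensors p"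
  using sym_tensors_pullback[OF sym_tensor_fieldD(1) tangent_iso_linear]
  by (simp add: local_rep_tangent_iso[abs_def])

text \<open>By polarisation a symmetric tensor is determined by its values on the diagonal, which form a function
  on the tangent bundle.\<close>

definition lin_fun :: "('a, 'e) tensor_field \<Rightarrow> 'a \<times> 'e \<Rightarrow> real" where
  "lin_fun K P = K (fst P) [snd P]"

definition quad_fun :: "('a, 'e) tensor_field \<Rightarrow> 'a \<times> 'e \<Rightarrow> real" where
  "quad_fun K P = K (fst P) [snd P, snd P]"

lemma lin_fun_tlift: "lin_fun K (tlift A x p) = local_rep A K x (fst p) [snd p]"
  by (simp add: lin_fun_def tlift_def local_rep_tangent_iso)

lemma quad_fun_tlift: "quad_fun K (tlift A x p) = local_rep A K x (fst p) [snd p, snd p]"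
  by (simp add: quad_fun_def tlift_def local_rep_tangent_iso)

lemma open_chart_img_times: "smooth_atlas A \<Longrightarrow> open (chart_img A x \<times> (UNIV :: 'e set))"
  for A :: "('a::t2_space, 'e::euclidean_space) atlas"
  by (intro open_Times atlas_chart(2) open_UNIV)

lemma tsmooth_lin_fun:
  assumes A: "smooth_atlas A" and K: "sym_tensor_field A 1 K" shows "tsmooth A (lin_fun K)"
  unfolding tsmooth_def lin_fun_tlift
proof
  fix x
  note o = open_chart_img_times[OF A, of x]
  show "smooth_on (chart_img A x \<times> UNIV) (\<lambda>p. local_rep A K x (fst p) [snd p])"
    by (rule smooth_on_linear_eval[OF o smooth_on_fst[OF o smooth_on_id[OF o]] smooth_on_snd[OF o smooth_on_id[OF o]]])
      (use sym_tensor_fieldD(2)[OF K] sym_tensors_1_linear[OF local_rep_sym_tensors[OF A K]] in auto)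
qed

lemma tsmooth_quad_fun:
  assumes A: "smooth_atlas A" and K: "sym_tensor_field A 2 K" shows "tsmooth A (quad_fun K)"
  unfolding tsmooth_def quad_fun_tlift
proof
  fix x
  note o = open_chart_img_times[OF A, of x]
  show "smooth_on (chart_img A x \<times> UNIV) (\<lambda>p. local_rep A K x (fst p) [snd p, snd p])"
    by (rule smooth_on_bilinear_eval[OF o smooth_on_fst[OF o smooth_on_id[OF o]] smooth_on_snd[OF o smooth_on_id[OF o]]
          smooth_on_snd[OF o smooth_on_id[OF o]], where G = "\<lambda>z u v. local_rep A K x z [u, v]" and S = "chart_img A x"])
      (use sym_tensor_fieldD(2)[OF K] sym_tensors_2_bilinear[OF local_rep_sym_tensors[OF A K]] in auto)
qed

section \<open>The geodesic spray\<close>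

text \<open>Of the chart around \<open>x\<close>, \<open>christoffel\<close> gives the Christoffel symbols at the centre \<open>x\<close>. To
  differentiate more than once they are needed at all coordinates \<open>z\<close>.\<close>

definition chart_christoffel ::
  "('a, 'e::euclidean_space) atlas \<Rightarrow> ('a, 'e) tensor_field \<Rightarrow> 'a \<Rightarrow> 'e \<Rightarrow> 'e \<Rightarrow> 'e \<Rightarrow> 'e" where
  "chart_christoffel A g x z v w = (THE u. \<forall>y. 2 * local_rep A g x z [u, y] =
     frechet_derivative (\<lambda>z. local_rep A g x z [w, y]) (at z) v +
     frechet_derivative (\<lambda>z. local_rep A g x z [v, y]) (at z) w -
     frechet_derivative (\<lambda>z. local_rep A g x z [v, w]) (at z) y)"

definition spray :: "('a, 'e::euclidean_space) atlas \<Rightarrow> ('a, 'e) tensor_field \<Rightarrow> 'a \<Rightarrow> 'e \<times> 'e \<Rightarrow> 'e \<times> 'e" where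
  "spray A g x p = (snd p, - chart_christoffel A g x (fst p) (snd p) (snd p))"

text \<open>The spray generates the geodesic flow, and \<open>geo\<close> is the derivative along it, computed in the chart around
  the base point.\<close>

definition geo :: "('a, 'e::euclidean_space) atlas \<Rightarrow> ('a, 'e) tensor_field \<Rightarrow> ('a \<times> 'e \<Rightarrow> real) \<Rightarrow> 'a \<times> 'e \<Rightarrow> real" where
  "geo A g \<psi> P = frechet_derivative (\<lambda>p. \<psi> (tlift A (fst P) p)) (at (chart_center A (fst P), snd P))
     (spray A g (fst P) (chart_center A (fst P), snd P))"

locale riem =
  fixes A :: "('a::t2_space, 'e::euclidean_space) atlas" and g :: "('a, 'e) tensor_field"
  assumes riem: "riemannian_manifold A g"
begin

lemma atlas: "smooth_atlas A" and metric_field: "sym_tensor_field A 2 g" and metric_pos: "v \<noteq> 0 \<Longrightarrow> g x [v, v] > 0"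
  using riem unfolding riemannian_manifold_def riemannian_metric_def by auto

lemmas open_TM = open_chart_img_times[OF atlas]

lemma metric_sym: "g x \<in> sym_tensors 2" by (rule sym_tensor_fieldD(1)[OF metric_field])

abbreviation "gx x z u v \<equiv> local_rep A g x z [u, v]"

lemma gx_sym: "z \<in> chart_img A x \<Longrightarrow> local_rep A g x z \<in> sym_tensors 2"
  by (rule local_rep_sym_tensors[OF atlas metric_field])

lemma gx_bilinear: "z \<in> chart_img A x \<Longrightarrow> bilinear (gx x z)"
  by (rule sym_tensors_2_bilinear[OF gx_sym])

lemma gx_pos:
  assumes z: "z \<in> chart_img A x" and v: "v \<noteq> 0" shows "gx x z v v > 0"
proof -
  have "tangent_iso A x z v \<noteq> tangent_iso A x z 0"
    using v tangent_iso_bij[OF atlas z] by (metis bij_pointE)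
  then show ?thesis
    using linear_0[OF tangent_iso_linear[OF atlas z]] metric_pos by (simp add: local_rep_tangent_iso)
qed

lemma gx_smooth: "smooth_on (chart_img A x) (\<lambda>z. gx x z u v)"
  by (rule sym_tensor_fieldD(2)[OF metric_field]) simp

abbreviation "dgx x z a u v \<equiv> frechet_derivative (\<lambda>z. gx x z u v) (at z) a"

lemma dgx_linear:
  assumes z: "z \<in> chart_img A x"
  shows "linear (\<lambda>a. dgx x z a u v)" "linear (\<lambda>v. dgx x z a u v)" "linear (\<lambda>u. dgx x z a u v)"
proof -
  show "linear (\<lambda>a. dgx x z a u v)"
    using has_derivative_linear[OF smooth_on_has_derivative[OF gx_smooth z]] .
  show "linear (\<lambda>v. dgx x z a u v)" "linear (\<lambda>u. dgx x z a u v)"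
    using gx_bilinear by (auto simp: bilinear_def intro!: linear_deriv_of_smooth_family[OF atlas_chart(2)[OF atlas] z gx_smooth])
qed

lemma dgx_commute: "z \<in> chart_img A x \<Longrightarrow> dgx x z a u v = dgx x z a v u"
  by (rule fun_cong[OF frechet_derivative_cong[OF atlas_chart(2)[OF atlas]]])
    (auto intro: sym_tensors_2D(1)[OF gx_sym])

lemma koszul:
  assumes z: "z \<in> chart_img A x"
  shows "2 * gx x z (chart_christoffel A g x z v w) y = dgx x z v w y + dgx x z w v y - dgx x z y v w"
proof -
  let ?f = "\<lambda>y. (dgx x z v w y + dgx x z w v y - dgx x z y v w) / 2"
  note l = dgx_linear[OF z]
  have "linear ?f"
    by (rule linearI) (simp_all add: linear_add[OF l(1)] linear_add[OF l(2)] linear_scale[OF l(1)] linear_scale[OF l(2)] field_simps)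
  from riesz_sym_tensor[OF gx_sym[OF z] gx_pos[OF z] this]
  have "\<exists>!u. \<forall>y. 2 * gx x z u y = dgx x z v w y + dgx x z w v y - dgx x z y v w"
    by (simp add: field_simps)
  from theI'[OF this] show ?thesis unfolding chart_christoffel_def by blast
qed

lemma gx_nondeg:
  assumes z: "z \<in> chart_img A x" and eq: "\<And>y. gx x z u y = gx x z u' y" shows "u = u'"
proof -
  have "gx x z (u - u') (u - u') = 0"
    using eq[of "u - u'"] bilinear_lsub[OF gx_bilinear[OF z]] by simp
  then show ?thesis using gx_pos[OF z, of "u - u'"] by force
qed

lemma chart_christoffel_commute:
  assumes z: "z \<in> chart_img A x"
  shows "chart_christoffel A g x z v w = chart_christoffel A g x z w v"
  proof (rule gx_nondeg[OF z])
    fix y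
    have "2 * gx x z (chart_christoffel A g x z v w) y = 2 * gx x z (chart_christoffel A g x z w v) y"
      unfolding koszul[OF z] dgx_commute[OF z, where u = v and v = w] by simp
    then show "gx x z (chart_christoffel A g x z v w) y = gx x z (chart_christoffel A g x z w v) y" by simp
  qed

lemma chart_christoffel_bilinear:
  assumes z: "z \<in> chart_img A x"
  shows "bilinear (chart_christoffel A g x z)"
proof -
  note l = dgx_linear[OF z] and b = gx_bilinear[OF z]
  let ?\<Gamma> = "chart_christoffel A g x z"
  have sym: "?\<Gamma> v w = ?\<Gamma> w v" for v w
    by (rule chart_christoffel_commute[OF z])
  have "linear (\<lambda>v. ?\<Gamma> v w)" for w
  proof (rule linearI)
    fix v v'
    have "2 * gx x z (?\<Gamma> (v + v') w) y = 2 * gx x z (?\<Gamma> v w + ?\<Gamma> v' w) y" for y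
      unfolding bilinear_ladd[OF b] distrib_left koszul[OF z]
      by (simp add: linear_add[OF l(1)] linear_add[OF l(3)])
    then show "?\<Gamma> (v + v') w = ?\<Gamma> v w + ?\<Gamma> v' w" by (intro gx_nondeg[OF z]) simp
  next
    fix c v
    have "2 * gx x z (?\<Gamma> (c *\<^sub>R v) w) y = 2 * gx x z (c *\<^sub>R ?\<Gamma> v w) y" for y
    proof -
      have "2 * gx x z (c *\<^sub>R ?\<Gamma> v w) y = c * (2 * gx x z (?\<Gamma> v w) y)" by (simp add: bilinear_lmul[OF b])
      then show ?thesis
        unfolding koszul[OF z] by (simp add: linear_scale[OF l(1)] linear_scale[OF l(3)] algebra_simps)
    qed
    then show "?\<Gamma> (c *\<^sub>R v) w = c *\<^sub>R ?\<Gamma> v w" by (intro gx_nondeg[OF z]) simp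
  qed
  then have l: "linear (\<lambda>v. ?\<Gamma> v w)" for w .
  have "(\<lambda>w. ?\<Gamma> w v) = ?\<Gamma> v" for v using sym by (intro ext)
  from l[unfolded this] have "linear (?\<Gamma> v)" for v .
  with l show ?thesis unfolding bilinear_def by blast
qed

lemma chart_christoffel_smooth: "smooth_on (chart_img A x) (\<lambda>z. chart_christoffel A g x z v w)"
proof (rule solution_smooth[OF atlas_chart(2)[OF atlas] gx_smooth gx_bilinear gx_pos])
  show "smooth_on (chart_img A x) (\<lambda>z. (1/2) * (dgx x z v w y + dgx x z w v y - dgx x z y v w))" for y
    by (intro smooth_on_cmult smooth_on_add smooth_on_diff smooth_on_deriv gx_smooth atlas_chart(2)[OF atlas])
  show "gx x z (chart_christoffel A g x z v w) y = (1/2) * (dgx x z v w y + dgx x z w v y - dgx x z y v w)"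
    if "z \<in> chart_img A x" for z y
    using koszul[OF that, of v w y] by simp
qed

lemma spray_smooth: "smooth_on (chart_img A x \<times> UNIV) (spray A g x)"
  unfolding spray_def
proof (intro smooth_on_Pair smooth_on_minus open_TM)
  note fst = smooth_on_fst[OF open_TM smooth_on_id[OF open_TM]] and snd = smooth_on_snd[OF open_TM smooth_on_id[OF open_TM]]
  show "smooth_on (chart_img A x \<times> UNIV) (\<lambda>p :: 'e \<times> 'e. snd p)" by (rule snd)
  show "smooth_on (chart_img A x \<times> UNIV) (\<lambda>p. chart_christoffel A g x (fst p) (snd p) (snd p))"
    by (rule smooth_on_bilinear_eval[OF open_TM fst snd snd _ chart_christoffel_smooth chart_christoffel_bilinear]) auto
qed

lemma christoffel_center: "christoffel A g x v w = chart_christoffel A g x (chart_center A x) v w"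
  unfolding christoffel_def chart_christoffel_def coord_deriv_def local_rep_self[OF atlas] ..

text \<open>Differentiate the transformation law of the metric and insert it into the Koszul formula. Of the terms
  with second derivatives of the transition map, one survives, because these are symmetric. The spray involves
  the Christoffel symbols on the diagonal only.\<close>

lemma chart_christoffel_transition:
  assumes z: "z \<in> overlap A x q"
  shows "chart_christoffel A g q (transition A x q z) (dtransition A x q z v) (dtransition A x q z v) =
    dtransition A x q z (chart_christoffel A g x z v v) - frechet_derivative (\<lambda>z. dtransition A x q z v) (at z) v"
proof -
  let ?\<tau> = "transition A x q" and ?J = "\<lambda>z. dtransition A x q z"
  let ?H = "\<lambda>a b. frechet_derivative (\<lambda>z. ?J z b) (at z) a"
  let ?O = "overlap A x q"
  have zi: "z \<in> chart_img A x" using z overlap_subset[OF atlas] by blast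
  have \<tau>: "?\<tau> ` ?O \<subseteq> chart_img A q" using atlas_overlap(4)[OF atlas] overlap_subset[OF atlas] by blast
  then have \<tau>z: "?\<tau> z \<in> chart_img A q" using z by blast
  note O = atlas_overlap(2)[OF atlas, of x q] and sm = atlas_overlap(3)[OF atlas, of x q]
  have eq: "gx x y u w = gx q (?\<tau> y) (?J y u) (?J y w)" if "y \<in> ?O" for y u w
    using local_rep_transition[OF atlas that] by simp
  have d: "dgx x z a u w = dgx q (?\<tau> z) (?J z a) (?J z u) (?J z w) + gx q (?\<tau> z) (?H a u) (?J z w) + gx q (?\<tau> z) (?J z u) (?H a w)" for a u w
  proof -
    have "((\<lambda>y. gx q (?\<tau> y) (?J y u) (?J y w)) has_derivative (\<lambda>a.
        dgx q (?\<tau> z) (?J z a) (?J z u) (?J z w) + gx q (?\<tau> z) (?H a u) (?J z w) + gx q (?\<tau> z) (?J z u) (?H a w))) (at z)"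
    proof (rule has_derivative_bilinear_eval[OF O z, where G = "\<lambda>y. gx q (?\<tau> y)"
          and G' = "\<lambda>u w a. dgx q (?\<tau> z) (?J z a) u w"])
      show "bilinear (gx q (?\<tau> s))" if "s \<in> ?O" for s by (rule gx_bilinear) (use \<tau> that in blast)
      show "((\<lambda>s. gx q (?\<tau> s) u w) has_derivative (\<lambda>a. dgx q (?\<tau> z) (?J z a) u w)) (at z)" for u w
        by (rule has_derivative_compose[where f = ?\<tau>, OF has_derivative_transition[OF atlas z] smooth_on_has_derivative[OF gx_smooth \<tau>z]])
      show "((\<lambda>z. ?J z u) has_derivative (\<lambda>a. ?H a u)) (at z)" "((\<lambda>z. ?J z w) has_derivative (\<lambda>a. ?H a w)) (at z)"
        by (rule smooth_on_has_derivative[OF smooth_on_deriv[OF sm] z])+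
    qed
    then have "((\<lambda>y. gx x y u w) has_derivative (\<lambda>a.
        dgx q (?\<tau> z) (?J z a) (?J z u) (?J z w) + gx q (?\<tau> z) (?H a u) (?J z w) + gx q (?\<tau> z) (?J z u) (?H a w))) (at z)"
      by (rule has_derivative_transform_within_open[OF _ O z]) (simp add: eq)
    from fun_cong[OF frechet_derivative_at[OF this], of a] show ?thesis by (rule sym)
  qed
  have H: "?H a b = ?H b a" for a b by (rule second_derivative_symmetric[OF O sm z])
  note G = sym_tensors_2D(1)[OF gx_sym[OF \<tau>z]] and b = gx_bilinear[OF \<tau>z]
  show ?thesis
  proof (rule gx_nondeg[OF \<tau>z])
    fix y'
    obtain y where y: "y' = ?J z y" using dtransition_inverse(2)[OF atlas z] by metis
    have "2 * gx q (?\<tau> z) (chart_christoffel A g q (?\<tau> z) (?J z v) (?J z v)) (?J z y) =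
        2 * dgx q (?\<tau> z) (?J z v) (?J z v) (?J z y) - dgx q (?\<tau> z) (?J z y) (?J z v) (?J z v)"
      unfolding koszul[OF \<tau>z] by simp
    also have "\<dots> = 2 * dgx x z v v y - dgx x z y v v - 2 * gx q (?\<tau> z) (?H v v) (?J z y)"
      unfolding d using H[of v y] G[of "?J z v" "?H v y"] by simp
    also have "2 * dgx x z v v y - dgx x z y v v = 2 * gx x z (chart_christoffel A g x z v v) y"
      unfolding koszul[OF zi] by simp
    also have "\<dots> = 2 * gx q (?\<tau> z) (?J z (chart_christoffel A g x z v v)) (?J z y)" by (simp add: eq[OF z])
    finally show "gx q (?\<tau> z) (chart_christoffel A g q (?\<tau> z) (?J z v) (?J z v)) y' =
        gx q (?\<tau> z) (?J z (chart_christoffel A g x z v v) - ?H v v) y'"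
      by (simp add: y bilinear_lsub[OF b] del: comp_apply)
  qed
qed

text \<open>Hence the spray is a vector field on the tangent bundle, and \<open>geo\<close> can be computed in any chart.\<close>

lemma geo_tlift:
  assumes \<psi>: "tsmooth A \<psi>" and p: "fst p \<in> chart_img A x"
  shows "geo A g \<psi> (tlift A x p) = frechet_derivative (\<lambda>p. \<psi> (tlift A x p)) (at p) (spray A g x p)"
proof -
  obtain z v where zv: "p = (z, v)" by force
  define q where "q = chart_inv A x z"
  have z: "z \<in> chart_img A x" using p zv by simp
  have zO: "z \<in> overlap A x q" unfolding q_def by (rule atlas_overlap(6)[OF atlas z])
  let ?\<tau> = "transition A x q" and ?J = "\<lambda>z. dtransition A x q z"
  let ?O = "overlap A x q \<times> (UNIV :: 'e set)"
  note O = atlas_overlap(2)[OF atlas, of x q] and sm = atlas_overlap(3)[OF atlas, of x q]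
  have OO: "open ?O" "p \<in> ?O" using O zO zv by (auto intro: open_Times)
  let ?T = "\<lambda>p. (?\<tau> (fst p), ?J (fst p) (snd p))"
  let ?T' = "\<lambda>k. (?J z (fst k), frechet_derivative (\<lambda>z. ?J z v) (at z) (fst k) + ?J z (snd k))"
  have \<tau>z: "?\<tau> z = chart_center A q" by (simp add: q_def)
  have T: "?T p = (chart_center A q, tangent_iso A x z v)"
    using \<tau>z by (simp add: zv tangent_iso_def q_def)
  have fst_d: "(fst has_derivative fst) (at p)" and snd_d: "(snd has_derivative snd) (at p)"
    using has_derivative_fst[OF has_derivative_ident] has_derivative_snd[OF has_derivative_ident] by auto
  have "((\<lambda>s. ?J (fst s) (snd s)) has_derivative
      (\<lambda>k. frechet_derivative (\<lambda>z. ?J z v) (at z) (fst k) + ?J z (snd k))) (at p)"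
  proof -
    have "((\<lambda>s. ?J (fst s) u) has_derivative (\<lambda>k. frechet_derivative (\<lambda>z. ?J z u) (at z) (fst k))) (at p)" for u
    proof (rule has_derivative_compose[of fst fst p UNIV "\<lambda>z. ?J z u", OF fst_d])
      show "((\<lambda>z. ?J z u) has_derivative frechet_derivative (\<lambda>z. ?J z u) (at z)) (at (fst p))"
        unfolding zv fst_conv by (rule smooth_on_has_derivative[OF smooth_on_deriv[OF sm] zO])
    qed
    from has_derivative_linear_eval[where \<theta> = "\<lambda>s. ?J (fst s)" and U = snd and U' = snd, OF OO _ this]
    show ?thesis using snd_d zv dtransition_linear[OF atlas] by auto
  qed
  moreover have "((\<lambda>s. ?\<tau> (fst s)) has_derivative (\<lambda>k. ?J z (fst k))) (at p)"
  proof (rule has_derivative_compose[of fst fst p UNIV ?\<tau>, OF fst_d])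
    show "(?\<tau> has_derivative ?J z) (at (fst p))"
      unfolding zv fst_conv by (rule has_derivative_transition[OF atlas zO])
  qed
  ultimately have dT: "(?T has_derivative ?T') (at p)" by (intro has_derivative_Pair)
  have Tq: "?T p \<in> chart_img A q \<times> UNIV" using T atlas_chart(3)[OF atlas] by simp
  have "((\<lambda>p. \<psi> (tlift A q p)) has_derivative frechet_derivative (\<lambda>p. \<psi> (tlift A q p)) (at (?T p))) (at (?T p))"
    using \<psi> Tq unfolding tsmooth_def by (blast intro: smooth_on_has_derivative)
  from has_derivative_compose[where f = ?T, OF dT this]
  have "((\<lambda>p. \<psi> (tlift A q (?T p))) has_derivative (\<lambda>k. frechet_derivative (\<lambda>p. \<psi> (tlift A q p)) (at (?T p)) (?T' k))) (at p)" .
  then have "((\<lambda>p. \<psi> (tlift A x p)) has_derivative (\<lambda>k. frechet_derivative (\<lambda>p. \<psi> (tlift A q p)) (at (?T p)) (?T' k))) (at p)"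
    by (rule has_derivative_transform_within_open[OF _ OO]) (use tlift_transition[OF atlas] in auto)
  from fun_cong[OF frechet_derivative_at[OF this], of "spray A g x p"]
  have "frechet_derivative (\<lambda>p. \<psi> (tlift A x p)) (at p) (spray A g x p) =
     frechet_derivative (\<lambda>p. \<psi> (tlift A q p)) (at (?T p)) (?T' (spray A g x p))" by (rule sym)
  also have "?T' (spray A g x p) = spray A g q (?T p)"
    using chart_christoffel_transition[OF zO, of v] linear_neg[OF dtransition_linear[OF atlas zO]]
    by (simp add: spray_def zv)
  also have "frechet_derivative (\<lambda>p. \<psi> (tlift A q p)) (at (?T p)) (spray A g q (?T p)) = geo A g \<psi> (tlift A x p)"
    unfolding T by (simp add: geo_def tlift_def zv q_def)
  finally show ?thesis by simp
qed

end

section \<open>Calculus on the tangent bundle\<close>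

context riem
begin

lemma tsmooth_D: "tsmooth A \<psi> \<Longrightarrow> smooth_on (chart_img A x \<times> UNIV) (\<lambda>p. \<psi> (tlift A x p))"
  by (simp add: tsmooth_def)

lemma tsmooth_has_derivative:
  "tsmooth A \<psi> \<Longrightarrow> ((\<lambda>p. \<psi> (tlift A x p)) has_derivative
     frechet_derivative (\<lambda>p. \<psi> (tlift A x p)) (at (chart_center A x, v))) (at (chart_center A x, v))"
  using smooth_on_has_derivative[OF tsmooth_D] atlas_chart(3)[OF atlas] by simp

lemma geo_eqI:
  "((\<lambda>p. \<psi> (tlift A x p)) has_derivative D) (at (chart_center A x, v)) \<Longrightarrow>
     geo A g \<psi> (x, v) = D (spray A g x (chart_center A x, v))"
  by (simp add: geo_def frechet_derivative_at[symmetric])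

lemma geo_alt: "geo A g \<psi> (x, v) = frechet_derivative (\<lambda>p. \<psi> (tlift A x p)) (at (chart_center A x, v)) (spray A g x (chart_center A x, v))"
  by (simp add: geo_def)

lemma tsmooth_const: "tsmooth A (\<lambda>P. c)"
  by (simp add: tsmooth_def smooth_on_const open_TM)

lemma tsmooth_add: "tsmooth A \<phi> \<Longrightarrow> tsmooth A \<psi> \<Longrightarrow> tsmooth A (\<lambda>P. \<phi> P + \<psi> P)"
  by (simp add: tsmooth_def smooth_on_add open_TM)

lemma tsmooth_diff: "tsmooth A \<phi> \<Longrightarrow> tsmooth A \<psi> \<Longrightarrow> tsmooth A (\<lambda>P. \<phi> P - \<psi> P)"
  by (simp add: tsmooth_def smooth_on_diff open_TM)

lemma tsmooth_mult: "tsmooth A \<phi> \<Longrightarrow> tsmooth A \<psi> \<Longrightarrow> tsmooth A (\<lambda>P. \<phi> P * \<psi> P)"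
  by (simp add: tsmooth_def smooth_on_mult open_TM)

lemma geo_const: "geo A g (\<lambda>P. c) P = 0"
  by (cases P) (simp add: geo_eqI[OF has_derivative_const])

lemma geo_add: "tsmooth A \<phi> \<Longrightarrow> tsmooth A \<psi> \<Longrightarrow> geo A g (\<lambda>P. \<phi> P + \<psi> P) P = geo A g \<phi> P + geo A g \<psi> P"
  by (cases P) (simp only: geo_alt[of \<phi>] geo_alt[of \<psi>]
      geo_eqI[OF has_derivative_add[OF tsmooth_has_derivative tsmooth_has_derivative]])

lemma geo_diff: "tsmooth A \<phi> \<Longrightarrow> tsmooth A \<psi> \<Longrightarrow> geo A g (\<lambda>P. \<phi> P - \<psi> P) P = geo A g \<phi> P - geo A g \<psi> P"
  by (cases P) (simp only: geo_alt[of \<phi>] geo_alt[of \<psi>]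
      geo_eqI[OF has_derivative_diff[OF tsmooth_has_derivative tsmooth_has_derivative]])

lemma geo_mult: "tsmooth A \<phi> \<Longrightarrow> tsmooth A \<psi> \<Longrightarrow> geo A g (\<lambda>P. \<phi> P * \<psi> P) P = geo A g \<phi> P * \<psi> P + \<phi> P * geo A g \<psi> P"
  by (cases P) (simp add: geo_alt[of \<phi>] geo_alt[of \<psi>] tlift_center[OF atlas]
      geo_eqI[OF has_derivative_mult[OF tsmooth_has_derivative tsmooth_has_derivative]])

lemma geo_cmult: "tsmooth A \<psi> \<Longrightarrow> geo A g (\<lambda>P. c * \<psi> P) P = c * geo A g \<psi> P"
  using geo_mult[OF tsmooth_const, of \<psi> c P] by (simp add: geo_const)

lemma geo_minus: "tsmooth A \<psi> \<Longrightarrow> geo A g (\<lambda>P. - \<psi> P) P = - geo A g \<psi> P"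
  using geo_cmult[of \<psi> "-1" P] by simp

text \<open>Geodesics can be run through at speed \<open>t\<close>: the spray is quadratic in the fibre coordinates.\<close>

lemma geo_scale:
  assumes \<psi>: "tsmooth A \<psi>"
  shows "geo A g (\<lambda>P. \<psi> (fst P, t *\<^sub>R snd P)) (x, v) * t = geo A g \<psi> (x, t *\<^sub>R v)"
proof -
  let ?z = "chart_center A x"
  let ?D = "frechet_derivative (\<lambda>p. \<psi> (tlift A x p)) (at (?z, t *\<^sub>R v))"
  have eq: "(fst (tlift A x p), t *\<^sub>R snd (tlift A x p)) = tlift A x (fst p, t *\<^sub>R snd p)" if "fst p \<in> chart_img A x" for p
    using linear_scale[OF tangent_iso_linear[OF atlas that]] by (simp add: tlift_def)
  have "((\<lambda>p. (fst p, t *\<^sub>R snd p)) has_derivative (\<lambda>k. (fst k, t *\<^sub>R snd k))) (at (?z, v))"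
    by (auto intro!: derivative_eq_intros)
  from has_derivative_compose[OF this, of "\<lambda>p. \<psi> (tlift A x p)" ?D] tsmooth_has_derivative[OF \<psi>]
  have "((\<lambda>p. \<psi> (tlift A x (fst p, t *\<^sub>R snd p))) has_derivative (\<lambda>k. ?D (fst k, t *\<^sub>R snd k))) (at (?z, v))" by simp
  then have "((\<lambda>p. \<psi> (fst (tlift A x p), t *\<^sub>R snd (tlift A x p))) has_derivative (\<lambda>k. ?D (fst k, t *\<^sub>R snd k))) (at (?z, v))"
    by (rule has_derivative_transform_within_open[OF _ open_TM[of x]]) (use eq atlas_chart(3)[OF atlas] in auto)
  from geo_eqI[OF this] have "geo A g (\<lambda>P. \<psi> (fst P, t *\<^sub>R snd P)) (x, v) * t =
      t * ?D (v, t *\<^sub>R - chart_christoffel A g x ?z v v)" by (simp add: spray_def)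
  also have "\<dots> = ?D (t *\<^sub>R (v, t *\<^sub>R - chart_christoffel A g x ?z v v))"
    by (rule linear_scale[OF has_derivative_linear[OF tsmooth_has_derivative[OF \<psi>]], symmetric, unfolded real_scaleR_def])
  also have "t *\<^sub>R (v, t *\<^sub>R - chart_christoffel A g x ?z v v) = spray A g x (?z, t *\<^sub>R v)"
    using bilinear_lmul[OF chart_christoffel_bilinear[OF atlas_chart(3)[OF atlas]]]
      bilinear_rmul[OF chart_christoffel_bilinear[OF atlas_chart(3)[OF atlas]]] by (simp add: spray_def)
  finally show ?thesis by (simp add: geo_alt)
qed

text \<open>The second-derivative test, in the chart around the base point.\<close>

lemma geo_geo_nonpos_at_max:
  assumes \<psi>: "tsmooth A \<psi>" and max: "\<And>P. \<psi> P \<le> \<psi> P0"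
  shows "geo A g (geo A g \<psi>) P0 \<le> 0"
proof -
  obtain x v where P0: "P0 = (x, v)" by force
  let ?p = "(chart_center A x, v)"
  have p: "?p \<in> chart_img A x \<times> UNIV" using atlas_chart(3)[OF atlas] by simp
  have "geo A g (geo A g \<psi>) P0 = frechet_derivative (\<lambda>p. geo A g \<psi> (tlift A x p)) (at ?p) (spray A g x ?p)"
    by (simp add: P0 geo_alt)
  also have "frechet_derivative (\<lambda>p. geo A g \<psi> (tlift A x p)) (at ?p) =
      frechet_derivative (\<lambda>p. frechet_derivative (\<lambda>p. \<psi> (tlift A x p)) (at p) (spray A g x p)) (at ?p)"
    by (rule frechet_derivative_cong[OF open_TM p]) (use geo_tlift[OF \<psi>] in auto)
  also have "frechet_derivative (\<lambda>p. frechet_derivative (\<lambda>p. \<psi> (tlift A x p)) (at p) (spray A g x p)) (at ?p) (spray A g x ?p) \<le> 0"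
    by (rule field_derivative_twice_nonpos_at_max[OF open_TM p tsmooth_D[OF \<psi>] _ spray_smooth])
      (use max in \<open>simp add: tlift_center[OF atlas] P0\<close>)
  finally show ?thesis .
qed

text \<open>For tensors, \<open>geo\<close> is the covariant derivative, evaluated on the diagonal.\<close>

lemma fst_snd_has_derivative: "(fst has_derivative fst) (at p)" "(snd has_derivative snd) (at p)"
  using has_derivative_fst[OF has_derivative_ident] has_derivative_snd[OF has_derivative_ident] by auto

lemma geo_lin_fun:
  assumes K: "sym_tensor_field A 1 K"
  shows "geo A g (lin_fun K) (x, v) = nabla A g x v K [v]"
proof -
  let ?z = "chart_center A x"
  let ?D = "\<lambda>u. frechet_derivative (\<lambda>z. local_rep A K x z [u]) (at ?z)"
  have z: "?z \<in> chart_img A x" by (rule atlas_chart(3)[OF atlas])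
  have p: "(?z, v) \<in> chart_img A x \<times> UNIV" using z by simp
  have d: "((\<lambda>s. local_rep A K x (fst s) [u]) has_derivative (\<lambda>k. ?D u (fst k))) (at (?z, v))" for u
    by (rule has_derivative_compose[of fst fst "(?z, v)" UNIV "\<lambda>z. local_rep A K x z [u]", OF fst_snd_has_derivative(1)])
      (use smooth_on_has_derivative[OF sym_tensor_fieldD(2)[OF K] z, of "[u]"] in simp)
  have "((\<lambda>s. local_rep A K x (fst s) [snd s]) has_derivative
      (\<lambda>k. ?D (snd (?z, v)) (fst k) + local_rep A K x (fst (?z, v)) [snd k])) (at (?z, v))"
    by (rule has_derivative_linear_eval[where \<theta> = "\<lambda>s u. local_rep A K x (fst s) [u]", OF open_TM p _ d fst_snd_has_derivative(2)])
      (use sym_tensors_1_linear[OF local_rep_sym_tensors[OF atlas K]] in auto)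
  from geo_eqI[of "lin_fun K", unfolded lin_fun_tlift, OF this] show ?thesis
    using linear_neg[OF sym_tensors_1_linear[OF sym_tensor_fieldD(1)[OF K]]]
    by (simp add: spray_def local_rep_self[OF atlas] nabla_def coord_deriv_def christoffel_center)
qed

lemma geo_quad_fun:
  assumes K: "sym_tensor_field A 2 K"
  shows "geo A g (quad_fun K) (x, v) = nabla A g x v K [v, v]"
proof -
  let ?z = "chart_center A x"
  let ?D = "\<lambda>u w. frechet_derivative (\<lambda>z. local_rep A K x z [u, w]) (at ?z)"
  have z: "?z \<in> chart_img A x" by (rule atlas_chart(3)[OF atlas])
  have p: "(?z, v) \<in> chart_img A x \<times> UNIV" using z by simp
  have d: "((\<lambda>s. local_rep A K x (fst s) [u, w]) has_derivative (\<lambda>k. ?D u w (fst k))) (at (?z, v))" for u w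
    by (rule has_derivative_compose[of fst fst "(?z, v)" UNIV "\<lambda>z. local_rep A K x z [u, w]", OF fst_snd_has_derivative(1)])
      (use smooth_on_has_derivative[OF sym_tensor_fieldD(2)[OF K] z, of "[u, w]"] in simp)
  have "((\<lambda>s. local_rep A K x (fst s) [snd s, snd s]) has_derivative
      (\<lambda>k. ?D (snd (?z, v)) (snd (?z, v)) (fst k) + local_rep A K x (fst (?z, v)) [snd k, snd (?z, v)]
         + local_rep A K x (fst (?z, v)) [snd (?z, v), snd k])) (at (?z, v))"
    by (rule has_derivative_bilinear_eval[where G = "\<lambda>s u w. local_rep A K x (fst s) [u, w]",
          OF open_TM p _ d fst_snd_has_derivative(2) fst_snd_has_derivative(2)])
      (use sym_tensors_2_bilinear[OF local_rep_sym_tensors[OF atlas K]] in auto)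
  from geo_eqI[of "quad_fun K", unfolded quad_fun_tlift, OF this] show ?thesis
    using linear_neg[OF sym_tensors_2D(2)[OF sym_tensor_fieldD(1)[OF K]]] linear_neg[OF sym_tensors_2D(3)[OF sym_tensor_fieldD(1)[OF K]]]
    by (simp add: spray_def local_rep_self[OF atlas] nabla_def coord_deriv_def christoffel_center numeral_2_eq_2 lessThan_Suc)
qed

lemma tsmooth_metric: "tsmooth A (quad_fun g)"
  by (rule tsmooth_quad_fun[OF atlas metric_field])

lemma geo_metric: "geo A g (quad_fun g) P = 0"
  by (cases P) (simp add: geo_quad_fun[OF metric_field] nabla_metric[OF riem])

end

section \<open>Functions on the product of two tangent bundles\<close>

text \<open>A tangent vector of the product is a pair of tangent vectors of the factors. With the two as separate
  arguments, the derivatives along the two geodesic flows act on one argument each, and the other one is a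
  parameter.\<close>

definition jrep :: "('a, 'e::euclidean_space) atlas \<Rightarrow> ('b, 'f::euclidean_space) atlas \<Rightarrow>
    ('a \<times> 'e \<Rightarrow> 'b \<times> 'f \<Rightarrow> real) \<Rightarrow> 'a \<Rightarrow> 'b \<Rightarrow> ('e \<times> 'e) \<times> ('f \<times> 'f) \<Rightarrow> real" where
  "jrep A B \<Phi> x y z = \<Phi> (tlift A x (fst z)) (tlift B y (snd z))"

definition jdom :: "('a, 'e::euclidean_space) atlas \<Rightarrow> ('b, 'f::euclidean_space) atlas \<Rightarrow>
    'a \<Rightarrow> 'b \<Rightarrow> (('e \<times> 'e) \<times> ('f \<times> 'f)) set" where
  "jdom A B x y = (chart_img A x \<times> UNIV) \<times> (chart_img B y \<times> UNIV)"

definition jsmooth :: "('a, 'e::euclidean_space) atlas \<Rightarrow> ('b, 'f::euclidean_space) atlas \<Rightarrow>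
    ('a \<times> 'e \<Rightarrow> 'b \<times> 'f \<Rightarrow> real) \<Rightarrow> bool" where
  "jsmooth A B \<Phi> \<longleftrightarrow> (\<forall>x y. smooth_on (jdom A B x y) (jrep A B \<Phi> x y))"

definition geo1 :: "('a, 'e::euclidean_space) atlas \<Rightarrow> ('a, 'e) tensor_field \<Rightarrow>
    ('a \<times> 'e \<Rightarrow> 'q \<Rightarrow> real) \<Rightarrow> 'a \<times> 'e \<Rightarrow> 'q \<Rightarrow> real" where
  "geo1 A g \<Phi> P Q = geo A g (\<lambda>P. \<Phi> P Q) P"

definition geo2 :: "('b, 'f::euclidean_space) atlas \<Rightarrow> ('b, 'f) tensor_field \<Rightarrow>
    ('p \<Rightarrow> 'b \<times> 'f \<Rightarrow> real) \<Rightarrow> 'p \<Rightarrow> 'b \<times> 'f \<Rightarrow> real" where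
  "geo2 B k \<Phi> P Q = geo B k (\<Phi> P) Q"

locale riem_pair = M1: riem A1 g1 + M2: riem A2 g2
  for A1 :: "('a::t2_space, 'e::euclidean_space) atlas" and g1
    and A2 :: "('b::t2_space, 'f::euclidean_space) atlas" and g2
begin

abbreviation "smooth \<equiv> jsmooth A1 A2"
abbreviation "F1 \<equiv> geo1 A1 g1"
abbreviation "F2 \<equiv> geo2 A2 g2"
abbreviation "jd \<equiv> jdom A1 A2"
abbreviation "rep \<equiv> jrep A1 A2"

lemma open_jd: "open (jd x y)"
  unfolding jdom_def by (intro open_Times M1.open_TM M2.open_TM)

lemma smoothD: "smooth \<Phi> \<Longrightarrow> smooth_on (jd x y) (rep \<Phi> x y)"
  by (simp add: jsmooth_def)

lemma smooth_slice1:
  assumes \<Phi>: "smooth \<Phi>" shows "tsmooth A1 (\<lambda>P. \<Phi> P Q)"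
  unfolding tsmooth_def
proof
  fix x
  obtain y w where Q: "Q = (y, w)" by force
  let ?q = "(chart_center A2 y, w)"
  have "smooth_on (chart_img A1 x \<times> UNIV) (\<lambda>p. rep \<Phi> x y (p, ?q))"
    by (rule smooth_on_compose[OF M1.open_TM _ smoothD[OF \<Phi>]])
      (use atlas_chart(3)[OF M2.atlas] in \<open>auto simp: jdom_def intro!: smooth_on_Pair smooth_on_id smooth_on_const M1.open_TM\<close>)
  then show "smooth_on (chart_img A1 x \<times> UNIV) (\<lambda>p. \<Phi> (tlift A1 x p) Q)"
    by (simp add: jrep_def tlift_center[OF M2.atlas] Q)
qed

lemma smooth_slice2:
  assumes \<Phi>: "smooth \<Phi>" shows "tsmooth A2 (\<Phi> P)"
  unfolding tsmooth_def
proof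
  fix y
  obtain x v where P: "P = (x, v)" by force
  let ?p = "(chart_center A1 x, v)"
  have "smooth_on (chart_img A2 y \<times> UNIV) (\<lambda>q. rep \<Phi> x y (?p, q))"
    by (rule smooth_on_compose[OF M2.open_TM _ smoothD[OF \<Phi>]])
      (use atlas_chart(3)[OF M1.atlas] in \<open>auto simp: jdom_def intro!: smooth_on_Pair smooth_on_id smooth_on_const M2.open_TM\<close>)
  then show "smooth_on (chart_img A2 y \<times> UNIV) (\<lambda>q. \<Phi> P (tlift A2 y q))"
    by (simp add: jrep_def tlift_center[OF M1.atlas] P)
qed

lemma F1_rep:
  assumes \<Phi>: "smooth \<Phi>" and z: "z \<in> jd x y"
  shows "rep (F1 \<Phi>) x y z = frechet_derivative (rep \<Phi> x y) (at z) (spray A1 g1 x (fst z), 0)"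
proof -
  obtain p q where pq: "z = (p, q)" by (cases z)
  have "rep (F1 \<Phi>) x y z = frechet_derivative (\<lambda>p. \<Phi> (tlift A1 x p) (tlift A2 y q)) (at p) (spray A1 g1 x p)"
    unfolding jrep_def geo1_def pq fst_conv snd_conv
    by (rule M1.geo_tlift[OF smooth_slice1[OF \<Phi>]]) (use z pq in \<open>auto simp: jdom_def\<close>)
  also have "\<dots> = frechet_derivative (rep \<Phi> x y) (at z) (spray A1 g1 x (fst z), 0)"
    using frechet_derivative_fst_slice[OF smoothD[OF \<Phi>], of p q x y] z pq by (simp add: jrep_def)
  finally show ?thesis .
qed

lemma F2_rep:
  assumes \<Phi>: "smooth \<Phi>" and z: "z \<in> jd x y"
  shows "rep (F2 \<Phi>) x y z = frechet_derivative (rep \<Phi> x y) (at z) (0, spray A2 g2 y (snd z))"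
proof -
  obtain p q where pq: "z = (p, q)" by (cases z)
  have "rep (F2 \<Phi>) x y z = frechet_derivative (\<lambda>q. \<Phi> (tlift A1 x p) (tlift A2 y q)) (at q) (spray A2 g2 y q)"
    unfolding jrep_def geo2_def pq fst_conv snd_conv
    by (rule M2.geo_tlift[OF smooth_slice2[OF \<Phi>]]) (use z pq in \<open>auto simp: jdom_def\<close>)
  also have "\<dots> = frechet_derivative (rep \<Phi> x y) (at z) (0, spray A2 g2 y (snd z))"
    using frechet_derivative_snd_slice[OF smoothD[OF \<Phi>], of p q x y] z pq by (simp add: jrep_def)
  finally show ?thesis .
qed

lemma smooth_spray1: "smooth_on (jd x y) (\<lambda>z. spray A1 g1 x (fst z))"
  by (rule smooth_on_compose[OF open_jd smooth_on_fst[OF open_jd smooth_on_id[OF open_jd]] M1.spray_smooth])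
    (auto simp: jdom_def)

lemma smooth_spray2: "smooth_on (jd x y) (\<lambda>z. spray A2 g2 y (snd z))"
  by (rule smooth_on_compose[OF open_jd smooth_on_snd[OF open_jd smooth_on_id[OF open_jd]] M2.spray_smooth])
    (auto simp: jdom_def)

lemma smooth_F1:
  assumes "smooth \<Phi>" shows "smooth (F1 \<Phi>)"
  unfolding jsmooth_def
  by (intro allI smooth_on_cong[OF open_jd F1_rep[OF assms, symmetric]] smooth_on_deriv_dir[OF open_jd smoothD[OF assms]]
      smooth_on_Pair[OF open_jd smooth_spray1 smooth_on_const[OF open_jd]])

lemma smooth_F2:
  assumes "smooth \<Phi>" shows "smooth (F2 \<Phi>)"
  unfolding jsmooth_def
  by (intro allI smooth_on_cong[OF open_jd F2_rep[OF assms, symmetric]] smooth_on_deriv_dir[OF open_jd smoothD[OF assms]]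
      smooth_on_Pair[OF open_jd smooth_on_const[OF open_jd] smooth_spray2])

lemma F1_F2_commute:
  assumes \<Phi>: "smooth \<Phi>"
  shows "F1 (F2 \<Phi>) P Q = F2 (F1 \<Phi>) P Q"
proof -
  obtain x v y w where PQ: "P = (x, v)" "Q = (y, w)" by (metis surj_pair)
  let ?p = "(chart_center A1 x, v)" and ?q = "(chart_center A2 y, w)"
  let ?z = "(?p, ?q)"
  have z: "?z \<in> jd x y" using atlas_chart(3)[OF M1.atlas] atlas_chart(3)[OF M2.atlas] by (simp add: jdom_def)
  have at: "\<Psi> P Q = rep \<Psi> x y ?z" for \<Psi>
    by (simp add: jrep_def PQ tlift_center M1.atlas M2.atlas)
  have "F1 (F2 \<Phi>) P Q = frechet_derivative (rep (F2 \<Phi>) x y) (at ?z) (spray A1 g1 x ?p, 0)"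
    unfolding at F1_rep[OF smooth_F2[OF \<Phi>] z] by simp
  also have "frechet_derivative (rep (F2 \<Phi>) x y) (at ?z) =
      frechet_derivative (\<lambda>z. frechet_derivative (rep \<Phi> x y) (at z) (0, spray A2 g2 y (snd z))) (at ?z)"
    by (rule frechet_derivative_cong[OF open_jd z F2_rep[OF \<Phi>]])
  also have "\<dots> (spray A1 g1 x ?p, 0) =
      frechet_derivative (\<lambda>z. frechet_derivative (rep \<Phi> x y) (at z) (spray A1 g1 x (fst z), 0)) (at ?z) (0, spray A2 g2 y ?q)"
    by (rule factor_fields_commute[where S = "chart_img A1 x \<times> UNIV" and T = "chart_img A2 y \<times> UNIV"])
      (use open_jd smoothD[OF \<Phi>, of x y] M1.spray_smooth M2.spray_smooth z in \<open>auto simp: jdom_def\<close>)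
  also have "frechet_derivative (\<lambda>z. frechet_derivative (rep \<Phi> x y) (at z) (spray A1 g1 x (fst z), 0)) (at ?z) =
      frechet_derivative (rep (F1 \<Phi>) x y) (at ?z)"
    by (rule frechet_derivative_cong[OF open_jd z F1_rep[OF \<Phi>, symmetric]])
  also have "\<dots> (0, spray A2 g2 y ?q) = F2 (F1 \<Phi>) P Q"
    unfolding at[of "F2 (F1 \<Phi>)"] F2_rep[OF smooth_F1[OF \<Phi>] z] by simp
  finally show ?thesis .
qed

lemma smooth_const: "smooth (\<lambda>P Q. c)"
  by (simp add: jsmooth_def jrep_def[abs_def] smooth_on_const open_jd)

lemma smooth_add: "smooth \<Phi> \<Longrightarrow> smooth \<Psi> \<Longrightarrow> smooth (\<lambda>P Q. \<Phi> P Q + \<Psi> P Q)"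
  by (simp add: jsmooth_def jrep_def[abs_def] smooth_on_add open_jd)

lemma smooth_diff: "smooth \<Phi> \<Longrightarrow> smooth \<Psi> \<Longrightarrow> smooth (\<lambda>P Q. \<Phi> P Q - \<Psi> P Q)"
  by (simp add: jsmooth_def jrep_def[abs_def] smooth_on_diff open_jd)

lemma smooth_minus: "smooth \<Phi> \<Longrightarrow> smooth (\<lambda>P Q. - \<Phi> P Q)"
  by (simp add: jsmooth_def jrep_def[abs_def] smooth_on_minus open_jd)

lemma smooth_mult: "smooth \<Phi> \<Longrightarrow> smooth \<Psi> \<Longrightarrow> smooth (\<lambda>P Q. \<Phi> P Q * \<Psi> P Q)"
  by (simp add: jsmooth_def jrep_def[abs_def] smooth_on_mult open_jd)

lemma smooth_first:
  assumes "tsmooth A1 \<psi>" shows "smooth (\<lambda>P Q. \<psi> P)"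
  unfolding jsmooth_def jrep_def[abs_def]
proof (intro allI)
  fix x y
  show "smooth_on (jd x y) (\<lambda>z. \<psi> (tlift A1 x (fst z)))"
    by (rule smooth_on_compose[OF open_jd smooth_on_fst[OF open_jd smooth_on_id[OF open_jd]] M1.tsmooth_D[OF assms]])
      (auto simp: jdom_def)
qed

lemma smooth_second:
  assumes "tsmooth A2 \<psi>" shows "smooth (\<lambda>P Q. \<psi> Q)"
  unfolding jsmooth_def jrep_def[abs_def]
proof (intro allI)
  fix x y
  show "smooth_on (jd x y) (\<lambda>z. \<psi> (tlift A2 y (snd z)))"
    by (rule smooth_on_compose[OF open_jd smooth_on_snd[OF open_jd smooth_on_id[OF open_jd]] M2.tsmooth_D[OF assms]])
      (auto simp: jdom_def)
qed

lemma F_const: "F1 (\<lambda>P Q. c) P Q = 0" "F2 (\<lambda>P Q. c) P Q = 0"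
  by (simp_all add: geo1_def geo2_def M1.geo_const M2.geo_const)

lemma F_add:
  assumes "smooth \<Phi>" "smooth \<Psi>"
  shows "F1 (\<lambda>P Q. \<Phi> P Q + \<Psi> P Q) P Q = F1 \<Phi> P Q + F1 \<Psi> P Q"
    and "F2 (\<lambda>P Q. \<Phi> P Q + \<Psi> P Q) P Q = F2 \<Phi> P Q + F2 \<Psi> P Q"
  by (simp_all add: geo1_def geo2_def M1.geo_add smooth_slice1 M2.geo_add smooth_slice2 assms)

lemma F_diff:
  assumes "smooth \<Phi>" "smooth \<Psi>"
  shows "F1 (\<lambda>P Q. \<Phi> P Q - \<Psi> P Q) P Q = F1 \<Phi> P Q - F1 \<Psi> P Q"
    and "F2 (\<lambda>P Q. \<Phi> P Q - \<Psi> P Q) P Q = F2 \<Phi> P Q - F2 \<Psi> P Q"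
  by (simp_all add: geo1_def geo2_def M1.geo_diff smooth_slice1 M2.geo_diff smooth_slice2 assms)

lemma F_minus:
  assumes "smooth \<Phi>"
  shows "F1 (\<lambda>P Q. - \<Phi> P Q) P Q = - F1 \<Phi> P Q" and "F2 (\<lambda>P Q. - \<Phi> P Q) P Q = - F2 \<Phi> P Q"
  by (simp_all add: geo1_def geo2_def M1.geo_minus smooth_slice1 M2.geo_minus smooth_slice2 assms)

lemma F_mult:
  assumes "smooth \<Phi>" "smooth \<Psi>"
  shows "F1 (\<lambda>P Q. \<Phi> P Q * \<Psi> P Q) P Q = F1 \<Phi> P Q * \<Psi> P Q + \<Phi> P Q * F1 \<Psi> P Q"
    and "F2 (\<lambda>P Q. \<Phi> P Q * \<Psi> P Q) P Q = F2 \<Phi> P Q * \<Psi> P Q + \<Phi> P Q * F2 \<Psi> P Q"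
  by (simp_all add: geo1_def geo2_def M1.geo_mult smooth_slice1 M2.geo_mult smooth_slice2 assms)

lemma F_first: "F1 (\<lambda>P Q. \<psi> P) P Q = geo A1 g1 \<psi> P" "F2 (\<lambda>P Q. \<psi> P) P Q = 0"
  by (simp_all add: geo1_def geo2_def M2.geo_const)

lemma F_second: "F2 (\<lambda>P Q. \<psi> Q) P Q = geo A2 g2 \<psi> Q" "F1 (\<lambda>P Q. \<psi> Q) P Q = 0"
  by (simp_all add: geo1_def geo2_def M1.geo_const)

abbreviation "r2 P \<equiv> quad_fun g1 P"
abbreviation "s2 Q \<equiv> quad_fun g2 Q"

lemma smooth_r2: "smooth (\<lambda>P Q. r2 P)" and smooth_s2: "smooth (\<lambda>P Q. s2 Q)"
  by (rule smooth_first[OF M1.tsmooth_metric], rule smooth_second[OF M2.tsmooth_metric])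

lemma F_r2: "F1 (\<lambda>P Q. r2 P) P Q = 0" "F2 (\<lambda>P Q. r2 P) P Q = 0"
  by (simp_all add: F_first M1.geo_metric)

lemma F_s2: "F1 (\<lambda>P Q. s2 Q) P Q = 0" "F2 (\<lambda>P Q. s2 Q) P Q = 0"
  by (simp_all add: F_second M2.geo_metric)

lemmas smooth_intros = smooth_const smooth_add smooth_diff smooth_minus smooth_mult smooth_F1 smooth_F2 smooth_r2 smooth_s2

end

section \<open>The maximum principle\<close>

lemma continuous_on_bilinear_eval:
  fixes G :: "'a::metric_space \<Rightarrow> 'e::euclidean_space \<Rightarrow> 'f::euclidean_space \<Rightarrow> real"
  assumes "\<And>u v. continuous_on C (\<lambda>z. G z u v)" "\<And>z. z \<in> C \<Longrightarrow> bilinear (G z)"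
  shows "continuous_on (C \<times> UNIV) (\<lambda>p. G (fst p) (fst (snd p)) (snd (snd p)))"
proof -
  have "continuous_on (C \<times> UNIV) (\<lambda>p. \<Sum>b\<in>Basis. \<Sum>c\<in>Basis. ((fst (snd p) \<bullet> b) * (snd (snd p) \<bullet> c)) *\<^sub>R G (fst p) b c)"
    by (intro continuous_intros continuous_on_compose2[OF assms(1)]) auto
  then show ?thesis
  proof (rule continuous_on_cong[THEN iffD1, rotated -1])
    fix p assume "p \<in> C \<times> (UNIV :: ('e \<times> 'f) set)"
    then have "bilinear (G (fst p))" using assms(2) by auto
    from bilinear_expand[OF this]
    show "(\<Sum>b\<in>Basis. \<Sum>c\<in>Basis. ((fst (snd p) \<bullet> b) * (snd (snd p) \<bullet> c)) *\<^sub>R G (fst p) b c) =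
      G (fst p) (fst (snd p)) (snd (snd p))" by (rule sym)
  qed simp
qed

context riem
begin

lemma chart_neighbourhood:
  assumes "open B" "chart_center A x \<in> B"
  shows "open {q \<in> chart_dom A x. chart_map A x q \<in> B}" "x \<in> {q \<in> chart_dom A x. chart_map A x q \<in> B}"
proof -
  have "{q \<in> chart_dom A x. chart_map A x q \<in> B} = chart_dom A x \<inter> chart_map A x -` B" by auto
  then show "open {q \<in> chart_dom A x. chart_map A x q \<in> B}"
    using continuous_open_preimage[OF atlas_chart(6,4)[OF atlas] assms(1)] by simp
  show "x \<in> {q \<in> chart_dom A x. chart_map A x q \<in> B}" using assms(2) atlas_chart(1)[OF atlas] by simp
qed

lemma chart_ball: "\<exists>e>0. cball (chart_center A x) e \<subseteq> chart_img A x"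
  using atlas_chart(2,3)[OF atlas] open_contains_cball by blast

lemma tlift_surj:
  assumes "q \<in> chart_dom A x"
  shows "\<exists>v. (q, w) = tlift A x (chart_map A x q, v)"
proof -
  have "surj (tangent_iso A x (chart_map A x q))"
    using tangent_iso_bij[OF atlas atlas_chart(9)[OF atlas assms]] bij_is_surj by blast
  then obtain v where "w = tangent_iso A x (chart_map A x q) v" by (meson surjD)
  then show ?thesis by (auto simp: tlift_def atlas_chart(10)[OF atlas assms])
qed

text \<open>Bounded, because the metric is uniformly positive over the ball.\<close>

lemma unit_vectors_compact:
  assumes sub: "cball c e \<subseteq> chart_img A x"
  shows "compact {p \<in> cball c e \<times> UNIV. gx x (fst p) (snd p) (snd p) = 1}" (is "compact ?C")
proof -
  have cont: "continuous_on (cball c e) (\<lambda>z. gx x z u v)" for u v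
    by (rule continuous_on_subset[OF smooth_on_continuous_on[OF gx_smooth] sub])
  have bil: "bilinear (gx x z)" if "z \<in> cball c e" for z using gx_bilinear sub that by blast
  have "continuous_on (cball c e \<times> UNIV) (\<lambda>p. gx x (fst p) (snd p) (snd p))"
    by (rule continuous_on_compose2[OF continuous_on_bilinear_eval[OF cont bil], of "cball c e \<times> UNIV"
        "\<lambda>p. (fst p, snd p, snd p)", simplified]) (auto intro!: continuous_intros)
  then have "closed ?C" by (intro continuous_closed_preimage_constant closed_Times) auto
  moreover have "bounded ?C"
  proof -
    obtain k where k: "k > 0" "\<And>z v. z \<in> cball c e \<Longrightarrow> k * (norm v)\<^sup>2 \<le> gx x z v v"
      using posdef_lower_bound[OF compact_cball cont bil] gx_pos sub by blast
    have "norm (snd p) \<le> sqrt (1/k)" if "p \<in> ?C" for p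
    proof (rule real_le_rsqrt)
      show "(norm (snd p))\<^sup>2 \<le> 1 / k" using k(2)[of "fst p" "snd p"] that k(1) by (auto simp: field_simps)
    qed
    then have "?C \<subseteq> cball c e \<times> cball 0 (sqrt (1/k))" by auto
    then show ?thesis by (rule bounded_subset[OF bounded_Times[OF bounded_cball bounded_cball]])
  qed
  ultimately show ?thesis by (simp add: compact_eq_bounded_closed)
qed

text \<open>Compactness of the unit tangent bundle, expressed through charts: the type \<open>'a \<times> 'e\<close> does not carry the
  topology of the bundle.\<close>

lemma unit_bundle_cover:
  assumes comp: "compact (UNIV :: 'a set)"
  shows "\<exists>N C. finite N \<and> (\<forall>x\<in>N. compact (C x) \<and> C x \<subseteq> chart_img A x \<times> UNIV) \<and>
    {P. quad_fun g P = 1} = (\<Union>x\<in>N. tlift A x ` C x)"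
proof -
  obtain e where e: "\<And>x. e x > 0" "\<And>x. cball (chart_center A x) (e x) \<subseteq> chart_img A x"
    using chart_ball by metis
  let ?C = "\<lambda>x. {p \<in> cball (chart_center A x) (e x) \<times> UNIV. gx x (fst p) (snd p) (snd p) = 1}"
  let ?W = "\<lambda>x. {q \<in> chart_dom A x. chart_map A x q \<in> ball (chart_center A x) (e x)}"
  have W: "open (?W x)" "x \<in> ?W x" for x
    using chart_neighbourhood[of "ball (chart_center A x) (e x)" x] e(1)[of x] by auto
  obtain N where N: "finite N" "(UNIV :: 'a set) \<subseteq> (\<Union>x\<in>N. ?W x)"
    by (rule compactE_image[OF comp, of UNIV ?W]) (use W in auto)
  have "\<exists>x\<in>N. P \<in> tlift A x ` ?C x" if P: "quad_fun g P = 1" for P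
  proof -
    obtain q w where qw: "P = (q, w)" by force
    obtain x where x: "x \<in> N" "q \<in> ?W x" using N by blast
    obtain v where v: "(q, w) = tlift A x (chart_map A x q, v)" using tlift_surj x by blast
    moreover have "(chart_map A x q, v) \<in> ?C x"
      using x P v quad_fun_tlift[of g A x "(chart_map A x q, v)"] by (auto simp: qw)
    ultimately show ?thesis using x(1) qw by blast
  qed
  moreover have "quad_fun g (tlift A x p) = 1" if "p \<in> ?C x" for x p
    using that by (simp add: quad_fun_tlift)
  ultimately have "{P. quad_fun g P = 1} = (\<Union>x\<in>N. tlift A x ` ?C x)" by blast
  moreover have "compact (?C x)" "?C x \<subseteq> chart_img A x \<times> UNIV" for x
    using unit_vectors_compact[OF e(2)] e(2) by blast+
  ultimately show ?thesis using N(1) by (intro exI[of _ N] exI[of _ ?C]) auto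
qed

lemma metric_scale: "quad_fun g (x, t *\<^sub>R v) = t\<^sup>2 * quad_fun g (x, v)"
  using linear_scale[OF sym_tensors_2D(2)[OF metric_sym]] linear_scale[OF sym_tensors_2D(3)[OF metric_sym]]
  by (simp add: quad_fun_def power2_eq_square)

lemma unit_vector_exists: "\<exists>u. quad_fun g (x, u) = 1 \<and> (\<exists>t. v = t *\<^sub>R u)"
proof -
  have unit: "quad_fun g (x, (1 / sqrt (g x [w, w])) *\<^sub>R w) = 1" if "w \<noteq> 0" for w
    using metric_pos[OF that, of x] unfolding metric_scale by (simp add: quad_fun_def power_divide)
  show ?thesis
  proof (cases "v = 0")
    case True
    obtain w :: 'e where "w \<noteq> 0" using nonempty_Basis nonzero_Basis by blast
    then show ?thesis using unit True by (metis scaleR_zero_left)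
  next
    case False
    then have "v = sqrt (g x [v, v]) *\<^sub>R (1 / sqrt (g x [v, v])) *\<^sub>R v"
      using metric_pos[OF False, of x] by simp
    then show ?thesis using unit[OF False] by blast
  qed
qed

end

context riem_pair
begin

lemma unit_max:
  assumes comp: "compact (UNIV :: 'a set)" "compact (UNIV :: 'b set)" and \<Phi>: "smooth \<Phi>"
  shows "\<exists>P0 Q0. r2 P0 = 1 \<and> s2 Q0 = 1 \<and> (\<forall>P Q. r2 P = 1 \<longrightarrow> s2 Q = 1 \<longrightarrow> \<Phi> P Q \<le> \<Phi> P0 Q0)"
proof -
  obtain N1 C1 where 1: "finite N1" "\<And>x. x \<in> N1 \<Longrightarrow> compact (C1 x)" "\<And>x. x \<in> N1 \<Longrightarrow> C1 x \<subseteq> chart_img A1 x \<times> UNIV"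
    "{P. r2 P = 1} = (\<Union>x\<in>N1. tlift A1 x ` C1 x)"
    using M1.unit_bundle_cover[OF comp(1)] by (elim exE conjE) (rule that, auto)
  obtain N2 C2 where 2: "finite N2" "\<And>x. x \<in> N2 \<Longrightarrow> compact (C2 x)" "\<And>x. x \<in> N2 \<Longrightarrow> C2 x \<subseteq> chart_img A2 x \<times> UNIV"
    "{Q. s2 Q = 1} = (\<Union>x\<in>N2. tlift A2 x ` C2 x)"
    using M2.unit_bundle_cover[OF comp(2)] by (elim exE conjE) (rule that, auto)
  let ?V = "\<Union>x\<in>N1. \<Union>y\<in>N2. rep \<Phi> x y ` (C1 x \<times> C2 y)"
  have cV: "compact ?V"
  proof (intro compact_UN 1(1) 2(1) compact_continuous_image compact_Times 1(2) 2(2))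
    fix x y assume "x \<in> N1" "y \<in> N2"
    then have "C1 x \<times> C2 y \<subseteq> jd x y" using 1(3) 2(3) by (auto simp: jdom_def)
    then show "continuous_on (C1 x \<times> C2 y) (rep \<Phi> x y)"
      by (rule continuous_on_subset[OF smooth_on_continuous_on[OF smoothD[OF \<Phi>]]])
  qed
  have V: "?V = {\<Phi> P Q |P Q. r2 P = 1 \<and> s2 Q = 1}"
  proof (intro equalityI subsetI)
    fix s assume "s \<in> ?V"
    then obtain x y p q where xy: "x \<in> N1" "y \<in> N2" "p \<in> C1 x" "q \<in> C2 y"
      and s: "s = \<Phi> (tlift A1 x p) (tlift A2 y q)"
      by (auto simp: jrep_def)
    have "tlift A1 x p \<in> {P. r2 P = 1}" "tlift A2 y q \<in> {Q. s2 Q = 1}" unfolding 1(4) 2(4) using xy by blast+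
    then show "s \<in> {\<Phi> P Q |P Q. r2 P = 1 \<and> s2 Q = 1}" using s by blast
  next
    fix s assume "s \<in> {\<Phi> P Q |P Q. r2 P = 1 \<and> s2 Q = 1}"
    then obtain P Q where PQ: "P \<in> {P. r2 P = 1}" "Q \<in> {Q. s2 Q = 1}" and s: "s = \<Phi> P Q" by blast
    obtain x p where x: "x \<in> N1" "p \<in> C1 x" "P = tlift A1 x p" using PQ(1) unfolding 1(4) by blast
    obtain y q where y: "y \<in> N2" "q \<in> C2 y" "Q = tlift A2 y q" using PQ(2) unfolding 2(4) by blast
    have "s = rep \<Phi> x y (p, q)" by (simp add: s jrep_def x y)
    moreover have "(p, q) \<in> C1 x \<times> C2 y" using x y by blast
    ultimately show "s \<in> ?V" using x(1) y(1) by blast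
  qed
  obtain P Q where "r2 P = 1" "s2 Q = 1" using M1.unit_vector_exists M2.unit_vector_exists by metis
  then have ne: "?V \<noteq> {}" unfolding V by blast
  obtain s where "s \<in> ?V" and max: "\<forall>t\<in>?V. t \<le> s" using compact_attains_sup[OF cV ne] by (elim bexE)
  then obtain P0 Q0 where PQ0: "r2 P0 = 1" "s2 Q0 = 1" and s: "s = \<Phi> P0 Q0" unfolding V by (elim CollectE exE conjE)
  have "\<Phi> P Q \<le> \<Phi> P0 Q0" if "r2 P = 1" "s2 Q = 1" for P Q
    using max that unfolding V s by blast
  with PQ0 show ?thesis by (intro exI conjI allI impI)
qed

text \<open>Along the two geodesic flows, \<open>c + 2im\<close> satisfies the Cauchy-Riemann equations on the product of the
  unit tangent bundles, so that \<open>c\<close> is harmonic for \<open>F1\<^sup>2 + F2\<^sup>2\<close>, and \<open>w = u\<^sup>2 + v\<^sup>2\<close>, which is the squared gradient of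
  \<open>c\<close>, is subharmonic. As in Bernstein's proof of the Liouville theorem, consider \<open>w + a c\<^sup>2\<close> for small \<open>a > 0\<close>.
  It is subharmonic, with Laplacian at least \<open>2 a w\<close>; this cannot be positive at a
  maximum, hence \<open>w = 0\<close> there, so that \<open>w \<le> a max c\<^sup>2\<close> everywhere.
  To avoid the constraint \<open>r2 = s2 = 1\<close> the functions are made homogeneous of the same degree.\<close>

lemma cauchy_riemann_zero_unit:
  assumes comp: "compact (UNIV :: 'a set)" "compact (UNIV :: 'b set)"
    and c: "smooth c" and m: "smooth m"
    and F1c: "\<And>P Q. F1 c P Q = 2 * (r2 P * F2 m P Q)" and F2c: "\<And>P Q. F2 c P Q = - 2 * (s2 Q * F1 m P Q)"
    and hc1: "\<And>x v t Q. c (x, t *\<^sub>R v) Q = t\<^sup>2 * c (x, v) Q" and hc2: "\<And>P y w t. c P (y, t *\<^sub>R w) = t\<^sup>2 * c P (y, w)"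
    and hm1: "\<And>x v t Q. m (x, t *\<^sub>R v) Q = t * m (x, v) Q" and hm2: "\<And>P y w t. m P (y, t *\<^sub>R w) = t * m P (y, w)"
    and P: "r2 P = 1" and Q: "s2 Q = 1"
  shows "F1 m P Q = 0" "F2 m P Q = 0"
proof -
  define u where "u = (\<lambda>P Q. 2 * F2 m P Q)"
  define v where "v = (\<lambda>P Q. 2 * F1 m P Q)"
  have u: "smooth u" and v: "smooth v" unfolding u_def v_def by (intro smooth_intros m)+
  have F1c: "F1 c = (\<lambda>P Q. r2 P * u P Q)" and F2c: "F2 c = (\<lambda>P Q. - (s2 Q * v P Q))"
    by (intro ext, simp only: F1c u_def mult.left_commute) (intro ext, simp add: F2c v_def)
  note rules = F_mult F_add F_diff F_minus F_const F_r2 F_s2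
  note sm = smooth_intros u v c m
  have F1u: "F1 u = F2 v"
    unfolding u_def v_def by (intro ext) (simp add: rules sm F1_F2_commute[OF m])
  have F2u: "(\<lambda>P Q. r2 P * F2 u P Q) = (\<lambda>P Q. - (s2 Q * F1 v P Q))"
  proof (intro ext)
    fix P Q
    show "r2 P * F2 u P Q = - (s2 Q * F1 v P Q)"
      using F1_F2_commute[OF c, of P Q] unfolding F1c F2c by (simp add: rules sm)
  qed
  have harm_u: "r2 P * F2 (F2 u) P Q = - (s2 Q * F1 (F1 u) P Q)" for P Q
  proof -
    have "r2 P * F2 (F2 u) P Q = F2 (\<lambda>P Q. r2 P * F2 u P Q) P Q" by (simp add: rules sm)
    also have "\<dots> = - (s2 Q * F2 (F1 v) P Q)" unfolding F2u by (simp add: rules sm)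
    finally show ?thesis unfolding F1_F2_commute[OF v, symmetric] F1u .
  qed
  have harm_v: "s2 Q * F1 (F1 v) P Q = - (r2 P * F2 (F2 v) P Q)" for P Q
  proof -
    have "- (s2 Q * F1 (F1 v) P Q) = F1 (\<lambda>P Q. - (s2 Q * F1 v P Q)) P Q" by (simp add: rules sm)
    also have "\<dots> = r2 P * F1 (F2 u) P Q" unfolding F2u[symmetric] by (simp add: rules sm)
    finally show ?thesis unfolding F1_F2_commute[OF u] F1u by simp
  qed
  have hu1: "u (x, t *\<^sub>R v) Q = t * u (x, v) Q" for x t v Q
    using M2.geo_cmult[OF smooth_slice2[OF m], of t "(x, v)" Q] by (simp add: u_def geo2_def hm1[abs_def])
  have hv2: "v P (y, t *\<^sub>R w) = t * v P (y, w)" for P y t w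
    using M1.geo_cmult[OF smooth_slice1[OF m], of t "(y, w)" P] by (simp add: v_def geo1_def hm2)
  have hv1: "v (x, t *\<^sub>R w) Q = t\<^sup>2 * v (x, w) Q" for x t w Q
    using M1.geo_scale[OF smooth_slice1[OF m], of t Q x w] M1.geo_cmult[OF smooth_slice1[OF m], of t Q "(x, w)"]
    by (simp add: v_def geo1_def hm1 power2_eq_square mult.commute mult.left_commute)
  have hu2: "u P (y, t *\<^sub>R w) = t\<^sup>2 * u P (y, w)" for P y t w
    using M2.geo_scale[OF smooth_slice2[OF m], of P t y w] M2.geo_cmult[OF smooth_slice2[OF m], of t P "(y, w)"]
    by (simp add: u_def geo2_def hm2 power2_eq_square mult.commute mult.left_commute)
  obtain B where B: "\<And>P Q. r2 P = 1 \<Longrightarrow> s2 Q = 1 \<Longrightarrow> c P Q * c P Q \<le> B"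
    using unit_max[OF comp smooth_mult[OF c c]] by blast
  have bound: "u P Q * u P Q + v P Q * v P Q \<le> a * B" if a: "a > 0" for a
  proof -
    have "smooth (\<lambda>P Q. u P Q * u P Q + v P Q * v P Q + a * (c P Q * c P Q))" by (intro sm)
    from unit_max[OF comp this] obtain P0 Q0 where PQ0: "r2 P0 = 1" "s2 Q0 = 1"
      and max: "\<And>P Q. r2 P = 1 \<Longrightarrow> s2 Q = 1 \<Longrightarrow> u P Q * u P Q + v P Q * v P Q + a * (c P Q * c P Q) \<le>
        u P0 Q0 * u P0 Q0 + v P0 Q0 * v P0 Q0 + a * (c P0 Q0 * c P0 Q0)" by blast
    define \<mu> where "\<mu> = u P0 Q0 * u P0 Q0 + v P0 Q0 * v P0 Q0 + a * (c P0 Q0 * c P0 Q0)"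
    define \<phi> where "\<phi> = (\<lambda>P Q. r2 P * (u P Q * u P Q) + s2 Q * (v P Q * v P Q) + a * (c P Q * c P Q) - \<mu> * ((r2 P * r2 P) * (s2 Q * s2 Q)))"
    have \<phi>: "smooth \<phi>" unfolding \<phi>_def by (intro sm)
    have hom: "\<phi> (x, t *\<^sub>R p) (y, s *\<^sub>R q) = t ^ 4 * s ^ 4 * \<phi> (x, p) (y, q)" for x t p y s q
      unfolding \<phi>_def hu1 hu2 hv1 hv2 hc1 hc2 M1.metric_scale M2.metric_scale
      by (simp add: algebra_simps power2_eq_square power4_eq_xxxx)
    have le0: "\<phi> P Q \<le> 0" for P Q
    proof -
      obtain x p y q where xy: "P = (x, p)" "Q = (y, q)" by (metis surj_pair)
      obtain p' t where p': "r2 (x, p') = 1" "p = t *\<^sub>R p'" using M1.unit_vector_exists by blast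
      obtain q' s where q': "s2 (y, q') = 1" "q = s *\<^sub>R q'" using M2.unit_vector_exists by blast
      have "\<phi> (x, p') (y, q') \<le> 0" using max[OF p'(1) q'(1)] by (simp add: \<phi>_def p'(1) q'(1) \<mu>_def)
      then show ?thesis unfolding xy p'(2) q'(2) hom by (simp add: mult_nonneg_nonpos)
    qed
    have \<phi>0: "\<phi> P0 Q0 = 0" by (simp add: \<phi>_def PQ0 \<mu>_def)
    have "F1 (F1 \<phi>) P0 Q0 \<le> 0"
      using M1.geo_geo_nonpos_at_max[OF smooth_slice1[OF \<phi>], of Q0 P0] le0 \<phi>0 by (simp add: geo1_def[abs_def])
    moreover have "F2 (F2 \<phi>) P0 Q0 \<le> 0"
      using M2.geo_geo_nonpos_at_max[OF smooth_slice2[OF \<phi>], of P0 Q0] le0 \<phi>0 by (simp add: geo2_def[abs_def])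
    moreover have "F1 \<phi> = (\<lambda>P Q. 2 * (r2 P * (u P Q * F1 u P Q) + s2 Q * (v P Q * F1 v P Q) + a * (c P Q * F1 c P Q)))"
      unfolding \<phi>_def by (intro ext) (simp add: rules sm algebra_simps)
    then have "F1 (F1 \<phi>) P0 Q0 = 2 * ((F1 u P0 Q0 * F1 u P0 Q0 + u P0 Q0 * F1 (F1 u) P0 Q0)
        + (F1 v P0 Q0 * F1 v P0 Q0 + v P0 Q0 * F1 (F1 v) P0 Q0) + a * (F1 c P0 Q0 * F1 c P0 Q0 + c P0 Q0 * F1 (F1 c) P0 Q0))"
      by (simp add: rules sm PQ0)
    moreover have "F2 \<phi> = (\<lambda>P Q. 2 * (r2 P * (u P Q * F2 u P Q) + s2 Q * (v P Q * F2 v P Q) + a * (c P Q * F2 c P Q)))"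
      unfolding \<phi>_def by (intro ext) (simp add: rules sm algebra_simps)
    then have "F2 (F2 \<phi>) P0 Q0 = 2 * ((F2 u P0 Q0 * F2 u P0 Q0 + u P0 Q0 * F2 (F2 u) P0 Q0)
        + (F2 v P0 Q0 * F2 v P0 Q0 + v P0 Q0 * F2 (F2 v) P0 Q0) + a * (F2 c P0 Q0 * F2 c P0 Q0 + c P0 Q0 * F2 (F2 c) P0 Q0))"
      by (simp add: rules sm PQ0)
    moreover have "F2 (F2 u) P0 Q0 = - F1 (F1 u) P0 Q0" "F2 (F2 v) P0 Q0 = - F1 (F1 v) P0 Q0"
      using harm_u[of P0 Q0] harm_v[of Q0 P0] PQ0 by simp_all
    moreover have "F2 (F2 c) P0 Q0 = - F1 (F1 c) P0 Q0"
      unfolding F1c F2c using fun_cong[OF fun_cong[OF F1u]] by (simp add: rules sm PQ0)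
    moreover have "F1 c P0 Q0 = u P0 Q0" "F2 c P0 Q0 = - v P0 Q0" by (simp_all add: F1c F2c PQ0)
    ultimately have "a * (u P0 Q0 * u P0 Q0 + v P0 Q0 * v P0 Q0) + (F1 u P0 Q0 * F1 u P0 Q0 + F1 v P0 Q0 * F1 v P0 Q0
        + F2 u P0 Q0 * F2 u P0 Q0 + F2 v P0 Q0 * F2 v P0 Q0) \<le> 0"
      by (simp add: algebra_simps)
    then have "a * (u P0 Q0 * u P0 Q0 + v P0 Q0 * v P0 Q0) \<le> 0"
      using zero_le_square[of "F1 u P0 Q0"] zero_le_square[of "F1 v P0 Q0"]
        zero_le_square[of "F2 u P0 Q0"] zero_le_square[of "F2 v P0 Q0"] by linarith
    then have "u P0 Q0 * u P0 Q0 + v P0 Q0 * v P0 Q0 \<le> 0" using a by (simp add: mult_le_0_iff)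
    then have "u P Q * u P Q + v P Q * v P Q + a * (c P Q * c P Q) \<le> a * (c P0 Q0 * c P0 Q0)"
      using max[OF P Q] by linarith
    also have "\<dots> \<le> a * B" using B[OF PQ0] a by simp
    finally show ?thesis using a zero_le_square[of "c P Q"] by (smt (verit) mult_nonneg_nonneg)
  qed
  have "u P Q * u P Q + v P Q * v P Q \<le> 0 + e" if "e > 0" for e
  proof -
    have "B \<ge> 0" using B[OF P Q] zero_le_square order_trans by blast
    then have "e / (B + 1) * B \<le> e" using that by (simp add: field_simps)
    then show ?thesis using bound[of "e / (B + 1)"] that \<open>B \<ge> 0\<close> by simp
  qed
  then have "u P Q * u P Q + v P Q * v P Q \<le> 0" using field_le_epsilon by blast
  then have "u P Q = 0 \<and> v P Q = 0" using sum_squares_le_zero_iff by blast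
  then show "F1 m P Q = 0" "F2 m P Q = 0" by (auto simp: u_def v_def)
qed

text \<open>Both derivatives of \<open>m\<close> are homogeneous in each of the two vectors, so that unit vectors suffice.\<close>

lemma cauchy_riemann_zero:
  assumes "compact (UNIV :: 'a set)" "compact (UNIV :: 'b set)"
    and c: "smooth c" and m: "smooth m"
    and "\<And>P Q. F1 c P Q = 2 * (r2 P * F2 m P Q)" and "\<And>P Q. F2 c P Q = - 2 * (s2 Q * F1 m P Q)"
    and "\<And>x v t Q. c (x, t *\<^sub>R v) Q = t\<^sup>2 * c (x, v) Q" and "\<And>P y w t. c P (y, t *\<^sub>R w) = t\<^sup>2 * c P (y, w)"
    and hm1: "\<And>x v t Q. m (x, t *\<^sub>R v) Q = t * m (x, v) Q" and hm2: "\<And>P y w t. m P (y, t *\<^sub>R w) = t * m P (y, w)"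
  shows "F1 m P Q = 0" "F2 m P Q = 0"
proof -
  obtain x p y q where xy: "P = (x, p)" "Q = (y, q)" by (metis surj_pair)
  obtain p' t where p': "r2 (x, p') = 1" "p = t *\<^sub>R p'" using M1.unit_vector_exists by blast
  obtain q' s where q': "s2 (y, q') = 1" "q = s *\<^sub>R q'" using M2.unit_vector_exists by blast
  have 0: "F1 m (x, p') (y, q') = 0" "F2 m (x, p') (y, q') = 0"
    by (rule cauchy_riemann_zero_unit[OF assms p'(1) q'(1)])+
  have "F1 m (x, t *\<^sub>R p') (y, s *\<^sub>R q') = geo A1 g1 (\<lambda>P. s * (t * m P (y, q'))) (x, p') * t"
    using M1.geo_scale[OF smooth_slice1[OF m], of t "(y, s *\<^sub>R q')" x p'] by (simp add: geo1_def hm1 hm2 mult.left_commute)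
  also have "\<dots> = 0"
    using 0(1) M1.geo_cmult[OF smooth_slice1[OF m], of "s * t" "(y, q')" "(x, p')"] by (simp add: geo1_def mult.assoc)
  finally show "F1 m P Q = 0" by (simp add: xy p' q')
  have "F2 m (x, t *\<^sub>R p') (y, s *\<^sub>R q') = geo A2 g2 (\<lambda>Q. s * (t * m (x, p') Q)) (y, q') * s"
    using M2.geo_scale[OF smooth_slice2[OF m], of "(x, t *\<^sub>R p')" s y q'] by (simp add: geo2_def hm1 hm2)
  also have "\<dots> = 0"
    using 0(2) M2.geo_cmult[OF smooth_slice2[OF m], of "s * t" "(x, p')" "(y, q')"] by (simp add: geo2_def mult.assoc)
  finally show "F2 m P Q = 0" by (simp add: xy p' q')
qed

end

section \<open>Functions on the base\<close>

context riem
begin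

lemma tsmooth_base_iff:
  "tsmooth A (\<lambda>P. f (fst P)) \<longleftrightarrow> (\<forall>x. smooth_on (chart_img A x) (\<lambda>z. f (chart_inv A x z)))" (is "?L \<longleftrightarrow> ?R")
proof
  assume ?L
  show ?R
  proof
    fix x
    have o: "open (chart_img A x)" by (rule atlas_chart(2)[OF atlas])
    have "smooth_on (chart_img A x) (\<lambda>z. f (fst (tlift A x (z, 0))))"
      by (rule smooth_on_compose[OF o _ tsmooth_D[OF \<open>?L\<close>]]) (auto intro!: smooth_on_Pair smooth_on_id smooth_on_const o)
    then show "smooth_on (chart_img A x) (\<lambda>z. f (chart_inv A x z))" by (simp add: tlift_def)
  qed
next
  assume R: ?R
  show ?L unfolding tsmooth_def
  proof
    fix x
    have "smooth_on (chart_img A x \<times> (UNIV :: 'e set)) (\<lambda>p. f (chart_inv A x (fst p)))"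
      by (rule smooth_on_compose[OF open_TM smooth_on_fst[OF open_TM smooth_on_id[OF open_TM]] R[rule_format, of x]]) auto
    then show "smooth_on (chart_img A x \<times> UNIV) (\<lambda>p. f (fst (tlift A x p)))" by (simp add: tlift_def)
  qed
qed

lemma geo_base:
  assumes f: "tsmooth A (\<lambda>P. f (fst P))" and z: "z \<in> chart_img A x"
  shows "geo A g (\<lambda>P. f (fst P)) (tlift A x (z, v)) = frechet_derivative (\<lambda>z. f (chart_inv A x z)) (at z) v"
proof -
  have "smooth_on (chart_img A x) (\<lambda>z. f (chart_inv A x z))" using f tsmooth_base_iff by blast
  from smooth_on_has_derivative[OF this z]
  have "((\<lambda>z. f (chart_inv A x z)) has_derivative frechet_derivative (\<lambda>z. f (chart_inv A x z)) (at z)) (at (fst (z, v)))" by simp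
  from has_derivative_compose[OF fst_snd_has_derivative(1) this]
  have "((\<lambda>p. f (fst (tlift A x p))) has_derivative (\<lambda>k. frechet_derivative (\<lambda>z. f (chart_inv A x z)) (at z) (fst k))) (at (z, v))"
    by (simp add: tlift_def)
  then show ?thesis
    using geo_tlift[OF f, of "(z, v)" x] z by (simp add: frechet_derivative_at[symmetric] spray_def)
qed

lemma eventually_at_open: "open W \<Longrightarrow> x \<in> W \<Longrightarrow> (\<And>q. q \<in> W \<Longrightarrow> R q) \<Longrightarrow> \<forall>\<^sub>F q in at x within UNIV. R q"
  unfolding eventually_at_topological by blast

text \<open>In each chart the derivative vanishes, so that the function is locally constant.\<close>

lemma base_constant:
  assumes conn: "connected (UNIV :: 'a set)" and f: "tsmooth A (\<lambda>P. f (fst P))"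
    and 0: "\<And>P. geo A g (\<lambda>P. f (fst P)) P = 0"
  shows "f x = f y"
proof (rule connected_local_const[OF conn UNIV_I UNIV_I], rule ballI)
  fix x
  obtain e where e: "e > 0" "cball (chart_center A x) e \<subseteq> chart_img A x" using chart_ball by blast
  let ?B = "ball (chart_center A x) e"
  have B: "?B \<subseteq> chart_img A x" using e(2) by auto
  have const: "f (chart_inv A x z) = f (chart_inv A x (chart_center A x))" if z: "z \<in> ?B" for z
  proof (rule has_derivative_zero_unique[of ?B "\<lambda>z. f (chart_inv A x z)"])
    fix z' assume "z' \<in> ?B"
    then have z': "z' \<in> chart_img A x" using B by blast
    have "smooth_on (chart_img A x) (\<lambda>z. f (chart_inv A x z))" using f tsmooth_base_iff by blast
    from smooth_on_has_derivative[OF this z']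
    have "((\<lambda>z. f (chart_inv A x z)) has_derivative frechet_derivative (\<lambda>z. f (chart_inv A x z)) (at z')) (at z')" .
    moreover have "frechet_derivative (\<lambda>z. f (chart_inv A x z)) (at z') = (\<lambda>v. 0)"
      using geo_base[OF f z'] 0 by (intro ext) metis
    ultimately show "((\<lambda>z. f (chart_inv A x z)) has_derivative (\<lambda>v. 0)) (at z' within ?B)"
      using has_derivative_at_withinI by metis
  qed (use e z in auto)
  have "open ?B" "chart_center A x \<in> ?B" using e(1) by auto
  from chart_neighbourhood[OF this] show "\<forall>\<^sub>F q in at x within UNIV. f x = f q"
  proof (rule eventually_at_open)
    fix q assume "q \<in> {q \<in> chart_dom A x. chart_map A x q \<in> ?B}"
    then show "f x = f q"
      using const[of "chart_map A x q"] atlas_chart(10)[OF atlas] atlas_chart(1)[OF atlas, of x] by simp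
  qed
qed

section \<open>Killing forms\<close>

text \<open>A one-form is treated as a fibrewise linear function on the tangent bundle. It is a Killing form iff
  it is constant along the geodesic flow.\<close>

definition killing_form :: "('a \<times> 'e \<Rightarrow> real) \<Rightarrow> bool" where
  "killing_form \<psi> \<longleftrightarrow> tsmooth A \<psi> \<and> (\<forall>x. linear (\<lambda>v. \<psi> (x, v))) \<and> (\<forall>P. geo A g \<psi> P = 0)"

lemma killing_form_combination:
  assumes "killing_form \<phi>" "killing_form \<psi>"
  shows "killing_form (\<lambda>P. a * \<phi> P + b * \<psi> P)"
proof -
  have sm: "tsmooth A (\<lambda>P. a * \<phi> P)" "tsmooth A (\<lambda>P. b * \<psi> P)"
    using assms by (auto simp: killing_form_def intro!: tsmooth_mult tsmooth_const)
  have "linear (\<lambda>v. a * \<phi> (x, v) + b * \<psi> (x, v))" for x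
  proof -
    have l: "linear (\<lambda>v. \<phi> (x, v))" "linear (\<lambda>v. \<psi> (x, v))" using assms by (auto simp: killing_form_def)
    show ?thesis
      by (rule linearI) (simp_all add: linear_add[OF l(1)] linear_add[OF l(2)] linear_scale[OF l(1)] linear_scale[OF l(2)] algebra_simps)
  qed
  then show ?thesis using assms sm by (auto simp: killing_form_def geo_add geo_cmult tsmooth_add)
qed

text \<open>The last statement is the polarisation of \<open>geo A g \<psi> = 0\<close>.\<close>

lemma killing_form_chart:
  assumes \<psi>: "killing_form \<psi>"
  defines "\<theta> x z v \<equiv> \<psi> (tlift A x (z, v))"
  shows "smooth_on (chart_img A x) (\<lambda>z. \<theta> x z v)"
    and "z \<in> chart_img A x \<Longrightarrow> linear (\<theta> x z)"
    and "z \<in> chart_img A x \<Longrightarrow> frechet_derivative (\<lambda>z. \<theta> x z v) (at z) u + frechet_derivative (\<lambda>z. \<theta> x z u) (at z) v =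
      2 * \<theta> x z (chart_christoffel A g x z u v)"
proof -
  note o = atlas_chart(2)[OF atlas, of x]
  have ts: "tsmooth A \<psi>" using \<psi> by (simp add: killing_form_def)
  show sm: "smooth_on (chart_img A x) (\<lambda>z. \<theta> x z v)" for v
    unfolding \<theta>_def
    by (rule smooth_on_compose[OF o _ tsmooth_D[OF ts]]) (auto intro!: smooth_on_Pair smooth_on_id smooth_on_const o)
  show lin: "linear (\<theta> x z)" if "z \<in> chart_img A x" for z
    using linear_compose[OF tangent_iso_linear[OF atlas that], of "\<lambda>v. \<psi> (chart_inv A x z, v)"] \<psi>
    by (simp add: \<theta>_def[abs_def] tlift_def killing_form_def comp_def)
  assume z: "z \<in> chart_img A x"
  let ?D = "\<lambda>u v. frechet_derivative (\<lambda>z. \<theta> x z v) (at z) u"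
  let ?\<Gamma> = "chart_christoffel A g x z"
  have diag: "?D v v = \<theta> x z (?\<Gamma> v v)" for v
  proof -
    have p: "(z, v) \<in> chart_img A x \<times> UNIV" using z by simp
    have d: "((\<lambda>s. \<theta> x (fst s) u) has_derivative (\<lambda>k. ?D (fst k) u)) (at (z, v))" for u
      by (rule has_derivative_compose[of fst fst "(z, v)" UNIV "\<lambda>z. \<theta> x z u", OF fst_snd_has_derivative(1)])
        (use smooth_on_has_derivative[OF sm z] in simp)
    have "((\<lambda>s. \<theta> x (fst s) (snd s)) has_derivative (\<lambda>k. ?D (fst k) (snd (z, v)) + \<theta> x (fst (z, v)) (snd k))) (at (z, v))"
      by (rule has_derivative_linear_eval[where \<theta> = "\<lambda>s. \<theta> x (fst s)", OF open_TM p _ d fst_snd_has_derivative(2)])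
        (use lin in auto)
    then have "frechet_derivative (\<lambda>p. \<psi> (tlift A x p)) (at (z, v)) (spray A g x (z, v)) = ?D v v + \<theta> x z (- ?\<Gamma> v v)"
      by (simp add: \<theta>_def frechet_derivative_at[symmetric] spray_def)
    moreover have "geo A g \<psi> (tlift A x (z, v)) = 0" using \<psi> unfolding killing_form_def by blast
    ultimately show ?thesis
      using geo_tlift[OF ts, of "(z, v)" x] z linear_neg[OF lin[OF z]] by simp
  qed
  have l: "linear (\<lambda>u. ?D u v)" "linear (\<lambda>v. ?D u v)" for u v
    using has_derivative_linear[OF smooth_on_has_derivative[OF sm z]] linear_deriv_of_smooth_family[OF o z sm lin] by auto
  note b = chart_christoffel_bilinear[OF z]
  have "?D (u + v) (u + v) = \<theta> x z (?\<Gamma> (u + v) (u + v))" by (rule diag)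
  then have "?D u u + ?D u v + (?D v u + ?D v v) = \<theta> x z (?\<Gamma> u u) + \<theta> x z (?\<Gamma> u v) + (\<theta> x z (?\<Gamma> v u) + \<theta> x z (?\<Gamma> v v))"
    by (simp add: linear_add[OF l(1)] linear_add[OF l(2)] bilinear_ladd[OF b] bilinear_radd[OF b] linear_add[OF lin[OF z]])
  then show "?D u v + ?D v u = 2 * \<theta> x z (?\<Gamma> u v)"
    using diag[of u] diag[of v] chart_christoffel_commute[OF z, of u v] by simp
qed

text \<open>The set of points near which the form vanishes is open by definition, and closed by unique continuation in
  charts.\<close>

lemma killing_form_zero:
  assumes conn: "connected (UNIV :: 'a set)" and \<psi>: "killing_form \<psi>"
    and 0: "\<And>b. b \<in> Basis \<Longrightarrow> \<psi> (x0, b) = 0"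
      "\<And>b c. b \<in> Basis \<Longrightarrow> c \<in> Basis \<Longrightarrow> frechet_derivative (\<lambda>z. \<psi> (tlift A x0 (z, c))) (at (chart_center A x0)) b = 0"
  shows "\<psi> P = 0"
proof -
  obtain e where e: "\<And>x. e x > 0" "\<And>x. cball (chart_center A x) (e x) \<subseteq> chart_img A x"
    using chart_ball by metis
  let ?B = "\<lambda>x. ball (chart_center A x) (e x)"
  have B: "?B x \<subseteq> chart_img A x" for x using e(2)[of x] by auto
  let ?W = "\<lambda>x. {q \<in> chart_dom A x. chart_map A x q \<in> ?B x}"
  have W: "open (?W x)" "x \<in> ?W x" for x using chart_neighbourhood[of "?B x" x] e(1)[of x] by auto
  have propagate: "\<psi> (q, v) = 0"
    if q: "q \<in> ?W x" and z1: "z1 \<in> ?B x" "\<And>b. b \<in> Basis \<Longrightarrow> \<psi> (tlift A x (z1, b)) = 0"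
      "\<And>b c. b \<in> Basis \<Longrightarrow> c \<in> Basis \<Longrightarrow> frechet_derivative (\<lambda>z. \<psi> (tlift A x (z, c))) (at z1) b = 0" for x z1 q v
  proof -
    have qW: "q \<in> chart_dom A x" "chart_map A x q \<in> ?B x" using q by auto
    obtain w where w: "(q, v) = tlift A x (chart_map A x q, w)" using tlift_surj[OF qW(1)] by blast
    have "\<psi> (tlift A x (chart_map A x q, w)) = 0"
    proof (rule killing_form_unique_continuation[where \<theta> = "\<lambda>z v. \<psi> (tlift A x (z, v))" and B = "?B x"
          and \<Gamma> = "chart_christoffel A g x" and ?z0.0 = z1])
      note sub = smooth_on_subset[OF open_ball B]
      show "smooth_on (?B x) (\<lambda>z. \<psi> (tlift A x (z, v)))" for v by (rule sub[OF killing_form_chart(1)[OF \<psi>]])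
      show "smooth_on (?B x) (\<lambda>z. chart_christoffel A g x z u v)" for u v by (rule sub[OF chart_christoffel_smooth])
      fix z assume "z \<in> ?B x"
      then have z: "z \<in> chart_img A x" using B by blast
      show "linear (\<lambda>v. \<psi> (tlift A x (z, v)))" by (rule killing_form_chart(2)[OF \<psi> z])
      show "frechet_derivative (\<lambda>z. \<psi> (tlift A x (z, v))) (at z) u + frechet_derivative (\<lambda>z. \<psi> (tlift A x (z, u))) (at z) v =
        2 * \<psi> (tlift A x (z, chart_christoffel A g x z u v))" for u v
        by (rule killing_form_chart(3)[OF \<psi> z])
    qed (use z1 qW in auto)
    then show ?thesis by (simp add: w)
  qed
  define S where "S = {x. \<exists>W. open W \<and> x \<in> W \<and> (\<forall>q\<in>W. \<forall>v. \<psi> (q, v) = 0)}"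
  have S_open: "\<exists>W. open W \<and> x \<in> W \<and> W \<subseteq> S" if "x \<in> S" for x using that unfolding S_def by blast
  have S_closed: "a \<in> S" if b: "b \<in> S" "b \<in> ?W a" for a b
  proof -
    obtain V where V: "open V" "b \<in> V" "\<And>q v. q \<in> V \<Longrightarrow> \<psi> (q, v) = 0" using b(1) unfolding S_def by blast
    let ?z = "chart_map A a b"
    let ?N = "chart_img A a \<inter> chart_inv A a -` V"
    have N: "open ?N" by (rule continuous_open_preimage[OF atlas_chart(5,2)[OF atlas] V(1)])
    have zN: "?z \<in> ?N" using b(2) V(2) atlas_chart(9,10)[OF atlas] by auto
    have zero: "\<psi> (tlift A a (z, c)) = 0" if "z \<in> ?N" for z c using V(3) that by (simp add: tlift_def)
    have "frechet_derivative (\<lambda>z. \<psi> (tlift A a (z, c))) (at ?z) = frechet_derivative (\<lambda>z. 0) (at ?z)" for c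
      by (rule frechet_derivative_cong[OF N zN zero])
    then have "\<psi> (q, v) = 0" if "q \<in> ?W a" for q v
      by (intro propagate[OF that, of ?z]) (use b(2) zero[OF zN] in \<open>auto simp: frechet_derivative_const\<close>)
    with W[of a] have "\<exists>V. open V \<and> a \<in> V \<and> (\<forall>q\<in>V. \<forall>v. \<psi> (q, v) = 0)"
      by (intro exI[of _ "?W a"] conjI ballI allI)
    then show "a \<in> S" unfolding S_def by (rule CollectI)
  qed
  have x0: "x0 \<in> S"
  proof -
    have "\<psi> (q, v) = 0" if "q \<in> ?W x0" for q v
      by (rule propagate[OF that, of "chart_center A x0"]) (use 0 e(1)[of x0] in \<open>auto simp: tlift_center[OF atlas]\<close>)
    with W[of x0] have "\<exists>V. open V \<and> x0 \<in> V \<and> (\<forall>q\<in>V. \<forall>v. \<psi> (q, v) = 0)"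
      by (intro exI[of _ "?W x0"] conjI ballI allI)
    then show ?thesis unfolding S_def by (rule CollectI)
  qed
  have "(x0 \<in> S) = (fst P \<in> S)"
  proof (rule connected_local_const[OF conn UNIV_I UNIV_I, of "\<lambda>x. x \<in> S"], rule ballI)
    fix a
    show "\<forall>\<^sub>F b in at a within UNIV. (a \<in> S) = (b \<in> S)"
    proof (cases "a \<in> S")
      case True
      obtain W' where "open W'" "a \<in> W'" "W' \<subseteq> S" using S_open[OF True] by blast
      then show ?thesis using True by (intro eventually_at_open[of W']) auto
    next
      case False
      then show ?thesis using S_closed W by (intro eventually_at_open[of "?W a"]) blast+
    qed
  qed
  with x0 have "fst P \<in> S" by simp
  then obtain V where "fst P \<in> V" and V: "\<And>q v. q \<in> V \<Longrightarrow> \<psi> (q, v) = 0" unfolding S_def by blast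
  then have "\<psi> (fst P, snd P) = 0" by blast
  then show ?thesis by simp
qed

end

text \<open>Subtracting \<open>m(\<cdot>, q\<^sub>0) m(p\<^sub>0, \<cdot>) / m(p\<^sub>0, q\<^sub>0)\<close> makes the sections in the first variable vanish at \<open>p\<^sub>0\<close>. The
  functionals \<open>L\<close>, which express that these sections span a space of finite dimension, are then combined into one
  less that still separate them.\<close>

lemma finite_rank_decomposition:
  fixes m :: "'p \<Rightarrow> 'q \<Rightarrow> real" and L :: "'i \<Rightarrow> ('p \<Rightarrow> real) \<Rightarrow> real"
  assumes "finite I" and V: "\<And>f h a b. f \<in> V \<Longrightarrow> h \<in> V \<Longrightarrow> (\<lambda>p. a * f p + b * h p) \<in> V"
    and W: "\<And>f h a b. f \<in> W \<Longrightarrow> h \<in> W \<Longrightarrow> (\<lambda>q. a * f q + b * h q) \<in> W"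
    and "\<And>i f h a b. i \<in> I \<Longrightarrow> f \<in> V \<Longrightarrow> h \<in> V \<Longrightarrow> L i (\<lambda>p. a * f p + b * h p) = a * L i f + b * L i h"
    and "\<And>f p. f \<in> V \<Longrightarrow> (\<And>i. i \<in> I \<Longrightarrow> L i f = 0) \<Longrightarrow> f p = 0"
    and "\<And>q. (\<lambda>p. m p q) \<in> V" and "\<And>p. m p \<in> W"
  shows "\<exists>(k::nat) \<xi> \<zeta>. (\<forall>i<k. \<xi> i \<in> V \<and> \<zeta> i \<in> W) \<and> (\<forall>p q. m p q = (\<Sum>i<k. \<xi> i p * \<zeta> i q))"
  using assms(1,2,4-7)
proof (induction "card I" arbitrary: I V L m rule: less_induct)
  case less
  note V = less.prems(2) and L = less.prems(3) and sep = less.prems(4) and mV = less.prems(5) and mW = less.prems(6)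
  show ?case
  proof (cases "\<forall>p q. m p q = 0")
    case True
    then show ?thesis by (intro exI[of _ 0]) simp
  next
    case False
    then obtain p0 q0 where m0: "m p0 q0 \<noteq> 0" by blast
    define f0 where "f0 = (\<lambda>p. m p q0)"
    have f0: "f0 \<in> V" "f0 p0 \<noteq> 0" using mV m0 by (auto simp: f0_def)
    then obtain i0 where i0: "i0 \<in> I" "L i0 f0 \<noteq> 0" using sep by blast
    define V' where "V' = {f \<in> V. f p0 = 0}"
    define L' where "L' i f = L i f - (L i f0 / L i0 f0) * L i0 f" for i f
    define m' where "m' p q = m p q - m p q0 * m p0 q / m p0 q0" for p q
    have "\<exists>(k::nat) \<xi> \<zeta>. (\<forall>i<k. \<xi> i \<in> V' \<and> \<zeta> i \<in> W) \<and> (\<forall>p q. m' p q = (\<Sum>i<k. \<xi> i p * \<zeta> i q))"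
    proof (rule less.hyps[of "I - {i0}" V' L' m'])
      show "card (I - {i0}) < card I" using less.prems(1) i0(1) by (rule card_Diff1_less)
      show "finite (I - {i0})" using less.prems(1) by simp
      show "(\<lambda>p. a * f p + b * h p) \<in> V'" if "f \<in> V'" "h \<in> V'" for f h a b
        using that V by (simp add: V'_def)
      show "L' i (\<lambda>p. a * f p + b * h p) = a * L' i f + b * L' i h" if "i \<in> I - {i0}" "f \<in> V'" "h \<in> V'" for i f h a b
        using that L[of i f h a b] L[of i0 f h a b] i0(1) by (simp add: V'_def L'_def algebra_simps)
      show "f p = 0" if f: "f \<in> V'" and 0: "\<And>i. i \<in> I - {i0} \<Longrightarrow> L' i f = 0" for f p
      proof -
        define c where "c = L i0 f / L i0 f0"
        have h: "(\<lambda>p. 1 * f p + (- c) * f0 p) \<in> V" using f f0(1) by (intro V) (auto simp: V'_def)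
        have "L i (\<lambda>p. 1 * f p + (- c) * f0 p) = 0" if i: "i \<in> I" for i
        proof -
          have "L i (\<lambda>p. 1 * f p + (- c) * f0 p) = L i f - c * L i f0"
            using L[OF i _ f0(1), of f 1 "- c"] f by (simp add: V'_def)
          also have "\<dots> = 0" using 0[of i] i i0(2) by (cases "i = i0") (auto simp: L'_def c_def field_simps)
          finally show ?thesis .
        qed
        from sep[OF h this] have eq: "f p = c * f0 p" for p by simp
        from this[of p0] have "c = 0" using f f0(2) by (simp add: V'_def)
        then show ?thesis using eq by simp
      qed
      show "(\<lambda>p. m' p q) \<in> V'" for q
      proof -
        have "(\<lambda>p. 1 * m p q + (- m p0 q / m p0 q0) * m p q0) \<in> V" by (intro V mV)
        moreover have "(\<lambda>p. 1 * m p q + (- m p0 q / m p0 q0) * m p q0) = (\<lambda>p. m' p q)"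
          by (simp add: m'_def fun_eq_iff)
        ultimately show ?thesis using m0 by (simp add: V'_def m'_def)
      qed
      show "m' p \<in> W" for p
      proof -
        have "(\<lambda>q. 1 * m p q + (- m p q0 / m p0 q0) * m p0 q) \<in> W" by (intro W mW)
        moreover have "(\<lambda>q. 1 * m p q + (- m p q0 / m p0 q0) * m p0 q) = m' p" by (simp add: m'_def fun_eq_iff)
        ultimately show ?thesis by simp
      qed
    qed
    then obtain k :: nat and \<xi> \<zeta> where k: "\<And>i. i < k \<Longrightarrow> \<xi> i \<in> V' \<and> \<zeta> i \<in> W" "\<And>p q. m' p q = (\<Sum>i<k. \<xi> i p * \<zeta> i q)" by blast
    have \<zeta>k: "(\<lambda>q. (1 / m p0 q0) * m p0 q + 0 * m p0 q) \<in> W" by (intro W mW)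
    let ?\<xi> = "\<xi>(k := f0)" and ?\<zeta> = "\<zeta>(k := (\<lambda>q. (1 / m p0 q0) * m p0 q + 0 * m p0 q))"
    have "\<forall>i<Suc k. ?\<xi> i \<in> V \<and> ?\<zeta> i \<in> W" using k(1) \<zeta>k f0(1) by (auto simp: less_Suc_eq V'_def)
    moreover have "m p q = (\<Sum>i<Suc k. ?\<xi> i p * ?\<zeta> i q)" for p q
      using k(2)[of p q] by (simp add: m'_def f0_def)
    ultimately show ?thesis by blast
  qed
qed

context riem
begin

text \<open>The values and first derivatives at one point are finitely many functionals that separate Killing forms.\<close>

lemma killing_forms_finite_rank:
  assumes conn: "connected (UNIV :: 'a set)"
    and W: "\<And>f h a b. f \<in> W \<Longrightarrow> h \<in> W \<Longrightarrow> (\<lambda>q. a * f q + b * h q) \<in> W"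
    and m: "\<And>Q. killing_form (\<lambda>P. m P Q)" "\<And>P. m P \<in> W"
  shows "\<exists>(k::nat) \<xi> \<zeta>. (\<forall>i<k. killing_form (\<xi> i) \<and> \<zeta> i \<in> W) \<and> (\<forall>P Q. m P Q = (\<Sum>i<k. \<xi> i P * \<zeta> i Q))"
proof -
  fix x0 :: 'a
  let ?I = "(Basis :: 'e set) <+> ((Basis :: 'e set) \<times> (Basis :: 'e set))"
  \<comment> \<open>the components of the 1-jet at \<open>x0\<close>\<close>
  define L where "L i \<psi> = (case i of Inl b \<Rightarrow> \<psi> (x0, b)
      | Inr (b, c) \<Rightarrow> frechet_derivative (\<lambda>z. \<psi> (tlift A x0 (z, c))) (at (chart_center A x0)) b)"
    for i :: "'e + 'e \<times> 'e" and \<psi> :: "'a \<times> 'e \<Rightarrow> real"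
  have "\<exists>(k::nat) \<xi> \<zeta>. (\<forall>i<k. \<xi> i \<in> Collect killing_form \<and> \<zeta> i \<in> W) \<and> (\<forall>P Q. m P Q = (\<Sum>i<k. \<xi> i P * \<zeta> i Q))"
  proof (rule finite_rank_decomposition[of ?I _ _ L])
    show "(\<lambda>P. a * f P + b * h P) \<in> Collect killing_form" if "f \<in> Collect killing_form" "h \<in> Collect killing_form" for f h a b
      using that killing_form_combination by simp
    show "L i (\<lambda>P. a * f P + b * h P) = a * L i f + b * L i h"
      if "i \<in> ?I" "f \<in> Collect killing_form" "h \<in> Collect killing_form" for i f h a b
    proof (cases i)
      case (Inr bc)
      obtain b' c where bc: "bc = (b', c)" by force
      note d = smooth_on_has_derivative[OF killing_form_chart(1) atlas_chart(3)[OF atlas]]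
      have "((\<lambda>z. a * f (tlift A x0 (z, c)) + b * h (tlift A x0 (z, c))) has_derivative
        (\<lambda>k. a * frechet_derivative (\<lambda>z. f (tlift A x0 (z, c))) (at (chart_center A x0)) k
           + b * frechet_derivative (\<lambda>z. h (tlift A x0 (z, c))) (at (chart_center A x0)) k)) (at (chart_center A x0))"
        by (intro has_derivative_add has_derivative_mult_right d) (use that in auto)
      from fun_cong[OF frechet_derivative_at[OF this], of b'] show ?thesis by (simp add: L_def Inr bc)
    qed (simp add: L_def)
    show "f P = 0" if "f \<in> Collect killing_form" "\<And>i. i \<in> ?I \<Longrightarrow> L i f = 0" for f P
      by (rule killing_form_zero[OF conn, of f x0]) (use that(1) that(2)[of "Inl _"] that(2)[of "Inr (_, _)"] in \<open>auto simp: L_def\<close>)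
  qed (use m W in auto)
  then show ?thesis by simp
qed

end

section \<open>Orthonormal bases and traces\<close>

lemma onb_expand:
  fixes G :: "'e::euclidean_space tensor"
  assumes G: "G \<in> sym_tensors 2" and E: "orthonormal_basis G E"
  shows "(\<Sum>e\<in>E. G [v, e] *\<^sub>R e) = v"
proof -
  note lin = sym_tensors_2D(2)[OF G]
  have fin: "finite E" and card: "card E = DIM('e)"
    and on: "\<And>u v. u \<in> E \<Longrightarrow> v \<in> E \<Longrightarrow> G [u, v] = (if u = v then 1 else 0)"
    using E unfolding orthonormal_basis_def by auto
  have coeff: "G [\<Sum>e\<in>E. c e *\<^sub>R e, e'] = c e'" if "e' \<in> E" for c e'
  proof -
    have "G [\<Sum>e\<in>E. c e *\<^sub>R e, e'] = (\<Sum>e\<in>E. c e * G [e, e'])"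
      by (simp add: linear_sum[OF lin] linear_scale[OF lin])
    also have "\<dots> = (\<Sum>e\<in>E. if e = e' then c e else 0)" by (rule sum.cong) (auto simp: on that)
    finally show ?thesis using fin that by simp
  qed
  have "independent E"
    unfolding independent_explicit
  proof (intro conjI fin allI impI ballI)
    fix c e assume "(\<Sum>v\<in>E. c v *\<^sub>R v) = 0" "e \<in> E"
    then show "c e = 0" using coeff[of e c] linear_0[OF lin] by simp
  qed
  then have "UNIV \<subseteq> span E" using card by (intro card_ge_dim_independent) auto
  then obtain c where v: "v = (\<Sum>e\<in>E. c e *\<^sub>R e)" unfolding span_finite[OF fin] by auto
  show ?thesis by (subst (2) v, rule sum.cong) (use coeff v in auto)
qed

lemma onb_expand_linear:
  fixes G :: "'e::euclidean_space tensor" and f :: "'e \<Rightarrow> real"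
  assumes "G \<in> sym_tensors 2" "orthonormal_basis G E" "linear f"
  shows "(\<Sum>e\<in>E. G [e, v] * f e) = f v"
proof -
  have "f v = f (\<Sum>e\<in>E. G [v, e] *\<^sub>R e)" by (simp add: onb_expand[OF assms(1,2)])
  also have "\<dots> = (\<Sum>e\<in>E. G [v, e] * f e)"
    by (simp add: linear_sum[OF assms(3)] linear_scale[OF assms(3)])
  finally show ?thesis by (simp add: sym_tensors_2D(1)[OF assms(1), of v])
qed

text \<open>Expand the vectors of one basis in the other one.\<close>

lemma trace_basis_independent:
  fixes G :: "'e::euclidean_space tensor"
  assumes G: "G \<in> sym_tensors 2" and E: "orthonormal_basis G E" "orthonormal_basis G E'" and B: "bilinear B"
  shows "(\<Sum>e\<in>E. B e e) = (\<Sum>e\<in>E'. B e e :: real)"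
proof -
  have l: "linear (B u)" "linear (\<lambda>u. B u v)" for u v using B by (auto simp: bilinear_def)
  have "(\<Sum>e\<in>E. B e e) = (\<Sum>e\<in>E. \<Sum>e'\<in>E'. G [e', e] * B e' e)"
    by (rule sum.cong[OF refl]) (rule onb_expand_linear[OF G E(2) l(2), symmetric])
  also have "\<dots> = (\<Sum>e'\<in>E'. \<Sum>e\<in>E. G [e', e] * B e' e)" by (rule sum.swap)
  also have "\<dots> = (\<Sum>e'\<in>E'. \<Sum>e\<in>E. G [e, e'] * B e' e)"
    by (intro sum.cong refl arg_cong2[where f = "(*)"] sym_tensors_2D(1)[OF G])
  also have "\<dots> = (\<Sum>e'\<in>E'. B e' e')"
    by (rule sum.cong[OF refl]) (rule onb_expand_linear[OF G E(1) l(1)])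
  finally show ?thesis .
qed

lemma Lambda_op_nil: "Lambda_op G S [] = (\<Sum>e\<in>onb G. S [e, e])"
  by (simp add: Lambda_op_def contract_def)

section \<open>The operators d and L on tensors of low degree\<close>

lemma sym_prod_flat_length:
  assumes B: "\<And>Ys. length Ys \<noteq> p \<Longrightarrow> B Ys = 0" and Xs: "length Xs \<noteq> Suc p"
  shows "(flat G v \<odot> B) Xs = 0"
  unfolding sym_prod_def
proof (rule sum.neutral, rule ballI)
  fix I :: "nat set"
  have "flat G v (nths Xs I) = 0 \<or> length (nths Xs I) = 1"
    by (auto simp: flat_def split: list.splits)
  moreover have "B (nths Xs (- I)) = 0" if "length (nths Xs I) = 1"
  proof -
    have "{i. i < length Xs} = {i. i < length Xs \<and> i \<in> I} \<union> {i. i < length Xs \<and> i \<in> - I}" by auto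
    moreover have "card ({i. i < length Xs \<and> i \<in> I} \<union> {i. i < length Xs \<and> i \<in> - I}) =
        card {i. i < length Xs \<and> i \<in> I} + card {i. i < length Xs \<and> i \<in> - I}"
      by (rule card_Un_disjoint) auto
    ultimately have "card {i. i < length Xs} = card {i. i < length Xs \<and> i \<in> I} + card {i. i < length Xs \<and> i \<in> - I}"
      by (simp only:)
    then have "length (nths Xs (- I)) = length Xs - 1" using that by (simp add: length_nths)
    then show ?thesis using Xs that B by (cases Xs) auto
  qed
  ultimately show "flat G v (nths Xs I) * B (nths Xs (- I)) = 0" by auto
qed

lemma sym_prod_eval:
  "(A \<odot> B) [] = A [] * B []"
  "(A \<odot> B) (X # Xs) = (contract X A \<odot> B) Xs + (A \<odot> contract X B) Xs"
  using contract_sym_prod[of X A B Xs] by (simp_all add: sym_prod_def contract_def)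

lemma sym_prod_flat_2: "(flat G v \<odot> B) [X, Y] = G [v, X] * B [Y] + G [v, Y] * B [X]"
  by (simp add: sym_prod_eval contract_def flat_def)

lemma sym_prod_flat_3:
  "(flat G v \<odot> B) [X, Y, Z] = G [v, X] * B [Y, Z] + G [v, Y] * B [X, Z] + G [v, Z] * B [X, Y]"
  by (simp add: sym_prod_eval contract_def flat_def)

text \<open>By polarisation: the cyclic sum is a symmetric trilinear form that vanishes on the diagonal.\<close>

lemma cyclic_sum_zero:
  fixes N :: "'e::real_vector \<Rightarrow> 'e \<Rightarrow> 'e \<Rightarrow> real"
  assumes l: "\<And>Y Z. linear (\<lambda>X. N X Y Z)" "\<And>X Z. linear (\<lambda>Y. N X Y Z)" and s: "\<And>X Y Z. N X Y Z = N X Z Y"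
    and 0: "\<And>X. N X X X = 0"
  shows "N X Y Z + N Y X Z + N Z X Y = 0"
proof -
  have a: "N (X + X') Y Z = N X Y Z + N X' Y Z" "N X (Y + Y') Z = N X Y Z + N X Y' Z" "N X Y (Z + Z') = N X Y Z + N X Y Z'" for X X' Y Y' Z Z'
    using linear_add[OF l(1)] linear_add[OF l(2)] s by metis+
  show ?thesis
    using 0[of "X + Y + Z"] 0[of "X + Y"] 0[of "X + Z"] 0[of "Y + Z"] 0[of X] 0[of Y] 0[of Z]
      s[of X Y Z] s[of Y X Z] s[of Z X Y] s[of X X Y] s[of X X Z] s[of Y Y X] s[of Y Y Z] s[of Z Z X] s[of Z Z Y]
    by (simp add: a)
qed

context riem
begin

lemma onb_metric: "orthonormal_basis (g x) (onb (g x))"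
  by (rule orthonormal_basis_onb[OF metric_sym metric_pos])

lemma L_op_3:
  assumes k: "k \<in> sym_tensors 1"
  shows "L_op (g x) k [X, Y, Z] = 2 * (g x [X, Y] * k [Z] + g x [X, Z] * k [Y] + g x [Y, Z] * k [X])"
proof -
  note e = onb_expand_linear[OF metric_sym onb_metric sym_tensors_2D(2)[OF metric_sym]]
  have "L_op (g x) k [X, Y, Z] = (\<Sum>e\<in>onb (g x). 2 * (g x [e, X] * g x [e, Y]) * k [Z] + 2 * (g x [e, X] * g x [e, Z]) * k [Y]
      + 2 * (g x [e, Y] * g x [e, Z]) * k [X])"
    unfolding L_op_def by (rule sum.cong[OF refl]) (simp add: sym_prod_flat_3 sym_prod_flat_2 algebra_simps)
  also have "\<dots> = 2 * g x [X, Y] * k [Z] + 2 * g x [X, Z] * k [Y] + 2 * g x [Y, Z] * k [X]"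
    by (simp add: sum.distrib sum_distrib_right[symmetric] sum_distrib_left[symmetric] e)
  finally show ?thesis by (simp add: algebra_simps)
qed

lemma L_op_length:
  assumes k: "k \<in> sym_tensors 1" and Xs: "length Xs \<noteq> 3"
  shows "L_op (g x) k Xs = 0"
  unfolding L_op_def
proof (rule sum.neutral, rule ballI)
  fix e
  have "(flat (g x) e \<odot> k) Ys = 0" if "length Ys \<noteq> 2" for Ys
    by (rule sym_prod_flat_length[OF sym_tensors_length[OF k]]) (use that in auto)
  then show "(flat (g x) e \<odot> flat (g x) e \<odot> k) Xs = 0"
    by (rule sym_prod_flat_length) (use Xs in auto)
qed

lemma christoffel_bilinear: "bilinear (christoffel A g x)"
  using chart_christoffel_bilinear[OF atlas_chart(3)[OF atlas]] by (simp add: christoffel_center[abs_def])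

lemma coord_deriv_linear:
  assumes K: "sym_tensor_field A p K" and Xs: "length Xs = p"
  shows "linear (\<lambda>v. coord_deriv A K x v Xs)"
  unfolding coord_deriv_def
  by (rule has_derivative_linear[OF smooth_on_has_derivative[OF sym_tensor_fieldD(2)[OF K Xs] atlas_chart(3)[OF atlas]]])

lemma coord_deriv_linear_slot:
  assumes K: "sym_tensor_field A p K" and Xs: "length Xs = p" "i < p"
  shows "linear (\<lambda>u. coord_deriv A K x v (Xs[i := u]))"
  unfolding coord_deriv_def
  by (rule linear_deriv_of_smooth_family[OF atlas_chart(2,3)[OF atlas]])
    (use sym_tensor_fieldD(2)[OF K] sym_tensors_linear[OF local_rep_sym_tensors[OF atlas K]] Xs in auto)

lemma nabla_length:
  assumes K: "sym_tensor_field A p K" and Xs: "length Xs \<noteq> p"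
  shows "nabla A g x v K Xs = 0"
proof -
  have "coord_deriv A K x v Xs = frechet_derivative (\<lambda>z. 0) (at (chart_center A x)) v"
    unfolding coord_deriv_def
    by (rule fun_cong[OF frechet_derivative_cong[OF atlas_chart(2,3)[OF atlas]]])
      (use sym_tensors_length[OF local_rep_sym_tensors[OF atlas K] Xs] in auto)
  then show ?thesis
    using sym_tensors_length[OF sym_tensor_fieldD(1)[OF K]] Xs by (simp add: nabla_def frechet_derivative_const)
qed

lemma nabla_linear_direction:
  assumes K: "sym_tensor_field A p K" and Xs: "length Xs = p"
  shows "linear (\<lambda>v. nabla A g x v K Xs)"
proof -
  have lc: "linear (\<lambda>v. christoffel A g x v w)" for w using christoffel_bilinear by (simp add: bilinear_def)
  have "linear (\<lambda>v. K x (Xs[j := christoffel A g x v (Xs ! j)]))" if "j < p" for j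
    using linear_compose[OF lc sym_tensors_linear[OF sym_tensor_fieldD(1)[OF K] Xs that]] by (simp add: comp_def)
  then have "linear (\<lambda>v. \<Sum>j<length Xs. K x (Xs[j := christoffel A g x v (Xs ! j)]))"
    using Xs by (intro linear_compose_sum ballI) auto
  then show ?thesis unfolding nabla_def by (intro linear_compose_sub coord_deriv_linear[OF K Xs])
qed

lemma nabla_1: "nabla A g x v K [X] = coord_deriv A K x v [X] - K x [christoffel A g x v X]"
  by (simp add: nabla_def)

lemma nabla_2: "nabla A g x v K [X, Y] = coord_deriv A K x v [X, Y] - K x [christoffel A g x v X, Y] - K x [X, christoffel A g x v Y]"
  by (simp add: nabla_def numeral_2_eq_2 lessThan_Suc)

lemma nabla_2_commute:
  assumes K: "sym_tensor_field A 2 K"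
  shows "nabla A g x v K [X, Y] = nabla A g x v K [Y, X]"
proof -
  have "coord_deriv A K x v [X, Y] = coord_deriv A K x v [Y, X]"
    unfolding coord_deriv_def
    by (rule fun_cong[OF frechet_derivative_cong[OF atlas_chart(2,3)[OF atlas]]])
      (use sym_tensors_2D(1)[OF local_rep_sym_tensors[OF atlas K]] in auto)
  then show ?thesis
    using sym_tensors_2D(1)[OF sym_tensor_fieldD(1)[OF K], of x "christoffel A g x v X" Y]
      sym_tensors_2D(1)[OF sym_tensor_fieldD(1)[OF K], of x "christoffel A g x v Y" X] by (simp add: nabla_2)
qed

lemma nabla_2_linear:
  assumes K: "sym_tensor_field A 2 K"
  shows "linear (\<lambda>X. nabla A g x v K [X, Y])"
proof -
  have l1: "linear (\<lambda>X. coord_deriv A K x v [X, Y])"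
    using coord_deriv_linear_slot[OF K, of "[Y, Y]" 0] by simp
  have lc: "linear (christoffel A g x v)" using christoffel_bilinear by (simp add: bilinear_def)
  note l2 = linear_compose[OF lc sym_tensors_2D(2)[OF sym_tensor_fieldD(1)[OF K]], unfolded comp_def]
  show ?thesis unfolding nabla_2
    by (intro linear_compose_sub l1 l2 sym_tensors_2D(2)[OF sym_tensor_fieldD(1)[OF K]])
qed

lemma nabla_1_linear:
  assumes K: "sym_tensor_field A 1 K"
  shows "linear (\<lambda>X. nabla A g x v K [X])"
proof -
  have l1: "linear (\<lambda>X. coord_deriv A K x v [X])"
    using coord_deriv_linear_slot[OF K, of "[undefined]" 0] by simp
  have lc: "linear (christoffel A g x v)" using christoffel_bilinear by (simp add: bilinear_def)
  note l2 = linear_compose[OF lc sym_tensors_1_linear[OF sym_tensor_fieldD(1)[OF K]], unfolded comp_def]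
  show ?thesis unfolding nabla_1 by (intro linear_compose_sub l1 l2)
qed

lemma d_op_length:
  assumes K: "sym_tensor_field A p K" and Xs: "length Xs \<noteq> Suc p"
  shows "d_op A g K x Xs = 0"
  unfolding d_op_def by (rule sum.neutral, rule ballI) (rule sym_prod_flat_length[OF nabla_length[OF K] Xs])

lemma d_op_2:
  assumes K: "sym_tensor_field A 1 K"
  shows "d_op A g K x [X, Y] = nabla A g x X K [Y] + nabla A g x Y K [X]"
  using onb_expand_linear[OF metric_sym onb_metric nabla_linear_direction[OF K]]
  by (simp add: d_op_def sym_prod_flat_2 sum.distrib)

lemma d_op_3:
  assumes K: "sym_tensor_field A 2 K"
  shows "d_op A g K x [X, Y, Z] = nabla A g x X K [Y, Z] + nabla A g x Y K [X, Z] + nabla A g x Z K [X, Y]"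
  using onb_expand_linear[OF metric_sym onb_metric nabla_linear_direction[OF K]]
  by (simp add: d_op_def sym_prod_flat_3 sum.distrib)

text \<open>On the diagonal, \<open>d K\<close> is a multiple of \<open>(\<nabla>\<^sub>v K)(v, \<dots>, v)\<close>; a symmetric form is determined by its diagonal.
  The same holds for degree two and for the conformal Killing equation.\<close>

lemma killing_tensor_1_iff:
  "killing_tensor A g 1 K \<longleftrightarrow> sym_tensor_field A 1 K \<and> (\<forall>P. geo A g (lin_fun K) P = 0)"
proof (cases "sym_tensor_field A 1 K")
  case K: True
  show ?thesis
  proof (intro iffI conjI K allI)
    fix P assume "killing_tensor A g 1 K"
    then have "d_op A g K (fst P) [snd P, snd P] = 0" by (simp add: killing_tensor_def)
    then show "geo A g (lin_fun K) P = 0" using geo_lin_fun[OF K, of "fst P" "snd P"] by (simp add: d_op_2[OF K])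
  next
    assume *: "sym_tensor_field A 1 K \<and> (\<forall>P. geo A g (lin_fun K) P = 0)"
    then have diag: "nabla A g x v K [v] = 0" for x v using geo_lin_fun[OF K] by metis
    have "d_op A g K x [X, Y] = 0" for x X Y
    proof -
      have "nabla A g x (X + Y) K [X + Y] = nabla A g x X K [X] + nabla A g x X K [Y] + (nabla A g x Y K [X] + nabla A g x Y K [Y])"
        using linear_add[OF nabla_linear_direction[OF K, of "[_]"]] linear_add[OF nabla_1_linear[OF K]] by simp
      then show ?thesis by (simp add: diag d_op_2[OF K])
    qed
    then have "d_op A g K x Xs = 0" for x Xs
      by (cases "length Xs = 2") (auto elim!: length_2_cases simp: d_op_length[OF K])
    then show "killing_tensor A g 1 K" using K by (simp add: killing_tensor_def)
  qed
qed (simp add: killing_tensor_def)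

lemma killing_tensor_2_iff:
  "killing_tensor A g 2 K \<longleftrightarrow> sym_tensor_field A 2 K \<and> (\<forall>P. geo A g (quad_fun K) P = 0)"
proof (cases "sym_tensor_field A 2 K")
  case K: True
  show ?thesis
  proof (intro iffI conjI K allI)
    fix P assume "killing_tensor A g 2 K"
    then have "d_op A g K (fst P) [snd P, snd P, snd P] = 0" by (simp add: killing_tensor_def)
    then show "geo A g (quad_fun K) P = 0" using geo_quad_fun[OF K, of "fst P" "snd P"] by (simp add: d_op_3[OF K])
  next
    assume *: "sym_tensor_field A 2 K \<and> (\<forall>P. geo A g (quad_fun K) P = 0)"
    have "d_op A g K x [X, Y, Z] = 0" for x X Y Z
      unfolding d_op_3[OF K]
      by (rule cyclic_sum_zero[where N = "\<lambda>X Y Z. nabla A g x X K [Y, Z]"])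
        (use * nabla_linear_direction[OF K] nabla_2_linear[OF K] nabla_2_commute[OF K] geo_quad_fun[OF K, symmetric] in auto)
    then have "d_op A g K x Xs = 0" for x Xs
      by (cases "length Xs = 3") (auto simp: d_op_length[OF K] length_Suc_conv numeral_3_eq_3)
    then show "killing_tensor A g 2 K" using K by (simp add: killing_tensor_def)
  qed
qed (simp add: killing_tensor_def)

lemma conformal_killing_iff:
  "conformal_killing_tensor A g 2 K \<longleftrightarrow> sym_tensor_field A 2 K \<and>
     (\<exists>k. sym_tensor_field A 1 k \<and> (\<forall>x X. nabla A g x X K [X, X] = 2 * g x [X, X] * k x [X]))"
proof (cases "sym_tensor_field A 2 K")
  case K: True
  have eq: "(\<forall>x. d_op A g K x = L_op (g x) (k x)) \<longleftrightarrow> (\<forall>x X. nabla A g x X K [X, X] = 2 * g x [X, X] * k x [X])" (is "?L \<longleftrightarrow> ?R")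
    if k: "sym_tensor_field A 1 k" for k
  proof
    assume ?L
    then have "d_op A g K x [X, X, X] = L_op (g x) (k x) [X, X, X]" for x X by metis
    then show ?R by (simp add: d_op_3[OF K] L_op_3[OF sym_tensor_fieldD(1)[OF k]])
  next
    assume R: ?R
    show ?L
    proof (intro allI ext)
      fix x Xs
      show "d_op A g K x Xs = L_op (g x) (k x) Xs"
      proof (cases "length Xs = 3")
        case True
        then obtain X Y Z where Xs: "Xs = [X, Y, Z]" by (auto simp: length_Suc_conv numeral_3_eq_3)
        let ?N = "\<lambda>X Y Z. nabla A g x X K [Y, Z] - 2 * g x [Y, Z] * k x [X]"
        note lk = sym_tensors_1_linear[OF sym_tensor_fieldD(1)[OF k]]
        note lg = sym_tensors_2D(2)[OF metric_sym]
        have "?N X Y Z + ?N Y X Z + ?N Z X Y = 0"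
        proof (rule cyclic_sum_zero[where N = ?N])
          show "linear (\<lambda>X. ?N X Y Z)" for Y Z
            by (intro linear_compose_sub nabla_linear_direction[OF K])
              (auto simp: linear_add[OF lk] linear_scale[OF lk] algebra_simps intro!: linearI)
          show "linear (\<lambda>Y. ?N X Y Z)" for X Z
            by (intro linear_compose_sub nabla_2_linear[OF K])
              (auto simp: linear_add[OF lg] linear_scale[OF lg] algebra_simps intro!: linearI)
          show "?N X Y Z = ?N X Z Y" for X Y Z
            using nabla_2_commute[OF K, of x X Y Z] sym_tensors_2D(1)[OF metric_sym, of x Y Z] by simp
          show "?N X X X = 0" for X using R by simp
        qed
        then show ?thesis by (simp add: Xs d_op_3[OF K] L_op_3[OF sym_tensor_fieldD(1)[OF k]] algebra_simps)
      qed (use d_op_length[OF K] L_op_length[OF sym_tensor_fieldD(1)[OF k]] in simp)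
    qed
  qed
  have deg: "2 - 1 = (1::nat)" by simp
  show ?thesis unfolding conformal_killing_tensor_def deg using K eq by blast
qed (simp add: conformal_killing_tensor_def)


text \<open>The trace is smooth: it is the trace of the endomorphism \<open>T\<close> with \<open>K(v, w) = g(T v, w)\<close>, which can be
  computed in the fixed basis of the model space.\<close>

lemma tsmooth_trace:
  assumes K: "sym_tensor_field A 2 K"
  shows "tsmooth A (\<lambda>P. \<Sum>e\<in>onb (g (fst P)). K (fst P) [e, e])"
  unfolding tsmooth_base_iff[of "\<lambda>x. \<Sum>e\<in>onb (g x). K x [e, e]"]
proof
  fix x
  note o = atlas_chart(2)[OF atlas, of x]
  define T where "T b z = (THE u. \<forall>w. gx x z u w = local_rep A K x z [b, w])" for b z
  have T: "gx x z (T b z) w = local_rep A K x z [b, w]" if z: "z \<in> chart_img A x" for b z w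
    using theI'[OF riesz_sym_tensor[OF gx_sym[OF z] gx_pos[OF z] sym_tensors_2D(3)[OF local_rep_sym_tensors[OF atlas K z], of b]]]
    by (simp add: T_def)
  have "smooth_on (chart_img A x) (T b)" for b
    by (rule solution_smooth[OF o gx_smooth gx_bilinear gx_pos sym_tensor_fieldD(2)[OF K] T]) auto
  then have "smooth_on (chart_img A x) (\<lambda>z. \<Sum>b\<in>Basis. T b z \<bullet> b)"
    by (intro smooth_on_sum smooth_on_inner smooth_on_const o)
  then show "smooth_on (chart_img A x) (\<lambda>z. \<Sum>e\<in>onb (g (chart_inv A x z)). K (chart_inv A x z) [e, e])"
  proof (rule smooth_on_cong[OF o, rotated])
    fix z assume z: "z \<in> chart_img A x"
    let ?J = "tangent_iso A x z" and ?G = "local_rep A g x z" and ?q = "chart_inv A x z"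
    let ?E = "onb ?G"
    have E: "orthonormal_basis ?G ?E" by (rule orthonormal_basis_onb[OF gx_sym[OF z] gx_pos[OF z]])
    have inj: "inj_on ?J ?E" using tangent_iso_bij[OF atlas z] by (metis bij_is_inj inj_on_subset subset_UNIV)
    have JE: "orthonormal_basis (g ?q) (?J ` ?E)"
      using E inj by (auto simp: orthonormal_basis_def card_image local_rep_tangent_iso inj_on_eq_iff)
    have "(\<Sum>b\<in>Basis. T b z \<bullet> b) = (\<Sum>b\<in>Basis. \<Sum>e\<in>?E. ?G [T b z, e] * (e \<bullet> b))"
      by (rule sum.cong[OF refl], subst (1) onb_expand[OF gx_sym[OF z] E, symmetric]) (simp add: inner_sum_left)
    also have "\<dots> = (\<Sum>e\<in>?E. \<Sum>b\<in>Basis. (e \<bullet> b) * local_rep A K x z [b, e])"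
      unfolding T[OF z] by (subst sum.swap) (simp add: mult.commute)
    also have "\<dots> = (\<Sum>e\<in>?E. local_rep A K x z [e, e])"
      by (rule sum.cong[OF refl], subst (2) linear_Basis_expand[OF sym_tensors_2D(2)[OF local_rep_sym_tensors[OF atlas K z]]]) simp
    also have "\<dots> = (\<Sum>e\<in>?J ` ?E. K ?q [e, e])"
      by (simp add: sum.reindex[OF inj] local_rep_tangent_iso)
    also have "\<dots> = (\<Sum>e\<in>onb (g ?q). K ?q [e, e])"
      by (rule trace_basis_independent[OF metric_sym JE onb_metric sym_tensors_2_bilinear[OF sym_tensor_fieldD(1)[OF K]]])
    finally show "(\<Sum>b\<in>Basis. T b z \<bullet> b) = (\<Sum>e\<in>onb (g ?q). K ?q [e, e])" .
  qed
qed

end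

section \<open>The product manifold\<close>

lemma sym_tensors_mset: "S \<in> sym_tensors p \<Longrightarrow> mset Xs = mset Ys \<Longrightarrow> S Xs = S Ys"
  unfolding sym_tensors_def by blast

lemma sym_tensors_add:
  assumes S: "S \<in> sym_tensors p" and T: "T \<in> sym_tensors p"
  shows "(\<lambda>Xs. S Xs + T Xs) \<in> sym_tensors p"
  unfolding sym_tensors_def
proof (intro CollectI conjI allI impI)
  show "S Xs + T Xs = 0" if "length Xs \<noteq> p" for Xs using sym_tensors_length[OF S that] sym_tensors_length[OF T that] by simp
  show "linear (\<lambda>v. S (Xs[i := v]) + T (Xs[i := v]))" if "length Xs = p" "i < p" for Xs i
    by (intro linear_compose_add sym_tensors_linear[OF S that] sym_tensors_linear[OF T that])
  show "S Xs + T Xs = S Ys + T Ys" if "mset Xs = mset Ys" for Xs Ys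
    using sym_tensors_mset[OF S that] sym_tensors_mset[OF T that] by simp
qed

lemma sym_tensors_scale:
  assumes S: "S \<in> sym_tensors p"
  shows "(\<lambda>Xs. c * S Xs) \<in> sym_tensors p"
  unfolding sym_tensors_def
proof (intro CollectI conjI allI impI)
  show "c * S Xs = 0" if "length Xs \<noteq> p" for Xs using sym_tensors_length[OF S that] by simp
  show "linear (\<lambda>v. c * S (Xs[i := v]))" if "length Xs = p" "i < p" for Xs i
    using linear_compose_scale_right[OF sym_tensors_linear[OF S that], of c] by simp
  show "c * S Xs = c * S Ys" if "mset Xs = mset Ys" for Xs Ys
    using sym_tensors_mset[OF S that] by simp
qed

lemma linear_fst: "linear fst" and linear_snd: "linear snd"
  by (auto intro: linearI)

context riem_pair
begin

abbreviation "AM \<equiv> product_atlas A1 A2"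
abbreviation "gM \<equiv> product_metric g1 g2"

lemma product_chart:
  "chart_dom AM (x, y) = chart_dom A1 x \<times> chart_dom A2 y"
  "chart_map AM (x, y) z = (chart_map A1 x (fst z), chart_map A2 y (snd z))"
  "chart_img AM (x, y) = chart_img A1 x \<times> chart_img A2 y"
  by (auto simp: product_atlas_def chart_dom_def chart_map_def chart_img_def split: prod.splits)

lemma product_chart_inv:
  assumes z: "fst z \<in> chart_img A1 x" "snd z \<in> chart_img A2 y"
  shows "chart_inv AM (x, y) z = (chart_inv A1 x (fst z), chart_inv A2 y (snd z))"
  unfolding chart_inv_def[of AM]
proof (rule inv_into_f_eq)
  have "inj_on (chart_map A1 x) (chart_dom A1 x)" "inj_on (chart_map A2 y) (chart_dom A2 y)"
    using atlas_chart(10)[OF M1.atlas] atlas_chart(10)[OF M2.atlas] by (metis inj_onI)+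
  then show "inj_on (chart_map AM (x, y)) (chart_dom AM (x, y))"
    by (auto simp: product_chart inj_on_def)
qed (use z atlas_chart(7,8)[OF M1.atlas] atlas_chart(7,8)[OF M2.atlas] in \<open>auto simp: product_chart\<close>)

lemma product_transition:
  assumes z: "fst z \<in> chart_img A1 x" "snd z \<in> chart_img A2 y"
  shows "transition AM (x, y) (p, q) z = (transition A1 x p (fst z), transition A2 y q (snd z))"
  by (simp add: product_chart_inv[OF z] product_chart)

lemma product_overlap: "overlap AM (x, y) (p, q) = overlap A1 x p \<times> overlap A2 y q"
proof -
  have "overlap AM (x, y) (p, q) =
    (\<lambda>z. (chart_map A1 x (fst z), chart_map A2 y (snd z))) ` ((chart_dom A1 x \<inter> chart_dom A1 p) \<times> (chart_dom A2 y \<inter> chart_dom A2 q))"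
    unfolding overlap_def product_chart[abs_def] by (simp add: Times_Int_Times)
  also have "\<dots> = overlap A1 x p \<times> overlap A2 y q" unfolding overlap_def by force
  finally show ?thesis .
qed

lemma product_smooth_atlas: "smooth_atlas AM"
  unfolding smooth_atlas_def
proof (intro conjI allI)
  fix xy :: "'a \<times> 'b"
  obtain x y where xy: "xy = (x, y)" by force
  note c1 = atlas_chart[OF M1.atlas] and c2 = atlas_chart[OF M2.atlas]
  show "xy \<in> chart_dom AM xy" by (simp add: xy product_chart c1(1) c2(1))
  show "open (chart_dom AM xy)" by (simp add: xy product_chart open_Times c1(4) c2(4))
  have img: "chart_map AM xy ` chart_dom AM xy = chart_img A1 x \<times> chart_img A2 y"
    using product_chart(3)[of x y] unfolding xy chart_img_def by simp
  show "open (chart_map AM xy ` chart_dom AM xy)"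
    unfolding img by (intro open_Times c1(2) c2(2))
  have inv: "chart_inv AM xy z = (chart_inv A1 x (fst z), chart_inv A2 y (snd z))" if "z \<in> chart_img A1 x \<times> chart_img A2 y" for z
    unfolding xy by (rule product_chart_inv) (use that in auto)
  show "homeomorphism (chart_dom AM xy) (chart_map AM xy ` chart_dom AM xy) (chart_map AM xy) (chart_inv AM xy)"
    unfolding img
  proof (rule homeomorphismI)
    show "continuous_on (chart_dom AM xy) (chart_map AM xy)"
      unfolding xy product_chart[abs_def]
      by (intro continuous_on_Pair continuous_on_compose2[OF c1(6)] continuous_on_compose2[OF c2(6)] continuous_intros) auto
    have "continuous_on (chart_img A1 x \<times> chart_img A2 y) (\<lambda>z. (chart_inv A1 x (fst z), chart_inv A2 y (snd z)))"
      by (intro continuous_on_Pair continuous_on_compose2[OF c1(5)] continuous_on_compose2[OF c2(5)] continuous_intros) auto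
    then show "continuous_on (chart_img A1 x \<times> chart_img A2 y) (chart_inv AM xy)"
      by (rule continuous_on_cong[THEN iffD1, rotated 2]) (auto simp: inv)
    show "chart_map AM xy ` chart_dom AM xy \<subseteq> chart_img A1 x \<times> chart_img A2 y" using img by simp
    show "chart_inv AM xy ` (chart_img A1 x \<times> chart_img A2 y) \<subseteq> chart_dom AM xy"
      using inv c1(7) c2(7) by (auto simp: xy product_chart)
    show "chart_inv AM xy (chart_map AM xy p) = p" if "p \<in> chart_dom AM xy" for p
      using that c1(9,10) c2(9,10) inv[of "chart_map AM xy p"] by (auto simp: xy product_chart)
    show "chart_map AM xy (chart_inv AM xy z) = z" if "z \<in> chart_img A1 x \<times> chart_img A2 y" for z
      using that c1(8) c2(8) inv[OF that] by (auto simp: xy product_chart)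
  qed
  fix pq :: "'a \<times> 'b"
  obtain p q where pq: "pq = (p, q)" by force
  note o1 = atlas_overlap(2,3)[OF M1.atlas, of x p] and o2 = atlas_overlap(2,3)[OF M2.atlas, of y q]
  have o: "open (overlap A1 x p \<times> overlap A2 y q)" by (intro open_Times o1(1) o2(1))
  have "smooth_on (overlap A1 x p \<times> overlap A2 y q) (\<lambda>z. (transition A1 x p (fst z), transition A2 y q (snd z)))"
    by (intro smooth_on_Pair[OF o] smooth_on_compose[OF o smooth_on_fst[OF o smooth_on_id[OF o]] o1(2)]
        smooth_on_compose[OF o smooth_on_snd[OF o smooth_on_id[OF o]] o2(2)]) auto
  then have "smooth_on (overlap AM xy pq) (transition AM xy pq)"
    unfolding xy pq product_overlap
    by (rule smooth_on_cong[OF o, rotated], intro product_transition[symmetric])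
      (use subsetD[OF overlap_subset[OF M1.atlas]] subsetD[OF overlap_subset[OF M2.atlas]] in auto)
  then show "smooth_on (chart_map AM xy ` (chart_dom AM xy \<inter> chart_dom AM pq)) (transition AM xy pq)"
    by (simp add: overlap_def)
qed

lemma product_tangent_iso:
  assumes z: "fst z \<in> chart_img A1 x" "snd z \<in> chart_img A2 y"
  shows "tangent_iso AM (x, y) z V = (tangent_iso A1 x (fst z) (fst V), tangent_iso A2 y (snd z) (snd V))"
proof -
  let ?p = "chart_inv A1 x (fst z)" and ?q = "chart_inv A2 y (snd z)"
  let ?O = "overlap A1 x ?p \<times> overlap A2 y ?q"
  have O: "open ?O" "z \<in> ?O"
    using atlas_overlap(2)[OF M1.atlas] atlas_overlap(2)[OF M2.atlas] atlas_overlap(6)[OF M1.atlas z(1)] atlas_overlap(6)[OF M2.atlas z(2)]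
    by (auto intro!: open_Times simp: mem_Times_iff)
  have "((\<lambda>z. (transition A1 x ?p (fst z), transition A2 y ?q (snd z))) has_derivative
    (\<lambda>V. (dtransition A1 x ?p (fst z) (fst V), dtransition A2 y ?q (snd z) (snd V)))) (at z)"
    by (intro has_derivative_Pair has_derivative_compose[OF M1.fst_snd_has_derivative(1) has_derivative_transition[OF M1.atlas]]
        has_derivative_compose[OF M1.fst_snd_has_derivative(2) has_derivative_transition[OF M2.atlas]]) (use O in auto)
  then have "(transition AM (x, y) (?p, ?q) has_derivative
    (\<lambda>V. (dtransition A1 x ?p (fst z) (fst V), dtransition A2 y ?q (snd z) (snd V)))) (at z)"
    by (rule has_derivative_transform_within_open[OF _ O], intro product_transition[symmetric])
      (use subsetD[OF overlap_subset[OF M1.atlas]] subsetD[OF overlap_subset[OF M2.atlas]] in auto)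
  from fun_cong[OF frechet_derivative_at[OF this], of V] show ?thesis
    by (simp add: tangent_iso_def product_chart_inv[OF z])
qed

lemma product_local_rep:
  assumes z: "fst z \<in> chart_img A1 x" "snd z \<in> chart_img A2 y"
  shows "local_rep AM K (x, y) z Xs = K (chart_inv A1 x (fst z), chart_inv A2 y (snd z))
     (map (\<lambda>V. (tangent_iso A1 x (fst z) (fst V), tangent_iso A2 y (snd z) (snd V))) Xs)"
  unfolding local_rep_tangent_iso product_chart_inv[OF z] product_tangent_iso[OF z, abs_def] ..

lemma pullback_local_rep:
  assumes z: "fst z \<in> chart_img A1 x" "snd z \<in> chart_img A2 y"
  shows "local_rep AM (pullback1 K) (x, y) z Xs = local_rep A1 K x (fst z) (map fst Xs)"
    and "local_rep AM (pullback2 K') (x, y) z Xs = local_rep A2 K' y (snd z) (map snd Xs)"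
  unfolding product_local_rep[OF z]
  by (simp_all add: pullback1_def pullback2_def local_rep_tangent_iso comp_def)

lemma open_product_img: "open (chart_img A1 x \<times> chart_img A2 y)"
  by (intro open_Times atlas_chart(2) M1.atlas M2.atlas)

lemma sym_tensor_field_pullback1:
  assumes K: "sym_tensor_field A1 p K" shows "sym_tensor_field AM p (pullback1 K)"
  unfolding sym_tensor_field_def chart_img_def[symmetric]
proof (intro conjI allI impI)
  fix xy :: "'a \<times> 'b"
  obtain x y where xy: "xy = (x, y)" by force
  show "pullback1 K xy \<in> sym_tensors p"
    using sym_tensors_pullback[OF sym_tensor_fieldD(1)[OF K] linear_fst] by (simp add: pullback1_def xy)
  fix Xs :: "('e \<times> 'f) list" assume "length Xs = p"
  note o = open_product_img
  have "smooth_on (chart_img A1 x \<times> chart_img A2 y) (\<lambda>z. local_rep A1 K x (fst z) (map fst Xs))"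
    by (rule smooth_on_compose[OF o smooth_on_fst[OF o smooth_on_id[OF o]] sym_tensor_fieldD(2)[OF K]]) (auto simp: \<open>length Xs = p\<close>)
  then show "smooth_on (chart_img AM xy) (\<lambda>z. local_rep AM (pullback1 K) xy z Xs)"
    unfolding xy product_chart by (rule smooth_on_cong[OF o, rotated]) (auto simp: pullback_local_rep)
qed

lemma sym_tensor_field_pullback2:
  assumes K: "sym_tensor_field A2 p K" shows "sym_tensor_field AM p (pullback2 K)"
  unfolding sym_tensor_field_def chart_img_def[symmetric]
proof (intro conjI allI impI)
  fix xy :: "'a \<times> 'b"
  obtain x y where xy: "xy = (x, y)" by force
  show "pullback2 K xy \<in> sym_tensors p"
    using sym_tensors_pullback[OF sym_tensor_fieldD(1)[OF K] linear_snd] by (simp add: pullback2_def xy)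
  fix Xs :: "('e \<times> 'f) list" assume "length Xs = p"
  note o = open_product_img
  have "smooth_on (chart_img A1 x \<times> chart_img A2 y) (\<lambda>z. local_rep A2 K y (snd z) (map snd Xs))"
    by (rule smooth_on_compose[OF o smooth_on_snd[OF o smooth_on_id[OF o]] sym_tensor_fieldD(2)[OF K]]) (auto simp: \<open>length Xs = p\<close>)
  then show "smooth_on (chart_img AM xy) (\<lambda>z. local_rep AM (pullback2 K) xy z Xs)"
    unfolding xy product_chart by (rule smooth_on_cong[OF o, rotated]) (auto simp: pullback_local_rep)
qed

lemma sym_tensor_field_add:
  assumes "sym_tensor_field AM p K" "sym_tensor_field AM p K'"
  shows "sym_tensor_field AM p (\<lambda>z Xs. K z Xs + K' z Xs)"
  unfolding sym_tensor_field_def chart_img_def[symmetric]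
proof (intro conjI allI impI sym_tensors_add)
  fix xy :: "'a \<times> 'b" and Xs :: "('e \<times> 'f) list" assume "length Xs = p"
  then have "smooth_on (chart_img AM xy) (\<lambda>z. local_rep AM K xy z Xs + local_rep AM K' xy z Xs)"
    by (intro smooth_on_add atlas_chart(2)[OF product_smooth_atlas] sym_tensor_fieldD(2)[OF assms(1)] sym_tensor_fieldD(2)[OF assms(2)])
  then show "smooth_on (chart_img AM xy) (\<lambda>z. local_rep AM (\<lambda>z Xs. K z Xs + K' z Xs) xy z Xs)"
    by (simp add: local_rep_tangent_iso)
qed (use assms sym_tensor_fieldD(1) in auto)

lemma product_riemannian: "riemannian_manifold AM gM"
  unfolding riemannian_manifold_def riemannian_metric_def
proof (intro conjI allI impI product_smooth_atlas)
  show "sym_tensor_field AM 2 gM"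
    unfolding product_metric_def
    by (intro sym_tensor_field_add sym_tensor_field_pullback1 sym_tensor_field_pullback2 M1.metric_field M2.metric_field)
  fix xy :: "'a \<times> 'b" and V :: "'e \<times> 'f" assume V: "V \<noteq> 0"
  obtain x y where xy: "xy = (x, y)" by force
  have nn: "g1 x [v, v] \<ge> 0" "g2 y [w, w] \<ge> 0" for v w
    using M1.metric_pos[of v x] M2.metric_pos[of w y] linear_0[OF sym_tensors_2D(2)[OF M1.metric_sym]]
      linear_0[OF sym_tensors_2D(2)[OF M2.metric_sym]] by (metis less_eq_real_def)+
  have "fst V \<noteq> 0 \<or> snd V \<noteq> 0" using V by (simp add: prod_eq_iff)
  then show "0 < gM xy [V, V]"
    using M1.metric_pos[of "fst V" x] M2.metric_pos[of "snd V" y] nn(1)[of "fst V"] nn(2)[of "snd V"]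
    by (auto simp: product_metric_def pullback1_def pullback2_def xy)
qed

end

sublocale riem_pair \<subseteq> MM: riem "product_atlas A1 A2" "product_metric g1 g2"
  by unfold_locales (rule product_riemannian)

context riem_pair
begin

lemma product_metric_eval: "gM (x, y) [U, V] = g1 x [fst U, fst V] + g2 y [snd U, snd V]"
  by (simp add: product_metric_def pullback1_def pullback2_def)

lemma product_metric_coord_deriv:
  "coord_deriv AM gM (x, y) V [U, W] = coord_deriv A1 g1 x (fst V) [fst U, fst W] + coord_deriv A2 g2 y (snd V) [snd U, snd W]"
proof -
  let ?z = "chart_center AM (x, y)"
  have c: "fst ?z = chart_center A1 x" "snd ?z = chart_center A2 y" by (simp_all add: product_chart)
  have "((\<lambda>z. local_rep A1 g1 x (fst z) [fst U, fst W] + local_rep A2 g2 y (snd z) [snd U, snd W]) has_derivative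
     (\<lambda>V. frechet_derivative (\<lambda>z. local_rep A1 g1 x z [fst U, fst W]) (at (fst ?z)) (fst V) +
        frechet_derivative (\<lambda>z. local_rep A2 g2 y z [snd U, snd W]) (at (snd ?z)) (snd V))) (at ?z)"
    by (intro has_derivative_add has_derivative_compose[OF M1.fst_snd_has_derivative(1) smooth_on_has_derivative[OF M1.gx_smooth]]
        has_derivative_compose[OF M1.fst_snd_has_derivative(2) smooth_on_has_derivative[OF M2.gx_smooth]])
      (use atlas_chart(3)[OF M1.atlas] atlas_chart(3)[OF M2.atlas] in \<open>auto simp: c\<close>)
  then have "((\<lambda>z. local_rep AM gM (x, y) z [U, W]) has_derivative
     (\<lambda>V. frechet_derivative (\<lambda>z. local_rep A1 g1 x z [fst U, fst W]) (at (fst ?z)) (fst V) +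
        frechet_derivative (\<lambda>z. local_rep A2 g2 y z [snd U, snd W]) (at (snd ?z)) (snd V))) (at ?z)"
  proof (rule has_derivative_transform_within_open[OF _ open_product_img[of x y]])
    show "?z \<in> chart_img A1 x \<times> chart_img A2 y"
      using atlas_chart(3)[OF M1.atlas] atlas_chart(3)[OF M2.atlas] by (simp add: product_chart)
    show "local_rep A1 g1 x (fst z) [fst U, fst W] + local_rep A2 g2 y (snd z) [snd U, snd W] = local_rep AM gM (x, y) z [U, W]"
      if "z \<in> chart_img A1 x \<times> chart_img A2 y" for z
    proof -
      have z: "fst z \<in> chart_img A1 x" "snd z \<in> chart_img A2 y" using that by auto
      show ?thesis unfolding product_local_rep[OF z] by (simp add: local_rep_tangent_iso product_metric_eval)
    qed
  qed
  from fun_cong[OF frechet_derivative_at[OF this], of V] show ?thesis by (simp add: coord_deriv_def c)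
qed

text \<open>Both sides have the same scalar products with all vectors, by the Koszul formulas of the three metrics.\<close>

lemma product_christoffel:
  "christoffel AM gM (x, y) V W = (christoffel A1 g1 x (fst V) (fst W), christoffel A2 g2 y (snd V) (snd W))" (is "?\<Gamma> = ?\<Gamma>'")
proof -
  have eq: "gM (x, y) [?\<Gamma>, Y] = gM (x, y) [?\<Gamma>', Y]" for Y
    using christoffel[OF product_riemannian, of "(x, y)" V W Y] christoffel[OF M1.riem, of x "fst V" "fst W" "fst Y"]
      christoffel[OF M2.riem, of y "snd V" "snd W" "snd Y"]
    unfolding product_metric_coord_deriv by (simp add: product_metric_eval[of _ _ ?\<Gamma>'])
  have "gM (x, y) [?\<Gamma> - ?\<Gamma>', ?\<Gamma> - ?\<Gamma>'] = 0"
    using eq linear_diff[OF sym_tensors_2D(2)[OF MM.metric_sym]] by simp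
  then show ?thesis using MM.metric_pos[of "?\<Gamma> - ?\<Gamma>'" "(x, y)"] by force
qed

text \<open>The coefficients select a block of a tensor: \<open>1 0 1 0\<close> and \<open>0 1 0 1\<close> give the diagonal blocks, \<open>1 0 0 1\<close> the mixed
  one, and \<open>1 1 1 1\<close> the whole tensor. For each of them the derivatives along the two geodesic flows are covariant
  derivatives on the product.\<close>

definition mix :: "('a \<times> 'b, 'e \<times> 'f) tensor_field \<Rightarrow> real \<Rightarrow> real \<Rightarrow> real \<Rightarrow> real \<Rightarrow> 'a \<times> 'e \<Rightarrow> 'b \<times> 'f \<Rightarrow> real" where
  "mix h a b c d P Q = h (fst P, fst Q) [(a *\<^sub>R snd P, b *\<^sub>R snd Q), (c *\<^sub>R snd P, d *\<^sub>R snd Q)]"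

lemma mix_rep:
  assumes "z \<in> jd x y"
  shows "rep (mix h a b c d) x y z = local_rep AM h (x, y) (fst (fst z), fst (snd z))
     [(a *\<^sub>R snd (fst z), b *\<^sub>R snd (snd z)), (c *\<^sub>R snd (fst z), d *\<^sub>R snd (snd z))]"
proof -
  have z: "fst (fst z) \<in> chart_img A1 x" "fst (snd z) \<in> chart_img A2 y" using assms by (auto simp: jdom_def)
  show ?thesis
    using linear_scale[OF tangent_iso_linear[OF M1.atlas z(1)]] linear_scale[OF tangent_iso_linear[OF M2.atlas z(2)]] z
    by (simp add: jrep_def mix_def product_local_rep tlift_def)
qed

lemma local_rep_product_bilinear:
  assumes "sym_tensor_field AM 2 h" "z \<in> chart_img A1 x \<times> chart_img A2 y"
  shows "bilinear (\<lambda>U V. local_rep AM h (x, y) z [U, V])"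
  by (rule sym_tensors_2_bilinear[OF local_rep_sym_tensors[OF product_smooth_atlas assms(1)]])
    (use assms(2) in \<open>simp add: product_chart\<close>)

lemma local_rep_product_smooth:
  assumes "sym_tensor_field AM 2 h"
  shows "smooth_on (chart_img A1 x \<times> chart_img A2 y) (\<lambda>z. local_rep AM h (x, y) z [U, V])"
  using sym_tensor_fieldD(2)[OF assms, of "[U, V]" "(x, y)"] by (simp add: product_chart)

lemma smooth_mix:
  assumes h: "sym_tensor_field AM 2 h" shows "smooth (mix h a b c d)"
  unfolding jsmooth_def
proof (intro allI)
  fix x y
  note o = open_jd[of x y]
  have lin: "smooth_on (jd x y) L" if "linear L" for L :: "('e \<times> 'e) \<times> ('f \<times> 'f) \<Rightarrow> 'e \<times> 'f"
    by (rule smooth_on_linear[OF o that])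
  have "smooth_on (jd x y) (\<lambda>z. local_rep AM h (x, y) (fst (fst z), fst (snd z))
     [(a *\<^sub>R snd (fst z), b *\<^sub>R snd (snd z)), (c *\<^sub>R snd (fst z), d *\<^sub>R snd (snd z))])"
    by (rule smooth_on_bilinear_eval[where G = "\<lambda>z U V. local_rep AM h (x, y) z [U, V]" and S = "chart_img A1 x \<times> chart_img A2 y",
          OF o lin lin lin _ local_rep_product_smooth[OF h] local_rep_product_bilinear[OF h]])
      (auto simp: jdom_def scaleR_add_right intro!: linearI)
  then show "smooth_on (jd x y) (rep (mix h a b c d) x y)"
    by (rule smooth_on_cong[OF o, rotated]) (simp add: mix_rep)
qed

lemma F_mix:
  assumes h: "sym_tensor_field AM 2 h"
  shows "F1 (mix h a b c d) (x, v) (y, w) = nabla AM gM (x, y) (v, 0) h [(a *\<^sub>R v, b *\<^sub>R w), (c *\<^sub>R v, d *\<^sub>R w)]"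
    and "F2 (mix h a b c d) (x, v) (y, w) = nabla AM gM (x, y) (0, w) h [(a *\<^sub>R v, b *\<^sub>R w), (c *\<^sub>R v, d *\<^sub>R w)]"
proof -
  let ?p = "(chart_center A1 x, v)" and ?q = "(chart_center A2 y, w)"
  let ?z = "(?p, ?q)" and ?c = "(chart_center A1 x, chart_center A2 y)"
  let ?U = "\<lambda>z. (a *\<^sub>R snd (fst z), b *\<^sub>R snd (snd z))" and ?V = "\<lambda>z. (c *\<^sub>R snd (fst z), d *\<^sub>R snd (snd z))"
  let ?\<pi> = "\<lambda>z. (fst (fst z), fst (snd z))"
  let ?D = "\<lambda>U V k. frechet_derivative (\<lambda>z. local_rep AM h (x, y) z [U, V]) (at ?c) (?\<pi> k)"
  have c: "?c \<in> chart_img A1 x \<times> chart_img A2 y" using atlas_chart(3)[OF M1.atlas] atlas_chart(3)[OF M2.atlas] by simp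
  have z: "?z \<in> jd x y" using c by (simp add: jdom_def)
  have at: "\<Psi> (x, v) (y, w) = rep \<Psi> x y ?z" for \<Psi>
    by (simp add: jrep_def tlift_center M1.atlas M2.atlas)
  have lin: "(L has_derivative L) (at ?z)" if "linear L" for L :: "('e \<times> 'e) \<times> ('f \<times> 'f) \<Rightarrow> 'e \<times> 'f"
    by (rule linear_imp_has_derivative[OF that])
  have l: "linear ?U" "linear ?V" "linear ?\<pi>" by (auto simp: scaleR_add_right intro!: linearI)
  have "((\<lambda>z. local_rep AM h (x, y) (?\<pi> z) [?U z, ?V z]) has_derivative
     (\<lambda>k. ?D (?U ?z) (?V ?z) k + local_rep AM h (x, y) (?\<pi> ?z) [?U k, ?V ?z] + local_rep AM h (x, y) (?\<pi> ?z) [?U ?z, ?V k])) (at ?z)"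
  proof (rule has_derivative_bilinear_eval[where G = "\<lambda>z U V. local_rep AM h (x, y) (?\<pi> z) [U, V]", OF open_jd z _ _ lin[OF l(1)] lin[OF l(2)]])
    show "bilinear (\<lambda>U V. local_rep AM h (x, y) (?\<pi> s) [U, V])" if "s \<in> jd x y" for s
      by (rule local_rep_product_bilinear[OF h]) (use that in \<open>auto simp: jdom_def\<close>)
    show "((\<lambda>s. local_rep AM h (x, y) (?\<pi> s) [U, V]) has_derivative ?D U V) (at ?z)" for U V
      by (rule has_derivative_compose[where f = ?\<pi> and x = ?z and g = "\<lambda>z. local_rep AM h (x, y) z [U, V]", OF lin[OF l(3)]])
        (use smooth_on_has_derivative[OF local_rep_product_smooth[OF h] c] in simp)
  qed
  then have "(rep (mix h a b c d) x y has_derivative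
     (\<lambda>k. ?D (?U ?z) (?V ?z) k + local_rep AM h (x, y) (?\<pi> ?z) [?U k, ?V ?z] + local_rep AM h (x, y) (?\<pi> ?z) [?U ?z, ?V k])) (at ?z)"
    by (rule has_derivative_transform_within_open[OF _ open_jd z]) (simp add: mix_rep)
  from frechet_derivative_at[OF this, symmetric]
  have D: "frechet_derivative (rep (mix h a b c d) x y) (at ?z) =
     (\<lambda>k. ?D (?U ?z) (?V ?z) k + h (x, y) [?U k, ?V ?z] + h (x, y) [?U ?z, ?V k])"
    using local_rep_self[OF product_smooth_atlas, of h "(x, y)"] by (simp add: product_chart)
  have cd: "coord_deriv AM h (x, y) u [U, V] = frechet_derivative (\<lambda>z. local_rep AM h (x, y) z [U, V]) (at ?c) u" for u U V
    by (simp add: coord_deriv_def product_chart)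
  note hl = sym_tensors_2D(2,3)[OF sym_tensor_fieldD(1)[OF h]]
  have \<Gamma>1: "christoffel A1 g1 x u (t *\<^sub>R u') = t *\<^sub>R christoffel A1 g1 x u u'" "christoffel A1 g1 x 0 u = 0" for u u' t
    using bilinear_rmul[OF M1.christoffel_bilinear] bilinear_lzero[OF M1.christoffel_bilinear] by auto
  have \<Gamma>2: "christoffel A2 g2 y u (t *\<^sub>R u') = t *\<^sub>R christoffel A2 g2 y u u'" "christoffel A2 g2 y 0 u = 0" for u u' t
    using bilinear_rmul[OF M2.christoffel_bilinear] bilinear_lzero[OF M2.christoffel_bilinear] by auto
  have neg: "(- u, 0) = - (u, 0 :: 'f)" "(0, - u') = - (0 :: 'e, u')" for u :: 'e and u' :: 'f by simp_all
  show "F1 (mix h a b c d) (x, v) (y, w) = nabla AM gM (x, y) (v, 0) h [(a *\<^sub>R v, b *\<^sub>R w), (c *\<^sub>R v, d *\<^sub>R w)]"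
    unfolding at[of "F1 _"] F1_rep[OF smooth_mix[OF h] z] D MM.nabla_2 cd product_christoffel
    by (simp add: spray_def M1.christoffel_center[symmetric] \<Gamma>1 \<Gamma>2 neg linear_neg[OF hl(1)] linear_neg[OF hl(2)] del: uminus_Pair)
  show "F2 (mix h a b c d) (x, v) (y, w) = nabla AM gM (x, y) (0, w) h [(a *\<^sub>R v, b *\<^sub>R w), (c *\<^sub>R v, d *\<^sub>R w)]"
    unfolding at[of "F2 _"] F2_rep[OF smooth_mix[OF h] z] D MM.nabla_2 cd product_christoffel
    by (simp add: spray_def M2.christoffel_center[symmetric] \<Gamma>1 \<Gamma>2 neg linear_neg[OF hl(1)] linear_neg[OF hl(2)] del: uminus_Pair)
qed

end

section \<open>Decomposition of conformal Killing tensors on a product\<close>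

lemma jsmooth_swap:
  fixes A :: "('a::t2_space, 'e::euclidean_space) atlas" and B :: "('b::t2_space, 'f::euclidean_space) atlas"
  assumes "smooth_atlas A" "smooth_atlas B" "jsmooth A B \<Phi>"
  shows "jsmooth B A (\<lambda>Q P. \<Phi> P Q)"
  unfolding jsmooth_def
proof (intro allI)
  fix y x
  have o: "open (jdom B A y x)"
    unfolding jdom_def by (intro open_Times open_chart_img_times assms)
  have "smooth_on (jdom B A y x) (\<lambda>z. jrep A B \<Phi> x y (snd z, fst z))"
    by (rule smooth_on_compose[OF o smooth_on_linear[OF o], where g = "jrep A B \<Phi> x y"])
      (use assms(3) in \<open>auto simp: jsmooth_def jdom_def intro!: linearI\<close>)
  then show "smooth_on (jdom B A y x) (jrep B A (\<lambda>Q P. \<Phi> P Q) y x)"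
    by (simp add: jrep_def[abs_def])
qed

context riem_pair
begin

lemma swap: "riem_pair A2 g2 A1 g1" by unfold_locales

lemma metric_trace: "(\<Sum>e\<in>onb (g1 x). r2 (x, e)) = real DIM('e)"
proof -
  have "(\<Sum>e\<in>onb (g1 x). r2 (x, e)) = (\<Sum>e\<in>onb (g1 x). 1)"
    by (rule sum.cong) (use M1.onb_metric[of x] in \<open>auto simp: orthonormal_basis_def quad_fun_def\<close>)
  then show ?thesis using M1.onb_metric[of x] by (simp add: orthonormal_basis_def)
qed

text \<open>The combination \<open>a(v) - r2(v) a(u)\<close>, with a unit vector \<open>u\<close>, is annihilated by \<open>F2\<close>, and so is constant in the
  second factor. For fibrewise quadratic \<open>a\<close> this says that the trace-free part is constant.\<close>

lemma trace_free_part_constant: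
  assumes conn: "connected (UNIV :: 'b set)" and a: "smooth a"
    and base: "\<And>P y w w'. a P (y, w) = a P (y, w')"
    and F2a: "\<And>P Q. F2 a P Q = 2 * r2 P * k2 (fst P) Q"
    and u: "r2 (x, u) = 1"
  shows "a (x, v) (y, w) - a (x, v) (y', w') = r2 (x, v) * (a (x, u) (y, w) - a (x, u) (y', w'))"
proof -
  define f where "f y = a (x, v) (y, 0) - r2 (x, v) * a (x, u) (y, 0)" for y
  have eq: "(\<lambda>Q. f (fst Q)) = (\<lambda>Q. a (x, v) Q - r2 (x, v) * a (x, u) Q)"
    unfolding f_def by (intro ext) (metis base prod.collapse)
  have sm: "tsmooth A2 (a (x, v))" "tsmooth A2 (\<lambda>Q. r2 (x, v) * a (x, u) Q)"
    using smooth_slice2[OF a] by (auto intro: M2.tsmooth_mult M2.tsmooth_const)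
  have "f y = f y'"
  proof (rule M2.base_constant[OF conn])
    show "tsmooth A2 (\<lambda>Q. f (fst Q))" unfolding eq by (rule M2.tsmooth_diff[OF sm])
    show "geo A2 g2 (\<lambda>Q. f (fst Q)) Q = 0" for Q
      unfolding eq M2.geo_diff[OF sm] M2.geo_cmult[OF smooth_slice2[OF a]]
      using F2a[of "(x, v)" Q] F2a[of "(x, u)" Q] u by (simp add: geo2_def)
  qed
  then show ?thesis
    unfolding f_def using base[of "(x, v)" y 0 w] base[of "(x, u)" y 0 w] base[of "(x, v)" y' 0 w'] base[of "(x, u)" y' 0 w']
    by (simp add: algebra_simps)
qed

text \<open>This is where the vanishing of the trace of \<open>h\<close> enters: adding a multiple of the metric to \<open>h\<close> adds an
  arbitrary exact form to \<open>k\<close>. Up to terms that are constant along one factor, \<open>a = r2 \<rho>\<close> and \<open>b = s2 \<sigma>\<close> for functions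
  \<open>\<rho>\<close>, \<open>\<sigma>\<close> on the product, and vanishing trace becomes \<open>n1 \<rho> + n2 (\<sigma> - \<sigma>(\<cdot>, y0)) = \<kappa>(y)\<close>. The derivative of this
  along the first factor is \<open>2 (n1 + n2) (k1 - k1(\<cdot>, y0)) = 0\<close>. It is computed after multiplication with \<open>r2 s2\<close>, on
  \<open>a\<close> and \<open>b\<close> instead of \<open>\<rho>\<close> and \<open>\<sigma>\<close>.\<close>

lemma k1_independent:
  assumes conn: "connected (UNIV :: 'a set)" "connected (UNIV :: 'b set)"
    and a: "smooth a" and b: "smooth b"
    and a_base: "\<And>P y w w'. a P (y, w) = a P (y, w')" and b_base: "\<And>x v v' Q. b (x, v) Q = b (x, v') Q"
    and F1a: "\<And>P Q. F1 a P Q = 2 * r2 P * k1 P (fst Q)" and F2a: "\<And>P Q. F2 a P Q = 2 * r2 P * k2 (fst P) Q"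
    and F1b: "\<And>P Q. F1 b P Q = 2 * s2 Q * k1 P (fst Q)"
    and trace: "\<And>P Q. (\<Sum>e\<in>onb (g1 (fst P)). a (fst P, e) Q) + (\<Sum>e\<in>onb (g2 (fst Q)). b P (fst Q, e)) = 0"
    and k1_0: "\<And>x y. k1 (x, 0) y = 0"
  shows "k1 P y = k1 P y0"
proof -
  fix x0 :: 'a
  interpret sw: riem_pair A2 g2 A1 g1 by (rule swap)
  let ?n1 = "real DIM('e)" and ?n2 = "real DIM('f)"
  have "\<forall>x. \<exists>u. r2 (x, u) = 1" "\<forall>y. \<exists>w. s2 (y, w) = 1"
    using M1.unit_vector_exists M2.unit_vector_exists by blast+
  then obtain u w where u: "\<And>x. r2 (x, u x) = 1" and w: "\<And>y. s2 (y, w y) = 1" by metis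
  define \<rho> where "\<rho> x y = a (x, u x) (y, 0) - a (x, u x) (y0, 0)" for x y
  define \<sigma> where "\<sigma> x y = b (x, 0) (y, w y) - b (x0, 0) (y, w y)" for x y
  have a_eq: "a (x, v) (y, q) = a (x, v) (y0, q') + r2 (x, v) * \<rho> x y" for x v y q q'
    using trace_free_part_constant[OF conn(2) a a_base F2a u[of x], where v = v and y = y and w = q and y' = y0 and w' = q']
      a_base[of "(x, u x)" y q 0] a_base[of "(x, u x)" y0 q' 0] by (simp add: \<rho>_def)
  have b_eq: "b (x, v) (y, q) = b (x0, v') (y, q) + s2 (y, q) * \<sigma> x y" for x v y q v'
  proof -
    have F: "sw.F2 (\<lambda>Q P. b P Q) Q P = 2 * s2 Q * k1 P (fst Q)" for P Q
      using F1b by (simp add: geo1_def geo2_def)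
    show ?thesis
      using sw.trace_free_part_constant[where a = "\<lambda>Q P. b P Q" and ?k2.0 = "\<lambda>y P. k1 P y" and x = y and u = "w y" and v = q
          and y = x and w = v and y' = x0 and w' = v', OF conn(1) jsmooth_swap[OF M1.atlas M2.atlas b] b_base F w]
        b_base[of x v "(y, w y)" 0] b_base[of x0 v' "(y, w y)" 0] by (simp add: \<sigma>_def)
  qed
  define t2 where "t2 x y = (\<Sum>e\<in>onb (g2 y). b (x, 0) (y, e))" for x y
  have t2: "t2 x y = t2 x0 y + ?n2 * \<sigma> x y" for x y
    unfolding t2_def b_eq[of x 0 y _ 0] by (simp add: sum.distrib sum_distrib_right[symmetric] sw.metric_trace)
  have t1: "(\<Sum>e\<in>onb (g1 x). a (x, e) (y, 0)) = (\<Sum>e\<in>onb (g1 x). a (x, e) (y0, 0)) + ?n1 * \<rho> x y" for x y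
    unfolding a_eq[of x _ y 0 0] by (simp add: sum.distrib sum_distrib_right[symmetric] metric_trace)
  have \<kappa>: "?n1 * \<rho> x y + ?n2 * (\<sigma> x y - \<sigma> x y0) = t2 x0 y0 - t2 x0 y" for x y
    using trace[of "(x, 0)" "(y, 0)"] trace[of "(x, 0)" "(y0, 0)"] t1[of x y] t2[of x y] t2[of x y0]
    by (simp add: t2_def algebra_simps)
  let ?Q0 = "(y0, w y0)"
  define \<eta> where "\<eta> Q = s2 Q * (t2 x0 y0 - t2 x0 (fst Q)) + ?n2 * (b (x0, 0) Q - s2 Q * b (x0, 0) ?Q0)" for Q
  have main: "?n1 * (s2 Q * (a P Q - a P ?Q0)) + ?n2 * (r2 P * (b P Q - s2 Q * b P ?Q0)) = r2 P * \<eta> Q" for P Q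
  proof -
    obtain x v y q where PQ: "P = (x, v)" "Q = (y, q)" by (metis surj_pair)
    have "?n1 * (s2 Q * (a P Q - a P ?Q0)) + ?n2 * (r2 P * (b P Q - s2 Q * b P ?Q0)) =
        r2 P * (s2 Q * (?n1 * \<rho> x y + ?n2 * (\<sigma> x y - \<sigma> x y0)) + ?n2 * (b (x0, 0) Q - s2 Q * b (x0, 0) ?Q0))"
      unfolding PQ a_eq[of x v y q "w y0"] b_eq[of x v y q 0] b_eq[of x v y0 "w y0" 0] by (simp add: w algebra_simps)
    then show ?thesis by (simp add: \<kappa> \<eta>_def PQ)
  qed
  have aQ0: "smooth (\<lambda>P Q. a P ?Q0)" and bQ0: "smooth (\<lambda>P Q. b P ?Q0)"
    by (intro smooth_first smooth_slice1 a b)+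
  have FQ0: "F1 (\<lambda>P Q. a P ?Q0) P Q = F1 a P ?Q0" "F1 (\<lambda>P Q. b P ?Q0) P Q = F1 b P ?Q0" for P Q
    by (simp_all add: geo1_def)
  have key: "2 * (?n1 + ?n2) * (r2 P * (s2 Q * (k1 P (fst Q) - k1 P y0))) = 0" for P Q
  proof -
    have "F1 (\<lambda>P Q. ?n1 * (s2 Q * (a P Q - a P ?Q0)) + ?n2 * (r2 P * (b P Q - s2 Q * b P ?Q0))) P Q = 0"
      unfolding main using M1.geo_mult[OF M1.tsmooth_metric M1.tsmooth_const, of "\<eta> Q" P]
      by (simp add: geo1_def M1.geo_metric M1.geo_const)
    then show ?thesis
      by (simp add: F_mult F_add F_diff F_const F_r2 F_s2 FQ0 smooth_intros a b aQ0 bQ0 F1a F1b w algebra_simps)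
  qed
  obtain x v where P: "P = (x, v)" by force
  have "?n1 > 0" using DIM_positive[where 'a = 'e] by simp
  then have "0 < 2 * (?n1 + ?n2)" by (intro mult_pos_pos add_pos_nonneg) auto
  from less_imp_neq[OF this] have "2 * (?n1 + ?n2) \<noteq> 0" by (rule not_sym)
  then have "r2 P * (s2 (y, w y) * (k1 P (fst (y, w y)) - k1 P y0)) = 0" using key[of P "(y, w y)"] by (metis mult_eq_0_iff)
  then have "r2 P * (k1 P y - k1 P y0) = 0" by (simp add: w)
  moreover have "v = 0" if "r2 P = 0"
    using M1.metric_pos[of v x] that P by (auto simp: quad_fun_def)
  ultimately show ?thesis using k1_0 P by auto
qed

text \<open>A primitive \<open>\<tau>\<close> of \<open>- 2 k\<close> is the sum of primitives of \<open>- 2 k1\<close> and of \<open>- 2 k2\<close> on the factors. By the equations for \<open>b\<close> and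
  \<open>a\<close>, these are \<open>- b(\<cdot>, w)\<close> and \<open>- a(v, \<cdot>)\<close> for fixed unit vectors \<open>w\<close> and \<open>v\<close>.\<close>

lemma potential:
  assumes conn: "connected (UNIV :: 'a set)" "connected (UNIV :: 'b set)"
    and a: "smooth a" and b: "smooth b"
    and a_base: "\<And>P y w w'. a P (y, w) = a P (y, w')" and b_base: "\<And>x v v' Q. b (x, v) Q = b (x, v') Q"
    and F1a: "\<And>P Q. F1 a P Q = 2 * r2 P * k1 P (fst Q)" and F2a: "\<And>P Q. F2 a P Q = 2 * r2 P * k2 (fst P) Q"
    and F1b: "\<And>P Q. F1 b P Q = 2 * s2 Q * k1 P (fst Q)" and F2b: "\<And>P Q. F2 b P Q = 2 * s2 Q * k2 (fst P) Q"
    and trace: "\<And>P Q. (\<Sum>e\<in>onb (g1 (fst P)). a (fst P, e) Q) + (\<Sum>e\<in>onb (g2 (fst Q)). b P (fst Q, e)) = 0"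
    and k1_0: "\<And>x y. k1 (x, 0) y = 0" and k2_0: "\<And>x y. k2 x (y, 0) = 0"
  shows "\<exists>\<tau>. smooth (\<lambda>P Q. \<tau> (fst P) (fst Q)) \<and>
    (\<forall>P Q Q'. a P Q + \<tau> (fst P) (fst Q) * r2 P = a P Q' + \<tau> (fst P) (fst Q') * r2 P) \<and>
    (\<forall>P P' Q. b P Q + \<tau> (fst P) (fst Q) * s2 Q = b P' Q + \<tau> (fst P') (fst Q) * s2 Q) \<and>
    (\<forall>P Q. F1 (\<lambda>P Q. a P Q + \<tau> (fst P) (fst Q) * r2 P) P Q = 0) \<and>
    (\<forall>P Q. F2 (\<lambda>P Q. b P Q + \<tau> (fst P) (fst Q) * s2 Q) P Q = 0)"
proof -
  fix x0 :: 'a and y0 :: 'b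
  interpret sw: riem_pair A2 g2 A1 g1 by (rule swap)
  have k1: "k1 P y = k1 P y'" for P y y'
    by (rule k1_independent[OF conn a b a_base b_base F1a F2a F1b trace k1_0])
  have k2: "k2 x Q = k2 x' Q" for x x' Q
    by (rule sw.k1_independent[where ?k1.0 = "\<lambda>Q x. k2 x Q" and ?k2.0 = "\<lambda>y P. k1 P y" and a = "\<lambda>Q P. b P Q" and b = "\<lambda>Q P. a P Q",
          OF conn(2,1) jsmooth_swap[OF M1.atlas M2.atlas b] jsmooth_swap[OF M1.atlas M2.atlas a]])
      (use F1a F2a F1b F2b a_base b_base trace k2_0 in \<open>auto simp: geo1_def geo2_def add.commute\<close>)
  obtain v0 where v0: "r2 (x0, v0) = 1" using M1.unit_vector_exists by blast
  obtain w0 where w0: "s2 (y0, w0) = 1" using M2.unit_vector_exists by blast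
  let ?P0 = "(x0, v0)" and ?Q0 = "(y0, w0)"
  define \<tau> where "\<tau> x y = - b (x, 0) ?Q0 - a ?P0 (y, 0)" for x y
  have \<tau>: "\<tau> (fst P) (fst Q) = - b P ?Q0 - a ?P0 Q" for P Q
    unfolding \<tau>_def by (metis a_base b_base prod.collapse)
  have sm: "smooth (\<lambda>P Q. b P ?Q0)" "smooth (\<lambda>P Q. a ?P0 Q)"
    by (intro smooth_first smooth_slice1 b) (intro smooth_second smooth_slice2 a)
  have F0: "F1 (\<lambda>P Q. b P ?Q0) P Q = 2 * k1 P y0" "F2 (\<lambda>P Q. b P ?Q0) P Q = 0"
    "F1 (\<lambda>P Q. a ?P0 Q) P Q = 0" "F2 (\<lambda>P Q. a ?P0 Q) P Q = 2 * k2 x0 Q" for P Q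
    using F1b[of P ?Q0] F2a[of ?P0 Q] v0 w0 by (simp_all add: geo1_def geo2_def M1.geo_const M2.geo_const)
  let ?a = "\<lambda>P Q. a P Q + (- b P ?Q0 - a ?P0 Q) * r2 P" and ?b = "\<lambda>P Q. b P Q + (- b P ?Q0 - a ?P0 Q) * s2 Q"
  have smab: "smooth ?a" "smooth ?b" by (intro smooth_intros a b sm)+
  note rules = F_mult F_add F_diff F_minus F_r2 F_s2 F0 smooth_intros a b sm F1a F1b F2a F2b
  have Fa: "F1 ?a P Q = 0" "F2 ?a P Q = 0" and Fb: "F1 ?b P Q = 0" "F2 ?b P Q = 0" for P Q
    using k1[of P "fst Q" y0] k2[of "fst P" Q x0] by (simp_all add: rules)
  have const_a: "?a P Q = ?a P Q'" for P Q Q'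
  proof -
    have eq: "(\<lambda>Q. ?a P (fst Q, 0)) = ?a P" by (intro ext) (metis a_base prod.collapse)
    have "?a P (fst Q, 0) = ?a P (fst Q', 0)"
      by (rule M2.base_constant[OF conn(2), of "\<lambda>y. ?a P (y, 0)"])
        (unfold eq, use smooth_slice2[OF smab(1)] Fa(2) in \<open>auto simp: geo2_def\<close>)
    then show ?thesis using fun_cong[OF eq, of Q] fun_cong[OF eq, of Q'] by simp
  qed
  have const_b: "?b P Q = ?b P' Q" for P P' Q
  proof -
    have eq: "(\<lambda>P. ?b (fst P, 0) Q) = (\<lambda>P. ?b P Q)" by (intro ext) (metis b_base prod.collapse)
    have "?b (fst P, 0) Q = ?b (fst P', 0) Q"
      by (rule M1.base_constant[OF conn(1), of "\<lambda>x. ?b (x, 0) Q"])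
        (unfold eq, use smooth_slice1[OF smab(2)] Fb(1) in \<open>auto simp: geo1_def\<close>)
    then show ?thesis using fun_cong[OF eq, of P] fun_cong[OF eq, of P'] by simp
  qed
  show ?thesis
  proof (intro exI[of _ \<tau>] conjI allI)
    show "smooth (\<lambda>P Q. \<tau> (fst P) (fst Q))" unfolding \<tau> by (intro smooth_intros sm)
    show "F1 (\<lambda>P Q. a P Q + \<tau> (fst P) (fst Q) * r2 P) P Q = 0" for P Q unfolding \<tau> by (rule Fa(1))
    show "F2 (\<lambda>P Q. b P Q + \<tau> (fst P) (fst Q) * s2 Q) P Q = 0" for P Q unfolding \<tau> by (rule Fb(2))
    show "a P Q + \<tau> (fst P) (fst Q) * r2 P = a P Q' + \<tau> (fst P) (fst Q') * r2 P" for P Q Q'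
      unfolding \<tau> by (rule const_a)
    show "b P Q + \<tau> (fst P) (fst Q) * s2 Q = b P' Q + \<tau> (fst P') (fst Q) * s2 Q" for P P' Q
      unfolding \<tau> by (rule const_b)
  qed
qed

end

section \<open>The blocks of a trace-free conformal Killing tensor\<close>

lemma flat_sym_tensors: "G \<in> sym_tensors 2 \<Longrightarrow> flat G u \<in> sym_tensors 1"
  by (rule sym_tensors_1I) (auto simp: flat_def sym_tensors_2D(3) split: list.splits)

lemma flat_prod_sym_tensors:
  assumes G: "G \<in> sym_tensors 2"
  shows "(flat G u \<odot> flat G v) \<in> sym_tensors 2"
proof (rule sym_tensors_2I)
  show "(flat G u \<odot> flat G v) Xs = 0" if "length Xs \<noteq> 2" for Xs
    by (rule sym_prod_flat_length[OF sym_tensors_length[OF flat_sym_tensors[OF G]]]) (use that in auto)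
  note l = sym_tensors_2D(3)[OF G]
  show "(flat G u \<odot> flat G v) [X, Y] = (flat G u \<odot> flat G v) [Y, X]" for X Y
    by (simp add: flat_sym_prod_flat)
  show "linear (\<lambda>X. (flat G u \<odot> flat G v) [X, Y])" for Y
    by (rule linearI) (simp_all add: flat_sym_prod_flat linear_add[OF l] linear_scale[OF l] algebra_simps)
qed

lemma sym_tensors_zero: "(\<lambda>Xs. 0) \<in> sym_tensors p"
  unfolding sym_tensors_def by (simp add: linear_zero)

lemma sym_tensors_sum:
  assumes "finite I" "\<And>i. i \<in> I \<Longrightarrow> S i \<in> sym_tensors p"
  shows "(\<lambda>Xs. \<Sum>i\<in>I. S i Xs) \<in> sym_tensors p"
  using assms
proof (induction I rule: finite_induct)
  case empty
  show ?case by (simp add: sym_tensors_zero)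
next
  case (insert i I)
  have "S i \<in> sym_tensors p" "(\<lambda>Xs. \<Sum>i\<in>I. S i Xs) \<in> sym_tensors p" using insert by auto
  from sym_tensors_add[OF this] show ?case using insert.hyps by simp
qed

context riem
begin

lemma killing_form_of_vector_field:
  assumes "killing_vector_field A g \<xi>"
  shows "killing_form (\<lambda>P. g (fst P) [\<xi> (fst P), snd P])"
proof -
  let ?K = "\<lambda>x. flat (g x) (\<xi> x)"
  have K: "sym_tensor_field A 1 ?K" "\<And>P. geo A g (lin_fun ?K) P = 0"
    using assms unfolding killing_vector_field_def killing_tensor_1_iff by auto
  have "lin_fun ?K = (\<lambda>P. g (fst P) [\<xi> (fst P), snd P])" by (simp add: fun_eq_iff lin_fun_def flat_def)
  then show ?thesis
    using K tsmooth_lin_fun[OF atlas K(1)] sym_tensors_2D(3)[OF metric_sym] by (auto simp: killing_form_def)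
qed

lemma killing_vector_field_of_form:
  assumes \<psi>: "killing_form \<psi>"
  shows "\<exists>\<xi>. killing_vector_field A g \<xi> \<and> (\<forall>x v. g x [\<xi> x, v] = \<psi> (x, v))"
proof -
  have "\<forall>x. \<exists>u. \<forall>v. g x [u, v] = \<psi> (x, v)"
    using riesz_sym_tensor[OF metric_sym metric_pos] \<psi> unfolding killing_form_def by blast
  then obtain \<xi> where \<xi>: "\<And>x v. g x [\<xi> x, v] = \<psi> (x, v)" by metis
  let ?K = "\<lambda>x. flat (g x) (\<xi> x)"
  have K: "sym_tensor_field A 1 ?K"
    unfolding sym_tensor_field_def chart_img_def[symmetric]
  proof (intro conjI allI impI flat_sym_tensors metric_sym)
    fix x and Xs :: "'e list" assume "length Xs = 1"
    then obtain v where "Xs = [v]" by (auto simp: length_Suc_conv)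
    then have "local_rep A ?K x z Xs = \<psi> (tlift A x (z, v))" for z
      by (simp add: local_rep_tangent_iso flat_def \<xi> tlift_def)
    then show "smooth_on (chart_img A x) (\<lambda>z. local_rep A ?K x z Xs)" using killing_form_chart(1)[OF \<psi>] by simp
  qed
  have "lin_fun ?K = \<psi>" by (simp add: fun_eq_iff lin_fun_def flat_def \<xi>)
  then have "killing_vector_field A g \<xi>"
    using K \<psi> unfolding killing_vector_field_def killing_tensor_1_iff killing_form_def by simp
  with \<xi> show ?thesis by blast
qed

end

context riem_pair
begin

text \<open>The union of orthonormal bases of the two factors is an orthonormal basis of the product.\<close>

lemma product_trace:
  assumes B: "bilinear (B :: 'e \<times> 'f \<Rightarrow> _ \<Rightarrow> real)"
  shows "(\<Sum>e\<in>onb (gM (x, y)). B e e) = (\<Sum>e\<in>onb (g1 x). B (e, 0) (e, 0)) + (\<Sum>e\<in>onb (g2 y). B (0, e) (0, e))"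
proof -
  let ?E1 = "(\<lambda>e. (e, 0 :: 'f)) ` onb (g1 x)" and ?E2 = "(\<lambda>e. (0 :: 'e, e)) ` onb (g2 y)"
  note o1 = M1.onb_metric[of x, unfolded orthonormal_basis_def] and o2 = M2.onb_metric[of y, unfolded orthonormal_basis_def]
  have inj: "inj_on (\<lambda>e. (e, 0 :: 'f)) (onb (g1 x))" "inj_on (\<lambda>e. (0 :: 'e, e)) (onb (g2 y))"
    by (auto simp: inj_on_def)
  have "(0 :: 'e) \<notin> onb (g1 x)" using o1 linear_0[OF sym_tensors_2D(2)[OF M1.metric_sym]] by (metis zero_neq_one)
  then have disj: "?E1 \<inter> ?E2 = {}" by auto
  have 0: "g1 x [0, v] = 0" "g1 x [v, 0] = 0" "g2 y [0, w] = 0" "g2 y [w, 0] = 0" for v w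
    using linear_0[OF sym_tensors_2D(2)[OF M1.metric_sym]] linear_0[OF sym_tensors_2D(3)[OF M1.metric_sym]]
      linear_0[OF sym_tensors_2D(2)[OF M2.metric_sym]] linear_0[OF sym_tensors_2D(3)[OF M2.metric_sym]] by auto
  have nz: "(0 :: 'f) \<notin> onb (g2 y)" using o2 0 by (metis zero_neq_one)
  have "orthonormal_basis (gM (x, y)) (?E1 \<union> ?E2)"
    unfolding orthonormal_basis_def
  proof (intro conjI ballI)
    show "finite (?E1 \<union> ?E2)" using o1 o2 by auto
    show "card (?E1 \<union> ?E2) = DIM('e \<times> 'f)"
      using o1 o2 disj by (simp add: card_Un_disjoint card_image[OF inj(1)] card_image[OF inj(2)])
    fix U V assume "U \<in> ?E1 \<union> ?E2" "V \<in> ?E1 \<union> ?E2"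
    moreover have "g1 x [u, v] = (if u = v then 1 else 0)" if "u \<in> onb (g1 x)" "v \<in> onb (g1 x)" for u v
      using o1 that by blast
    moreover have "g2 y [u, v] = (if u = v then 1 else 0)" if "u \<in> onb (g2 y)" "v \<in> onb (g2 y)" for u v
      using o2 that by blast
    ultimately show "gM (x, y) [U, V] = (if U = V then 1 else 0)"
      using nz \<open>(0 :: 'e) \<notin> onb (g1 x)\<close> by (elim UnE imageE) (auto simp: product_metric_eval 0)
  qed
  from trace_basis_independent[OF MM.metric_sym MM.onb_metric this B]
  have "(\<Sum>e\<in>onb (gM (x, y)). B e e) = (\<Sum>e\<in>?E1 \<union> ?E2. B e e)" .
  also have "\<dots> = (\<Sum>e\<in>?E1. B e e) + (\<Sum>e\<in>?E2. B e e)"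
    by (rule sum.union_disjoint) (use o1 o2 disj in auto)
  finally show ?thesis by (simp add: sum.reindex[OF inj(1)] sum.reindex[OF inj(2)])
qed

lemma DIM_product_nonzero: "real DIM('e \<times> 'f) \<noteq> 0"
  using DIM_positive[where 'a = "'e \<times> 'f"] by (simp only: of_nat_eq_0_iff)

text \<open>The multiple of the metric that is subtracted in \<open>(K1 + K2)\<^sub>0\<close>. As the trace is computed on the two factors,
  it is the sum of a function on each.\<close>

definition tau :: "('a, 'e) tensor_field \<Rightarrow> ('b, 'f) tensor_field \<Rightarrow> 'a \<Rightarrow> 'b \<Rightarrow> real" where
  "tau K1 K2 x y = ((\<Sum>e\<in>onb (g1 x). K1 x [e, e]) + (\<Sum>e\<in>onb (g2 y). K2 y [e, e])) / real DIM('e \<times> 'f)"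

lemma pullback_sum_trace:
  assumes K1: "K1 x \<in> sym_tensors 2" and K2: "K2 y \<in> sym_tensors 2"
  shows "Lambda_op (gM (x, y)) (\<lambda>Ys. pullback1 K1 (x, y) Ys + pullback2 K2 (x, y) Ys) [] = tau K1 K2 x y * real DIM('e \<times> 'f)"
proof -
  note l = linear_0[OF sym_tensors_2D(2)[OF K1]] linear_0[OF sym_tensors_2D(2)[OF K2]]
  have "(\<lambda>Ys. pullback1 K1 (x, y) Ys + pullback2 K2 (x, y) Ys) \<in> sym_tensors 2"
    unfolding pullback1_def pullback2_def
    using sym_tensors_add[OF sym_tensors_pullback[OF K1 linear_fst] sym_tensors_pullback[OF K2 linear_snd]] by simp
  from product_trace[OF sym_tensors_2_bilinear[OF this], of x y] show ?thesis
    by (simp add: Lambda_op_nil tau_def pullback1_def pullback2_def l DIM_product_nonzero del: DIM_prod)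
qed

lemma killing_sum_eval:
  assumes K1: "K1 x \<in> sym_tensors 2" and K2: "K2 y \<in> sym_tensors 2"
  shows "killing_sum g1 g2 K1 K2 k \<xi> \<zeta> (x, y) [U, V] =
    K1 x [fst U, fst V] + K2 y [snd U, snd V] - tau K1 K2 x y * gM (x, y) [U, V] +
    (\<Sum>i<k. g1 x [\<xi> i x, fst U] * g2 y [\<zeta> i y, snd V] + g1 x [\<xi> i x, fst V] * g2 y [\<zeta> i y, snd U])"
proof -
  have 0: "g1 x [0, v] = 0" "g2 y [0, w] = 0" for v w
    using linear_0[OF sym_tensors_2D(2)[OF M1.metric_sym]] linear_0[OF sym_tensors_2D(2)[OF M2.metric_sym]] by auto
  show ?thesis
    by (simp add: killing_sum_def trace_free_part_def pullback_sum_trace[of K1 x K2 y, OF K1 K2] DIM_product_nonzero flat_sym_prod_flat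
        pullback_vf1_def pullback_vf2_def product_metric_eval 0 del: DIM_prod)
      (simp add: pullback1_def pullback2_def)
qed

lemma killing_sum_sym_tensors:
  assumes K1: "K1 x \<in> sym_tensors 2" and K2: "K2 y \<in> sym_tensors 2"
  shows "killing_sum g1 g2 K1 K2 k \<xi> \<zeta> (x, y) \<in> sym_tensors 2"
proof -
  let ?t = "Lambda_op (gM (x, y)) (\<lambda>Ys. pullback1 K1 (x, y) Ys + pullback2 K2 (x, y) Ys) [] / real DIM('e \<times> 'f)"
  have p: "(\<lambda>Ys. pullback1 K1 (x, y) Ys + pullback2 K2 (x, y) Ys) \<in> sym_tensors 2"
    unfolding pullback1_def pullback2_def
    using sym_tensors_add[OF sym_tensors_pullback[OF K1 linear_fst] sym_tensors_pullback[OF K2 linear_snd]] by simp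
  have "(\<lambda>Xs. ((pullback1 K1 (x, y) Xs + pullback2 K2 (x, y) Xs) + (- ?t) * gM (x, y) Xs) +
     (\<Sum>i<k. (flat (gM (x, y)) (pullback_vf1 (\<xi> i) (x, y)) \<odot> flat (gM (x, y)) (pullback_vf2 (\<zeta> i) (x, y))) Xs)) \<in> sym_tensors 2"
    by (intro sym_tensors_add[OF sym_tensors_add[OF p sym_tensors_scale]] sym_tensors_sum flat_prod_sym_tensors MM.metric_sym finite_lessThan)
  then show ?thesis by (simp add: killing_sum_def trace_free_part_def Let_def)
qed

text \<open>The two factors are orthogonal to each other.\<close>

lemma mixed_trace_zero:
  "(\<Sum>e\<in>onb (gM (x, y)). \<Sum>i<(k::nat). g1 x [u i, fst e] * g2 y [v i, snd e]) = 0"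
proof -
  have 0: "g1 x [0, v] = 0" "g1 x [v, 0] = 0" "g2 y [0, w] = 0" "g2 y [w, 0] = 0" for v w
    using linear_0[OF sym_tensors_2D(2)[OF M1.metric_sym]] linear_0[OF sym_tensors_2D(3)[OF M1.metric_sym]]
      linear_0[OF sym_tensors_2D(2)[OF M2.metric_sym]] linear_0[OF sym_tensors_2D(3)[OF M2.metric_sym]] by auto
  have z: "(\<Sum>e\<in>onb (gM (x, y)). g1 x [a, fst e] * g2 y [b, snd e]) = 0" for a b
  proof -
    have "(\<Sum>e\<in>onb (gM (x, y)). g1 x [a, fst e] * g2 y [b, snd e]) =
      (\<Sum>e\<in>onb (gM (x, y)). gM (x, y) [e, (a, 0)] * gM (x, y) [(0, b), e])"
      by (rule sum.cong) (simp_all add: product_metric_eval 0 sym_tensors_2D(1)[OF M1.metric_sym, of x a])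
    also have "\<dots> = gM (x, y) [(0, b), (a, 0)]"
      by (rule onb_expand_linear[OF MM.metric_sym MM.onb_metric sym_tensors_2D(3)[OF MM.metric_sym]])
    finally show ?thesis by (simp add: product_metric_eval 0)
  qed
  show ?thesis by (subst sum.swap) (simp add: z)
qed

lemma gM_trace: "(\<Sum>e\<in>onb (gM (x, y)). gM (x, y) [e, e]) = real DIM('e \<times> 'f)"
proof -
  have "(\<Sum>e\<in>onb (gM (x, y)). gM (x, y) [e, e]) = (\<Sum>e\<in>onb (gM (x, y)). 1)"
    by (rule sum.cong) (use MM.onb_metric[of "(x, y)"] in \<open>auto simp: orthonormal_basis_def\<close>)
  then show ?thesis using MM.onb_metric[of "(x, y)"] by (simp add: orthonormal_basis_def)
qed

text \<open>A tensor with blocks \<open>K1 - \<tau> g1\<close>, \<open>K2 - \<tau> g2\<close> and \<open>\<Sum> \<xi> \<zeta>\<close> has trace \<open>tr (K1 + K2) - n \<tau>\<close>; for a trace-free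
  one this determines \<open>\<tau>\<close>.\<close>

lemma trace_free_is_killing_sum:
  assumes h: "\<And>z. h z \<in> sym_tensors 2" and tf: "trace_free gM h"
    and K1: "\<And>x. K1 x \<in> sym_tensors 2" and K2: "\<And>y. K2 y \<in> sym_tensors 2"
    and eq: "\<And>x y v w. h (x, y) [(v, w), (v, w)] = K1 x [v, v] + K2 y [w, w] - \<tau> x y * (g1 x [v, v] + g2 y [w, w])
      + 2 * (\<Sum>i<k. g1 x [\<xi> i x, v] * g2 y [\<zeta> i y, w])"
  shows "h = killing_sum g1 g2 K1 K2 k \<xi> \<zeta>"
proof
  fix xy :: "'a \<times> 'b"
  obtain x y where xy: "xy = (x, y)" by force
  let ?O = "onb (gM (x, y))" and ?n = "real DIM('e \<times> 'f)"
  have "0 = Lambda_op (gM (x, y)) (h (x, y)) []" using tf by (simp add: trace_free_def)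
  also have "\<dots> = (\<Sum>e\<in>?O. h (x, y) [(fst e, snd e), (fst e, snd e)])" by (simp add: Lambda_op_nil)
  also have "\<dots> = (\<Sum>e\<in>?O. K1 x [fst e, fst e] + K2 y [snd e, snd e]) - \<tau> x y * (\<Sum>e\<in>?O. gM (x, y) [e, e])
      + 2 * (\<Sum>e\<in>?O. \<Sum>i<k. g1 x [\<xi> i x, fst e] * g2 y [\<zeta> i y, snd e])"
    unfolding eq by (simp add: sum.distrib sum_subtractf sum_distrib_left distrib_left product_metric_eval)
  also have "(\<Sum>e\<in>?O. K1 x [fst e, fst e] + K2 y [snd e, snd e]) = tau K1 K2 x y * ?n"
    using pullback_sum_trace[of K1 x K2 y, OF K1 K2] by (simp add: Lambda_op_nil pullback1_def pullback2_def)
  finally have "(tau K1 K2 x y - \<tau> x y) * ?n = 0" by (simp only: mixed_trace_zero gM_trace) (simp add: algebra_simps)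
  then have \<tau>: "\<tau> x y = tau K1 K2 x y" by (simp add: DIM_product_nonzero del: DIM_prod)
  show "h xy = killing_sum g1 g2 K1 K2 k \<xi> \<zeta> xy"
    unfolding xy
  proof (rule sym_tensors_2_eqI[OF h killing_sum_sym_tensors[of K1 x K2 y, OF K1 K2]])
    fix V
    show "h (x, y) [V, V] = killing_sum g1 g2 K1 K2 k \<xi> \<zeta> (x, y) [V, V]"
      using eq[of x y "fst V" "snd V"]
      by (simp add: killing_sum_eval[of K1 x K2 y, OF K1 K2] \<tau> product_metric_eval sum_distrib_left)
  qed
qed

text \<open>The function \<open>c = s2 a - r2 b\<close> is chosen such that \<open>k\<close> cancels in its derivatives. Once \<open>F1 m = F2 m = 0\<close>, the equations
  for \<open>a\<close>, \<open>b\<close> and for \<open>m\<close> are independent of each other.\<close>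

theorem conformal_killing_decomposition:
  assumes comp: "compact (UNIV :: 'a set)" "compact (UNIV :: 'b set)"
    and conn: "connected (UNIV :: 'a set)" "connected (UNIV :: 'b set)"
    and ck: "conformal_killing_tensor AM gM 2 h" and tf: "trace_free gM h"
  shows "\<exists>K1 K2 k \<xi> \<zeta>. killing_tensor A1 g1 2 K1 \<and> killing_tensor A2 g2 2 K2 \<and>
     (\<forall>i<k. killing_vector_field A1 g1 (\<xi> i) \<and> killing_vector_field A2 g2 (\<zeta> i)) \<and> h = killing_sum g1 g2 K1 K2 k \<xi> \<zeta>"
proof -
  fix x0 :: 'a and y0 :: 'b
  have deg: "2 - 1 = (1::nat)" by simp
  obtain \<kappa> where h: "sym_tensor_field AM 2 h" and \<kappa>: "sym_tensor_field AM 1 \<kappa>"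
    and d: "\<And>z. d_op AM gM h z = L_op (gM z) (\<kappa> z)"
    using ck unfolding conformal_killing_tensor_def deg by blast
  note hs = sym_tensor_fieldD(1)[OF h]
  note hl = sym_tensors_2D(2,3)[OF hs] and \<kappa>l = sym_tensors_1_linear[OF sym_tensor_fieldD(1)[OF \<kappa>]]
  have cyc: "nabla AM gM z X h [Y, Z] + nabla AM gM z Y h [X, Z] + nabla AM gM z Z h [X, Y] =
      2 * (gM z [X, Y] * \<kappa> z [Z] + gM z [X, Z] * \<kappa> z [Y] + gM z [Y, Z] * \<kappa> z [X])" for z X Y Z
    using fun_cong[OF d[of z], of "[X, Y, Z]"] by (simp add: MM.d_op_3[OF h] MM.L_op_3[OF sym_tensor_fieldD(1)[OF \<kappa>]])
  define a where "a = mix h 1 0 1 0"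
  define m where "m = mix h 1 0 0 1"
  define b where "b = mix h 0 1 0 1"
  have sm: "smooth a" "smooth m" "smooth b" unfolding a_def m_def b_def by (intro smooth_mix[OF h])+
  define k1 where "k1 P y = \<kappa> (fst P, y) [(snd P, 0)]" for P y
  define k2 where "k2 x Q = \<kappa> (x, fst Q) [(0, snd Q)]" for x Q
  have g0: "g1 x [v, 0] = 0" "g1 x [0, v] = 0" "g2 y [w, 0] = 0" "g2 y [0, w] = 0" for x v y w
    using linear_0[OF sym_tensors_2D(2)[OF M1.metric_sym]] linear_0[OF sym_tensors_2D(3)[OF M1.metric_sym]]
      linear_0[OF sym_tensors_2D(2)[OF M2.metric_sym]] linear_0[OF sym_tensors_2D(3)[OF M2.metric_sym]] by auto
  \<comment> \<open>the parts of the conformal Killing equation of degrees (3,0), (2,1), (1,2) and (0,3)\<close>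
  have F1a: "F1 a P Q = 2 * r2 P * k1 P (fst Q)" and F2am: "F2 a P Q + 2 * F1 m P Q = 2 * r2 P * k2 (fst P) Q"
    and F1bm: "F1 b P Q + 2 * F2 m P Q = 2 * s2 Q * k1 P (fst Q)" and F2b: "F2 b P Q = 2 * s2 Q * k2 (fst P) Q" for P Q
  proof -
    obtain x v y w where PQ: "P = (x, v)" "Q = (y, w)" by (metis surj_pair)
    let ?z = "(x, y)" and ?V = "(v, 0) :: 'e \<times> 'f" and ?W = "(0, w) :: 'e \<times> 'f"
    note eqs = a_def m_def b_def PQ F_mix[OF h] k1_def k2_def quad_fun_def
    note comm = MM.nabla_2_commute[OF h, of ?z _ ?W ?V]
    show "F1 a P Q = 2 * r2 P * k1 P (fst Q)" using cyc[of ?z ?V ?V ?V] by (simp add: eqs product_metric_eval g0)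
    show "F2 b P Q = 2 * s2 Q * k2 (fst P) Q" using cyc[of ?z ?W ?W ?W] by (simp add: eqs product_metric_eval g0)
    show "F2 a P Q + 2 * F1 m P Q = 2 * r2 P * k2 (fst P) Q"
      using cyc[of ?z ?V ?V ?W] by (simp add: eqs product_metric_eval g0)
    show "F1 b P Q + 2 * F2 m P Q = 2 * s2 Q * k1 P (fst Q)"
      using cyc[of ?z ?V ?W ?W] by (simp add: eqs product_metric_eval g0 comm)
  qed
  define c where "c = (\<lambda>P Q. s2 Q * a P Q - r2 P * b P Q)"
  have c: "smooth c" unfolding c_def by (intro smooth_intros sm)
  note rules = F_mult F_diff F_r2 F_s2 smooth_intros sm
  have F1c: "F1 c P Q = 2 * (r2 P * F2 m P Q)" for P Q
  proof -
    have "F1 c P Q = s2 Q * F1 a P Q - r2 P * F1 b P Q" unfolding c_def by (simp add: rules)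
    also have "\<dots> = 2 * (r2 P * F2 m P Q)" unfolding F1a using F1bm[of P Q] by (simp add: eq_diff_eq[symmetric]) (simp add: algebra_simps)
    finally show ?thesis .
  qed
  have F2c: "F2 c P Q = - 2 * (s2 Q * F1 m P Q)" for P Q
  proof -
    have "F2 c P Q = s2 Q * F2 a P Q - r2 P * F2 b P Q" unfolding c_def by (simp add: rules)
    also have "\<dots> = - 2 * (s2 Q * F1 m P Q)" unfolding F2b using F2am[of P Q] by (simp add: eq_diff_eq[symmetric]) (simp add: algebra_simps)
    finally show ?thesis .
  qed
  have scale: "(t *\<^sub>R v, 0) = t *\<^sub>R (v, 0 :: 'f)" "(0, t *\<^sub>R w) = t *\<^sub>R (0 :: 'e, w)" for t v w by simp_all
  note hscale = linear_scale[OF hl(1)] linear_scale[OF hl(2)]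
  have ha: "a (x, t *\<^sub>R v) Q = t\<^sup>2 * a (x, v) Q" "a P (y, w) = a P (y, w')"
    and hb: "b P (y, t *\<^sub>R w) = t\<^sup>2 * b P (y, w)" "b (x, v) Q = b (x, v') Q"
    and hm: "m (x, t *\<^sub>R v) Q = t * m (x, v) Q" "m P (y, t *\<^sub>R w) = t * m P (y, w)" for x v v' t Q P y w w'
    unfolding a_def b_def m_def mix_def
    by (simp_all add: scale hscale power2_eq_square del: scaleR_Pair)
  have Fm: "F1 m P Q = 0" "F2 m P Q = 0" for P Q
  proof -
    have hc: "c (x, t *\<^sub>R v) Q = t\<^sup>2 * c (x, v) Q" "c P (y, t *\<^sub>R w) = t\<^sup>2 * c P (y, w)" for x v t Q P y w
      unfolding c_def ha(1) hb(1) M1.metric_scale M2.metric_scale hb(2)[of x "t *\<^sub>R v" Q v] ha(2)[of P y "t *\<^sub>R w" w]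
      by (simp_all add: algebra_simps)
    show "F1 m P Q = 0" "F2 m P Q = 0"
      by (rule cauchy_riemann_zero[OF comp c sm(2) F1c F2c hc hm])+
  qed
  have F2a: "F2 a P Q = 2 * r2 P * k2 (fst P) Q" and F1b: "F1 b P Q = 2 * s2 Q * k1 P (fst Q)" for P Q
    using F2am[of P Q] F1bm[of P Q] by (simp_all add: Fm)
  have trace: "(\<Sum>e\<in>onb (g1 (fst P)). a (fst P, e) Q) + (\<Sum>e\<in>onb (g2 (fst Q)). b P (fst Q, e)) = 0" for P Q
    using product_trace[OF sym_tensors_2_bilinear[OF hs[of "(fst P, fst Q)"]], of "fst P" "fst Q"] tf
    by (simp add: trace_free_def Lambda_op_nil[symmetric] a_def b_def mix_def)
  have k0: "k1 (x, 0) y = 0" "k2 x (y, 0) = 0" for x y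
    using linear_0[OF \<kappa>l] by (simp_all add: k1_def k2_def zero_prod_def)
  obtain \<tau> where \<tau>: "smooth (\<lambda>P Q. \<tau> (fst P) (fst Q))"
    "\<And>P Q Q'. a P Q + \<tau> (fst P) (fst Q) * r2 P = a P Q' + \<tau> (fst P) (fst Q') * r2 P"
    "\<And>P P' Q. b P Q + \<tau> (fst P) (fst Q) * s2 Q = b P' Q + \<tau> (fst P') (fst Q) * s2 Q"
    "\<And>P Q. F1 (\<lambda>P Q. a P Q + \<tau> (fst P) (fst Q) * r2 P) P Q = 0"
    "\<And>P Q. F2 (\<lambda>P Q. b P Q + \<tau> (fst P) (fst Q) * s2 Q) P Q = 0"
    using potential[OF conn sm(1,3) ha(2) hb(2) F1a F2a F1b F2b trace k0] by (elim exE conjE) (rule that, auto)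
  \<comment> \<open>\<open>K1\<close> is \<open>a + \<tau> g1\<close>, which is independent of \<open>y\<close>; so it may be read off at \<open>y0\<close>, where it is a tensor field on
    the first factor\<close>
  define K1 where "K1 x Xs = h (x, y0) (map (\<lambda>v. (v, 0)) Xs) + \<tau> x y0 * g1 x Xs" for x Xs
  define K2 where "K2 y Xs = h (x0, y) (map (\<lambda>w. (0, w)) Xs) + \<tau> x0 y * g2 y Xs" for y Xs
  have lin: "linear (\<lambda>v. (v, 0) :: 'e \<times> 'f)" "linear (\<lambda>w. (0, w) :: 'e \<times> 'f)" by (auto intro: linearI)
  have K1s: "K1 x \<in> sym_tensors 2" and K2s: "K2 y \<in> sym_tensors 2" for x y
    unfolding K1_def[abs_def] K2_def[abs_def]
    by (intro sym_tensors_add sym_tensors_scale sym_tensors_pullback[OF hs lin(1)] sym_tensors_pullback[OF hs lin(2)] M1.metric_sym M2.metric_sym)+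
  have K1f: "sym_tensor_field A1 2 K1"
    unfolding sym_tensor_field_def chart_img_def[symmetric]
  proof (intro conjI allI impI K1s)
    fix x and Xs :: "'e list" assume "length Xs = 2"
    then obtain u v where Xs: "Xs = [u, v]" using length_2_cases by blast
    note o = atlas_chart(2)[OF M1.atlas, of x] and c = atlas_chart(3,1,10)[OF M2.atlas]
    have "tsmooth A1 (\<lambda>P. \<tau> (fst P) y0)" using smooth_slice1[OF \<tau>(1), of "(y0, 0)"] by simp
    then have "smooth_on (chart_img A1 x) (\<lambda>z. \<tau> (chart_inv A1 x z) y0)" using M1.tsmooth_base_iff[of "\<lambda>x. \<tau> x y0"] by simp
    moreover have "smooth_on (chart_img A1 x) (\<lambda>z. local_rep AM h (x, y0) (z, chart_center A2 y0) [(u, 0), (v, 0)])"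
      by (rule smooth_on_compose[OF o smooth_on_Pair[OF o smooth_on_id[OF o] smooth_on_const[OF o]] local_rep_product_smooth[OF h]])
        (use c in auto)
    ultimately have "smooth_on (chart_img A1 x) (\<lambda>z. local_rep AM h (x, y0) (z, chart_center A2 y0) [(u, 0), (v, 0)]
        + \<tau> (chart_inv A1 x z) y0 * local_rep A1 g1 x z [u, v])"
      by (intro smooth_on_add smooth_on_mult o M1.gx_smooth)
    then show "smooth_on (chart_img A1 x) (\<lambda>z. local_rep A1 K1 x z Xs)"
      by (rule smooth_on_cong[OF o, rotated])
        (use c in \<open>simp add: product_local_rep Xs K1_def local_rep_tangent_iso[of A1] tangent_iso_center[OF M2.atlas]\<close>)
  qed
  have K2f: "sym_tensor_field A2 2 K2"
    unfolding sym_tensor_field_def chart_img_def[symmetric]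
  proof (intro conjI allI impI K2s)
    fix y and Xs :: "'f list" assume "length Xs = 2"
    then obtain u v where Xs: "Xs = [u, v]" using length_2_cases by blast
    note o = atlas_chart(2)[OF M2.atlas, of y] and c = atlas_chart(3,1,10)[OF M1.atlas]
    have "tsmooth A2 (\<lambda>Q. \<tau> x0 (fst Q))" using smooth_slice2[OF \<tau>(1), of "(x0, 0)"] by simp
    then have "smooth_on (chart_img A2 y) (\<lambda>z. \<tau> x0 (chart_inv A2 y z))" using M2.tsmooth_base_iff[of "\<lambda>y. \<tau> x0 y"] by simp
    moreover have "smooth_on (chart_img A2 y) (\<lambda>z. local_rep AM h (x0, y) (chart_center A1 x0, z) [(0, u), (0, v)])"
      by (rule smooth_on_compose[OF o smooth_on_Pair[OF o smooth_on_const[OF o] smooth_on_id[OF o]] local_rep_product_smooth[OF h]])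
        (use c in auto)
    ultimately have "smooth_on (chart_img A2 y) (\<lambda>z. local_rep AM h (x0, y) (chart_center A1 x0, z) [(0, u), (0, v)]
        + \<tau> x0 (chart_inv A2 y z) * local_rep A2 g2 y z [u, v])"
      by (intro smooth_on_add smooth_on_mult o M2.gx_smooth)
    then show "smooth_on (chart_img A2 y) (\<lambda>z. local_rep A2 K2 y z Xs)"
      by (rule smooth_on_cong[OF o, rotated])
        (use c in \<open>simp add: product_local_rep Xs K2_def local_rep_tangent_iso[of A2] tangent_iso_center[OF M1.atlas]\<close>)
  qed
  have qK1: "quad_fun K1 P = a P Q + \<tau> (fst P) (fst Q) * r2 P" for P Q
    unfolding \<tau>(2)[of P Q "(y0, 0)"] by (simp add: quad_fun_def K1_def a_def mix_def)
  have qK2: "quad_fun K2 Q = b P Q + \<tau> (fst P) (fst Q) * s2 Q" for P Q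
    unfolding \<tau>(3)[of P Q "(x0, 0)"] by (simp add: quad_fun_def K2_def b_def mix_def)
  have kill1: "killing_tensor A1 g1 2 K1"
    unfolding M1.killing_tensor_2_iff using K1f \<tau>(4)[of _ "(y0, 0)"] by (simp add: geo1_def qK1[of _ "(y0, 0)", abs_def])
  have kill2: "killing_tensor A2 g2 2 K2"
    unfolding M2.killing_tensor_2_iff using K2f \<tau>(5)[of "(x0, 0)"] by (simp add: geo2_def qK2[of _ "(x0, 0)", abs_def])
  \<comment> \<open>by \<open>Fm\<close>, the sections of \<open>m\<close> in both variables are Killing forms\<close>
  have "M1.killing_form (\<lambda>P. m P Q)" for Q
    unfolding M1.killing_form_def
    using smooth_slice1[OF sm(2)] Fm(1) linear_compose[OF lin(1) hl(1)] by (auto simp: geo1_def m_def mix_def comp_def)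
  moreover have "m P \<in> Collect M2.killing_form" for P
    unfolding M2.killing_form_def
    using smooth_slice2[OF sm(2)] Fm(2) linear_compose[OF lin(2) hl(2)] by (auto simp: geo2_def m_def mix_def comp_def)
  ultimately have "\<exists>(k::nat) \<psi> \<phi>. (\<forall>i<k. M1.killing_form (\<psi> i) \<and> \<phi> i \<in> Collect M2.killing_form) \<and>
      (\<forall>P Q. m P Q = (\<Sum>i<k. \<psi> i P * \<phi> i Q))"
    by (intro M1.killing_forms_finite_rank[OF conn(1)]) (auto intro: M2.killing_form_combination)
  then obtain k :: nat and \<psi> \<phi> where "\<forall>i<k. M1.killing_form (\<psi> i) \<and> \<phi> i \<in> Collect M2.killing_form"
    and m: "\<And>P Q. m P Q = (\<Sum>i<k. \<psi> i P * \<phi> i Q)" by blast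
  then have \<psi>\<phi>: "\<And>i. i < k \<Longrightarrow> M1.killing_form (\<psi> i)" "\<And>i. i < k \<Longrightarrow> M2.killing_form (\<phi> i)" by auto
  have "\<forall>i. \<exists>\<xi>. i < k \<longrightarrow> killing_vector_field A1 g1 \<xi> \<and> (\<forall>x v. g1 x [\<xi> x, v] = \<psi> i (x, v))"
    using M1.killing_vector_field_of_form[OF \<psi>\<phi>(1)] by blast
  then obtain \<xi> where \<xi>: "\<And>i. i < k \<Longrightarrow> killing_vector_field A1 g1 (\<xi> i)"
    "\<And>i x v. i < k \<Longrightarrow> g1 x [\<xi> i x, v] = \<psi> i (x, v)" by metis
  have "\<forall>i. \<exists>\<zeta>. i < k \<longrightarrow> killing_vector_field A2 g2 \<zeta> \<and> (\<forall>y w. g2 y [\<zeta> y, w] = \<phi> i (y, w))"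
    using M2.killing_vector_field_of_form[OF \<psi>\<phi>(2)] by blast
  then obtain \<zeta> where \<zeta>: "\<And>i. i < k \<Longrightarrow> killing_vector_field A2 g2 (\<zeta> i)"
    "\<And>i y w. i < k \<Longrightarrow> g2 y [\<zeta> i y, w] = \<phi> i (y, w)" by metis
  have "h = killing_sum g1 g2 K1 K2 k \<xi> \<zeta>"
  proof (rule trace_free_is_killing_sum[OF hs tf K1s K2s, where \<tau> = \<tau>])
    fix x y v w
    have "h (x, y) [(v, w), (v, w)] = a (x, v) (y, w) + 2 * m (x, v) (y, w) + b (x, v) (y, w)"
    proof -
      have "(v, w) = (v, 0) + (0, w)" by simp
      then have "h (x, y) [(v, w), (v, w)] = h (x, y) [(v, 0), (v, 0)] + h (x, y) [(v, 0), (0, w)]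
         + (h (x, y) [(0, w), (v, 0)] + h (x, y) [(0, w), (0, w)])"
        by (metis linear_add[OF hl(1)] linear_add[OF hl(2)])
      then show ?thesis using sym_tensors_2D(1)[OF hs, of "(x, y)" "(0, w)" "(v, 0)"] by (simp add: a_def b_def m_def mix_def)
    qed
    moreover have "m (x, v) (y, w) = (\<Sum>i<k. g1 x [\<xi> i x, v] * g2 y [\<zeta> i y, w])"
      unfolding m by (rule sum.cong) (use \<xi> \<zeta> in auto)
    ultimately show "h (x, y) [(v, w), (v, w)] = K1 x [v, v] + K2 y [w, w] - \<tau> x y * (g1 x [v, v] + g2 y [w, w])
      + 2 * (\<Sum>i<k. g1 x [\<xi> i x, v] * g2 y [\<zeta> i y, w])"
      using qK1[of "(x, v)" "(y, w)"] qK2[of "(y, w)" "(x, v)"] by (simp add: quad_fun_def algebra_simps)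
  qed
  with kill1 kill2 \<xi>(1) \<zeta>(1) show ?thesis by blast
qed

end

section \<open>Sums of Killing tensors are conformal Killing tensors\<close>

context riem
begin

lemma geo_base_center:
  assumes "tsmooth A (\<lambda>P. f (fst P))"
  shows "geo A g (\<lambda>P. f (fst P)) (x, v) = frechet_derivative (\<lambda>z. f (chart_inv A x z)) (at (chart_center A x)) v"
  using geo_base[OF assms atlas_chart(3)[OF atlas]] by (simp add: tlift_center[OF atlas])

lemma geo_base_linear:
  assumes f: "tsmooth A (\<lambda>P. f (fst P))"
  shows "linear (\<lambda>v. geo A g (\<lambda>P. f (fst P)) (x, v))"
  unfolding geo_base_center[OF f]
  using f has_derivative_linear[OF smooth_on_has_derivative[OF _ atlas_chart(3)[OF atlas]]] unfolding tsmooth_base_iff by blast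

end

context riem_pair
begin

lemma smooth_sum: "(\<And>i. i < k \<Longrightarrow> smooth (\<Phi> i)) \<Longrightarrow> smooth (\<lambda>P Q. \<Sum>i<(k::nat). \<Phi> i P Q)"
  by (induction k) (simp_all add: smooth_const smooth_add)

lemma F_sum:
  assumes "\<And>i. i < (k::nat) \<Longrightarrow> smooth (\<Phi> i)"
  shows "F1 (\<lambda>P Q. \<Sum>i<k. \<Phi> i P Q) P Q = (\<Sum>i<k. F1 (\<Phi> i) P Q)"
    and "F2 (\<lambda>P Q. \<Sum>i<k. \<Phi> i P Q) P Q = (\<Sum>i<k. F2 (\<Phi> i) P Q)"
  using assms by (induction k) (simp_all add: F_const F_add smooth_sum)

text \<open>Only the term \<open>- \<tau> g\<close> is not constant along the geodesic flow of the product. As \<open>g\<close> is, the derivative is \<open>- d\<tau> g\<close>, so that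
  \<open>k = - d\<tau> / 2\<close>.\<close>

theorem killing_sum_conformal:
  assumes K1: "killing_tensor A1 g1 2 K1" and K2: "killing_tensor A2 g2 2 K2"
    and kv: "\<forall>i<k. killing_vector_field A1 g1 (\<xi> i) \<and> killing_vector_field A2 g2 (\<zeta> i)"
  shows "conformal_killing_tensor AM gM 2 (killing_sum g1 g2 K1 K2 k \<xi> \<zeta>)"
    and "trace_free gM (killing_sum g1 g2 K1 K2 k \<xi> \<zeta>)"
proof -
  let ?H = "killing_sum g1 g2 K1 K2 k \<xi> \<zeta>" and ?n = "real DIM('e \<times> 'f)"
  have K1f: "sym_tensor_field A1 2 K1" and K2f: "sym_tensor_field A2 2 K2"
    and geoK: "\<And>P. geo A1 g1 (quad_fun K1) P = 0" "\<And>Q. geo A2 g2 (quad_fun K2) Q = 0"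
    using K1 K2 M1.killing_tensor_2_iff M2.killing_tensor_2_iff by auto
  note K1s = sym_tensor_fieldD(1)[OF K1f] and K2s = sym_tensor_fieldD(1)[OF K2f]
  define \<psi> where "\<psi> i P = g1 (fst P) [\<xi> i (fst P), snd P]" for i P
  define \<phi> where "\<phi> i Q = g2 (fst Q) [\<zeta> i (fst Q), snd Q]" for i Q
  have \<psi>: "M1.killing_form (\<psi> i)" and \<phi>: "M2.killing_form (\<phi> i)" if "i < k" for i
    using kv that M1.killing_form_of_vector_field M2.killing_form_of_vector_field by (auto simp: \<psi>_def[abs_def] \<phi>_def[abs_def])
  have Hs: "?H z \<in> sym_tensors 2" for z
    using killing_sum_sym_tensors[of K1 "fst z" K2 "snd z", OF K1s K2s] by simp
  have H: "?H (x, y) [U, V] = K1 x [fst U, fst V] + K2 y [snd U, snd V] - tau K1 K2 x y * gM (x, y) [U, V] +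
    (\<Sum>i<k. \<psi> i (x, fst U) * \<phi> i (y, snd V) + \<psi> i (x, fst V) * \<phi> i (y, snd U))" for x y U V
    unfolding \<psi>_def \<phi>_def fst_conv snd_conv by (rule killing_sum_eval[of K1 x K2 y, OF K1s K2s])
  define t1 where "t1 x = (1 / ?n) * (\<Sum>e\<in>onb (g1 x). K1 x [e, e])" for x
  define t2 where "t2 y = (1 / ?n) * (\<Sum>e\<in>onb (g2 y). K2 y [e, e])" for y
  have tau: "tau K1 K2 x y = t1 x + t2 y" for x y
    by (simp add: tau_def t1_def t2_def add_divide_distrib)
  have t1s: "tsmooth A1 (\<lambda>P. t1 (fst P))" and t2s: "tsmooth A2 (\<lambda>Q. t2 (fst Q))"
    unfolding t1_def t2_def
    by (intro M1.tsmooth_mult M1.tsmooth_const M1.tsmooth_trace K1f, intro M2.tsmooth_mult M2.tsmooth_const M2.tsmooth_trace K2f)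
  have t1c: "smooth_on (chart_img A1 x) (\<lambda>z. t1 (chart_inv A1 x z))" and t2c: "smooth_on (chart_img A2 y) (\<lambda>z. t2 (chart_inv A2 y z))" for x y
    using t1s t2s unfolding M1.tsmooth_base_iff M2.tsmooth_base_iff by blast+

  show "trace_free gM ?H"
    unfolding trace_free_def
  proof (intro allI)
    fix z :: "'a \<times> 'b" and Xs :: "('e \<times> 'f) list"
    obtain x y where z: "z = (x, y)" by force
    show "Lambda_op (gM z) (?H z) Xs = 0"
    proof (cases Xs)
      case Nil
      have "(\<Sum>e\<in>onb (gM (x, y)). ?H (x, y) [e, e]) =
          (\<Sum>e\<in>onb (gM (x, y)). K1 x [fst e, fst e] + K2 y [snd e, snd e])
          - tau K1 K2 x y * (\<Sum>e\<in>onb (gM (x, y)). gM (x, y) [e, e])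
          + 2 * (\<Sum>e\<in>onb (gM (x, y)). \<Sum>i<k. g1 x [\<xi> i x, fst e] * g2 y [\<zeta> i y, snd e])"
        unfolding H by (simp add: sum.distrib sum_subtractf sum_distrib_left \<psi>_def \<phi>_def)
      moreover have "(\<Sum>e\<in>onb (gM (x, y)). K1 x [fst e, fst e] + K2 y [snd e, snd e]) = tau K1 K2 x y * ?n"
        using pullback_sum_trace[of K1 x K2 y, OF K1s K2s] by (simp add: Lambda_op_nil pullback1_def pullback2_def)
      ultimately show ?thesis by (simp only: Nil z Lambda_op_nil mixed_trace_zero gM_trace)
    next
      case (Cons X Ys)
      then show ?thesis using sym_tensors_length[OF Hs] by (simp add: Lambda_op_def contract_def)
    qed
  qed

  have Hf: "sym_tensor_field AM 2 ?H"
    unfolding sym_tensor_field_def chart_img_def[symmetric]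
  proof (intro conjI allI impI Hs)
    fix xy :: "'a \<times> 'b" and Xs :: "('e \<times> 'f) list" assume "length Xs = 2"
    then obtain U V where Xs: "Xs = [U, V]" using length_2_cases by blast
    obtain x y where xy: "xy = (x, y)" by force
    let ?S = "chart_img A1 x \<times> chart_img A2 y"
    have o: "open ?S" by (rule open_product_img)
    have fst: "smooth_on ?S (\<lambda>z. f (fst z))" if "smooth_on (chart_img A1 x) f" for f :: "'e \<Rightarrow> real"
      by (rule smooth_on_compose[OF o smooth_on_fst[OF o smooth_on_id[OF o]] that]) auto
    have snd: "smooth_on ?S (\<lambda>z. f (snd z))" if "smooth_on (chart_img A2 y) f" for f :: "'f \<Rightarrow> real"
      by (rule smooth_on_compose[OF o smooth_on_snd[OF o smooth_on_id[OF o]] that]) auto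
    have "smooth_on ?S (\<lambda>z. local_rep A1 K1 x (fst z) [fst U, fst V] + local_rep A2 K2 y (snd z) [snd U, snd V]
       - (t1 (chart_inv A1 x (fst z)) + t2 (chart_inv A2 y (snd z))) *
           (local_rep A1 g1 x (fst z) [fst U, fst V] + local_rep A2 g2 y (snd z) [snd U, snd V])
       + (\<Sum>i<k. \<psi> i (tlift A1 x (fst z, fst U)) * \<phi> i (tlift A2 y (snd z, snd V)) +
           \<psi> i (tlift A1 x (fst z, fst V)) * \<phi> i (tlift A2 y (snd z, snd U))))"
      by (intro smooth_on_add[OF o] smooth_on_diff[OF o] smooth_on_mult[OF o] smooth_on_sum[OF o]
          fst[OF sym_tensor_fieldD(2)[OF K1f]] snd[OF sym_tensor_fieldD(2)[OF K2f]]
          fst[OF M1.gx_smooth] snd[OF M2.gx_smooth] fst[OF t1c] snd[OF t2c]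
          fst[OF M1.killing_form_chart(1)[OF \<psi>]] snd[OF M2.killing_form_chart(1)[OF \<phi>]]) auto
    then show "smooth_on (chart_img AM xy) (\<lambda>z. local_rep AM ?H xy z Xs)"
      unfolding xy product_chart
    proof (rule smooth_on_cong[OF o, rotated])
      fix z assume "z \<in> ?S"
      then have z: "fst z \<in> chart_img A1 x" "snd z \<in> chart_img A2 y" by auto
      show "local_rep A1 K1 x (fst z) [fst U, fst V] + local_rep A2 K2 y (snd z) [snd U, snd V]
       - (t1 (chart_inv A1 x (fst z)) + t2 (chart_inv A2 y (snd z))) *
           (local_rep A1 g1 x (fst z) [fst U, fst V] + local_rep A2 g2 y (snd z) [snd U, snd V])
       + (\<Sum>i<k. \<psi> i (tlift A1 x (fst z, fst U)) * \<phi> i (tlift A2 y (snd z, snd V)) +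
           \<psi> i (tlift A1 x (fst z, fst V)) * \<phi> i (tlift A2 y (snd z, snd U))) = local_rep AM ?H (x, y) z Xs"
        unfolding product_local_rep[OF z] Xs
        by (simp add: H tau product_metric_eval local_rep_tangent_iso tlift_def)
    qed
  qed

  define \<kappa> where "\<kappa> z Xs = (case Xs of [V] \<Rightarrow> - (1/2) * (geo A1 g1 (\<lambda>P. t1 (fst P)) (fst z, fst V) +
      geo A2 g2 (\<lambda>Q. t2 (fst Q)) (snd z, snd V)) | _ \<Rightarrow> 0)" for z and Xs :: "('e \<times> 'f) list"
  have \<kappa>1: "\<kappa> z [V] = - (1/2) * (geo A1 g1 (\<lambda>P. t1 (fst P)) (fst z, fst V) + geo A2 g2 (\<lambda>Q. t2 (fst Q)) (snd z, snd V))" for z V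
    by (simp add: \<kappa>_def)
  have \<kappa>: "sym_tensor_field AM 1 \<kappa>"
    unfolding sym_tensor_field_def chart_img_def[symmetric]
  proof (intro conjI allI impI)
    fix z :: "'a \<times> 'b"
    note l1 = linear_compose[OF linear_fst M1.geo_base_linear[OF t1s], unfolded comp_def]
    note l2 = linear_compose[OF linear_snd M2.geo_base_linear[OF t2s], unfolded comp_def]
    show "\<kappa> z \<in> sym_tensors 1"
    proof (rule sym_tensors_1I)
      show "\<kappa> z Xs = 0" if "length Xs \<noteq> 1" for Xs using that by (auto simp: \<kappa>_def split: list.splits)
      show "linear (\<lambda>V. \<kappa> z [V])"
        unfolding \<kappa>1 using linear_compose_scale_right[OF linear_compose_add[OF l1 l2], of "- (1/2)"] by simp
    qed
  next
    fix xy :: "'a \<times> 'b" and Xs :: "('e \<times> 'f) list" assume "length Xs = 1"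
    then obtain V where Xs: "Xs = [V]" by (auto simp: length_Suc_conv)
    obtain x y where xy: "xy = (x, y)" by force
    let ?S = "chart_img A1 x \<times> chart_img A2 y"
    have o: "open ?S" by (rule open_product_img)
    have "smooth_on ?S (\<lambda>z. frechet_derivative (\<lambda>z. t1 (chart_inv A1 x z)) (at (fst z)) (fst V))"
      by (rule smooth_on_compose[OF o smooth_on_fst[OF o smooth_on_id[OF o]] smooth_on_deriv[OF t1c]]) auto
    moreover have "smooth_on ?S (\<lambda>z. frechet_derivative (\<lambda>z. t2 (chart_inv A2 y z)) (at (snd z)) (snd V))"
      by (rule smooth_on_compose[OF o smooth_on_snd[OF o smooth_on_id[OF o]] smooth_on_deriv[OF t2c]]) auto
    ultimately have "smooth_on ?S (\<lambda>z. - (1/2) * (frechet_derivative (\<lambda>z. t1 (chart_inv A1 x z)) (at (fst z)) (fst V)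
       + frechet_derivative (\<lambda>z. t2 (chart_inv A2 y z)) (at (snd z)) (snd V)))"
      by (intro smooth_on_cmult[OF o] smooth_on_add[OF o])
    then show "smooth_on (chart_img AM xy) (\<lambda>z. local_rep AM \<kappa> xy z Xs)"
      unfolding xy product_chart
    proof (rule smooth_on_cong[OF o, rotated])
      fix z assume "z \<in> ?S"
      then have z: "fst z \<in> chart_img A1 x" "snd z \<in> chart_img A2 y" by auto
      show "- (1/2) * (frechet_derivative (\<lambda>z. t1 (chart_inv A1 x z)) (at (fst z)) (fst V)
       + frechet_derivative (\<lambda>z. t2 (chart_inv A2 y z)) (at (snd z)) (snd V)) = local_rep AM \<kappa> (x, y) z Xs"
        unfolding product_local_rep[OF z] Xs list.map \<kappa>1
        using M1.geo_base[OF t1s z(1), of "fst V"] M2.geo_base[OF t2s z(2), of "snd V"] by (simp add: tlift_def)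
    qed
  qed

  have "nabla AM gM z X ?H [X, X] = 2 * gM z [X, X] * \<kappa> z [X]" for z X
  proof -
    obtain x y where z: "z = (x, y)" by force
    obtain v w where X: "X = (v, w)" by force
    let ?P = "(x, v)" and ?Q = "(y, w)"
    have sm: "smooth (\<lambda>P Q. quad_fun K1 P)" "smooth (\<lambda>P Q. quad_fun K2 Q)"
      "smooth (\<lambda>P Q. t1 (fst P))" "smooth (\<lambda>P Q. t2 (fst Q))"
      by (intro smooth_first smooth_second tsmooth_quad_fun M1.atlas M2.atlas K1f K2f t1s t2s)+
    have sm\<psi>: "smooth (\<lambda>P Q. \<psi> i P)" "smooth (\<lambda>P Q. \<phi> i Q)" if "i < k" for i
      using \<psi>[OF that] \<phi>[OF that] by (auto simp: M1.killing_form_def M2.killing_form_def intro: smooth_first smooth_second)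
    have sms: "smooth (\<lambda>P Q. 2 * (\<psi> i P * \<phi> i Q))" if "i < k" for i
      by (intro smooth_intros sm\<psi> that)
    have F0: "F1 (\<lambda>P Q. 2 * (\<psi> i P * \<phi> i Q)) ?P ?Q = 0" "F2 (\<lambda>P Q. 2 * (\<psi> i P * \<phi> i Q)) ?P ?Q = 0" if "i < k" for i
      using \<psi>[OF that] \<phi>[OF that] sm\<psi>[OF that]
      by (simp_all add: F_mult smooth_intros F_const F_first F_second M1.killing_form_def M2.killing_form_def)
    have Fs: "F1 (\<lambda>P Q. \<Sum>i<k. 2 * (\<psi> i P * \<phi> i Q)) ?P ?Q = 0" "F2 (\<lambda>P Q. \<Sum>i<k. 2 * (\<psi> i P * \<phi> i Q)) ?P ?Q = 0"
      using F_sum[where k = k and \<Phi> = "\<lambda>i P Q. 2 * (\<psi> i P * \<phi> i Q)", OF sms] F0 by simp_all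
    have mix: "mix ?H 1 1 1 1 = (\<lambda>P Q. quad_fun K1 P + quad_fun K2 Q - (t1 (fst P) + t2 (fst Q)) * (r2 P + s2 Q)
        + (\<Sum>i<k. 2 * (\<psi> i P * \<phi> i Q)))"
      by (simp add: fun_eq_iff mix_def H tau product_metric_eval quad_fun_def mult.commute)
    have "nabla AM gM z X ?H [X, X] = nabla AM gM z (v, 0) ?H [X, X] + nabla AM gM z (0, w) ?H [X, X]"
      using linear_add[OF MM.nabla_linear_direction[OF Hf, of "[X, X]" z], of "(v, 0)" "(0, w)"] by (simp add: X)
    also have "\<dots> = F1 (mix ?H 1 1 1 1) ?P ?Q + F2 (mix ?H 1 1 1 1) ?P ?Q"
      by (simp add: F_mix[OF Hf] z X)
    also have "\<dots> = - (geo A1 g1 (\<lambda>P. t1 (fst P)) ?P + geo A2 g2 (\<lambda>Q. t2 (fst Q)) ?Q) * (r2 ?P + s2 ?Q)"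
      unfolding mix
      by (simp add: F_add F_diff F_mult F_r2 F_s2 F_first F_second smooth_intros sm smooth_sum[OF sms] Fs geoK)
        (simp add: algebra_simps)
    finally show ?thesis by (simp add: z X \<kappa>1 product_metric_eval quad_fun_def) (simp add: field_simps)
  qed
  then show "conformal_killing_tensor AM gM 2 ?H"
    unfolding MM.conformal_killing_iff using Hf \<kappa> by blast
qed

end

theorem theorem5p1:
  fixes A1 :: "('a::t2_space, 'e::euclidean_space) atlas"
    and A2 :: "('b::t2_space, 'f::euclidean_space) atlas"
    and g1 :: "('a, 'e) tensor_field" and g2 :: "('b, 'f) tensor_field"
  assumes "riemannian_manifold A1 g1" and "compact (UNIV :: 'a set)"
    and "riemannian_manifold A2 g2" and "compact (UNIV :: 'b set)"
  shows "(connected (UNIV :: 'a set) \<and> connected (UNIV :: 'b set) \<longrightarrow>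
      (\<forall>h. conformal_killing_tensor (product_atlas A1 A2) (product_metric g1 g2) 2 h \<and>
           trace_free (product_metric g1 g2) h \<longrightarrow>
        (\<exists>K1 K2 k \<xi> \<zeta>. killing_tensor A1 g1 2 K1 \<and> killing_tensor A2 g2 2 K2 \<and>
           (\<forall>i<k. killing_vector_field A1 g1 (\<xi> i) \<and> killing_vector_field A2 g2 (\<zeta> i)) \<and>
           h = killing_sum g1 g2 K1 K2 k \<xi> \<zeta>))) \<and>
    (\<forall>K1 K2 k \<xi> \<zeta>. killing_tensor A1 g1 2 K1 \<and> killing_tensor A2 g2 2 K2 \<and>
        (\<forall>i<k. killing_vector_field A1 g1 (\<xi> i) \<and> killing_vector_field A2 g2 (\<zeta> i)) \<longrightarrow>
      conformal_killing_tensor (product_atlas A1 A2) (product_metric g1 g2) 2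
        (killing_sum g1 g2 K1 K2 k \<xi> \<zeta>) \<and>
      trace_free (product_metric g1 g2) (killing_sum g1 g2 K1 K2 k \<xi> \<zeta>))"
proof -
  interpret riem_pair A1 g1 A2 g2 by unfold_locales (rule assms(1), rule assms(3))
  show ?thesis
  proof (intro conjI impI allI)
    fix h
    assume "connected (UNIV :: 'a set) \<and> connected (UNIV :: 'b set)" and "conformal_killing_tensor AM gM 2 h \<and> trace_free gM h"
    then show "\<exists>K1 K2 k \<xi> \<zeta>. killing_tensor A1 g1 2 K1 \<and> killing_tensor A2 g2 2 K2 \<and>
           (\<forall>i<k. killing_vector_field A1 g1 (\<xi> i) \<and> killing_vector_field A2 g2 (\<zeta> i)) \<and>
           h = killing_sum g1 g2 K1 K2 k \<xi> \<zeta>"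
      by (intro conformal_killing_decomposition assms) auto
  next
    fix K1 K2 and k :: nat and \<xi> \<zeta>
    assume *: "killing_tensor A1 g1 2 K1 \<and> killing_tensor A2 g2 2 K2 \<and>
        (\<forall>i<k. killing_vector_field A1 g1 (\<xi> i) \<and> killing_vector_field A2 g2 (\<zeta> i))"
    show "conformal_killing_tensor AM gM 2 (killing_sum g1 g2 K1 K2 k \<xi> \<zeta>)"
      by (rule killing_sum_conformal(1)) (use * in auto)
    show "trace_free gM (killing_sum g1 g2 K1 K2 k \<xi> \<zeta>)"
      by (rule killing_sum_conformal(2)) (use * in auto)
  qed
qed

end
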